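(* Consider the massive MIMO system described in the context, with $N_r=\beta N_t$, $\beta>1$ fixed, $\eta=1/\sigma^2>0$ fixed, Hermitian Toeplitz channel covariance matrices $\mathbf\Sigma=\mathbf\Sigma_{N_t}$, $[\mathbf\Sigma]_{mn}=\sigma(m-n)$, with $\sum_{k\ge0}|\sigma(k)|^2<\infty$ and $\operatorname{ess\,inf}_\omega s_\Sigma(\omega)>0$, where $s_\Sigma(\omega)=\sum_{k=-\infty}^\infty\sigma(k)e^{-jk\omega}$, and with precoder $$\widetilde{\mathbf F}=\frac1{\sqrt{\mathrm{tr}(\mathbf\Lambda^{-1/2})}}\,\mathbf W\mathbf\Lambda^{-1/4}\widetilde{\mathbf V}_2,$$ where $\mathbf\Sigma=\mathbf W\mathbf\Lambda\mathbf W^H$ is the eigenvalue decomposition ($\mathbf W$ unitary, $\mathbf\Lambda$ diagonal with the eigenvalues of $\mathbf\Sigma$ in nondecreasing order) and $\widetilde{\mathbf V}_2$ is the $N_t\times N_t$ normalized DFT matrix. Let the instantaneous SNR of the $k$-th sub-channel be $$\tau_k=\frac1{\sigma^2\big[(\widetilde{\mathbf F}^H\mathbf H^H\mathbf H\widetilde{\mathbf F})^{-1}\big]_{kk}},\qquad k=1,\dots,N_t.$$ Then, for $k=1,2,\dots,N_t$, $$\lim_{N_t\to\infty}\tau_k=\frac{\eta(\beta-1)}{\Lambda^2}\quad\text{almost surely},\qquad\text{where }\ \Lambda=\frac1{2\pi}\int_0^{2\pi}\frac{d\omega}{\sqrt{s_\Sigma(\omega)}}.$$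
   Context: For each $N_t$ (with $N_r=\beta N_t$ an integer), $\mathbf H$ is an $N_r\times N_t$ random matrix whose rows $\mathbf h_1^T,\dots,\mathbf h_{N_r}^T$ are i.i.d. zero-mean circularly-symmetric complex Gaussian with $\mathbb E[(\mathbf h_m^T)^H\mathbf h_m^T]=\mathbf\Sigma$; the matrices for different $N_t$ are defined on a common probability space. $\sigma^2>0$ is the noise variance (unrelated to the sequence $\sigma(\cdot)$). $\sigma:\mathbb Z\to\mathbb C$ is a fixed sequence (independent of $N_t$) with $\sigma(-k)=\sigma(k)^*$, and $s_\Sigma$ is the real-valued function with Fourier coefficients $\sigma(k)=\frac1{2\pi}\int_0^{2\pi}s_\Sigma(\omega)e^{jk\omega}d\omega$; $\operatorname{ess\,inf}$ is with respect to Lebesgue measure on $[0,2\pi]$. The normalized DFT matrix has $(m,n)$ entry $N_t^{-1/2}e^{-2\pi j(m-1)(n-1)/N_t}$ (with $j=\sqrt{-1}$). The convergence is understood for each fixed index $k$ as $N_t\to\infty$. *)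

theory Defs
  imports
    "HOL-Probability.Probability"
    "Jordan_Normal_Form.Schur_Decomposition"
    "Jordan_Normal_Form.Gauss_Jordan_Elimination"
begin

section \<open>Circularly-symmetric complex Gaussian vectors\<close>

text \<open>Degenerate (almost surely constant) variables count as Gaussian.\<close>

definition gaussian_var :: "'w measure \<Rightarrow> ('w \<Rightarrow> real) \<Rightarrow> bool" where
  "gaussian_var M X \<longleftrightarrow> X \<in> borel_measurable M \<and>
     ((\<exists>c. AE x in M. X x = c) \<or>
      (\<exists>\<mu> s. 0 < s \<and> distributed M lborel X (normal_density \<mu> s)))"

text \<open>A random vector in $\mathbb{C}^n$ is given by its coordinate functions with index \<open>i < n\<close>;
  as a random element it lives in the product space below.\<close>

abbreviation cvec_space :: "nat \<Rightarrow> (nat \<Rightarrow> complex) measure" where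
  "cvec_space n \<equiv> Pi\<^sub>M {..<n} (\<lambda>_. borel)"

text \<open>Joint Gaussianity of all real and imaginary parts: every real-linear functional
  $\mathbb{C}^n \to \mathbb{R}$, i.e. every \<open>z \<mapsto> Re (\<Sum>i<n. c i * z i)\<close>, is Gaussian.\<close>

definition complex_gaussian :: "'w measure \<Rightarrow> nat \<Rightarrow> ('w \<Rightarrow> nat \<Rightarrow> complex) \<Rightarrow> bool" where
  "complex_gaussian M n X \<longleftrightarrow>
     (\<forall>i<n. (\<lambda>x. X x i) \<in> borel_measurable M) \<and>
     (\<forall>c :: nat \<Rightarrow> complex. gaussian_var M (\<lambda>x. Re (\<Sum>i<n. c i * X x i)))"

definition circularly_symmetric :: "'w measure \<Rightarrow> nat \<Rightarrow> ('w \<Rightarrow> nat \<Rightarrow> complex) \<Rightarrow> bool" where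
  "circularly_symmetric M n X \<longleftrightarrow>
     (\<forall>\<theta>. distr M (cvec_space n) (\<lambda>x. \<lambda>i\<in>{..<n}. cis \<theta> * X x i) =
          distr M (cvec_space n) (\<lambda>x. \<lambda>i\<in>{..<n}. X x i))"

definition zero_mean :: "'w measure \<Rightarrow> nat \<Rightarrow> ('w \<Rightarrow> nat \<Rightarrow> complex) \<Rightarrow> bool" where
  "zero_mean M n X \<longleftrightarrow> (\<forall>i<n. (LINT x|M. X x i) = 0)"

section \<open>The channel matrix\<close>

definition mat_row_fun :: "nat \<Rightarrow> complex mat \<Rightarrow> nat \<Rightarrow> nat \<Rightarrow> complex" where
  "mat_row_fun n A m = (\<lambda>i\<in>{..<n}. A $$ (m, i))"

text \<open>The covariance condition is the entrywise form of
  $\mathbb{E}[(h_m^T)^H h_m^T] = \Sigma$, where $h_m^T$ is the $m$-th row.\<close>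

definition channel_matrix ::
  "'w measure \<Rightarrow> nat \<Rightarrow> nat \<Rightarrow> complex mat \<Rightarrow> ('w \<Rightarrow> complex mat) \<Rightarrow> bool" where
  "channel_matrix M Nr Nt S H \<longleftrightarrow>
     (\<forall>x\<in>space M. H x \<in> carrier_mat Nr Nt) \<and>
     prob_space.indep_vars M (\<lambda>_. cvec_space Nt) (\<lambda>m x. mat_row_fun Nt (H x) m) {..<Nr} \<and>
     (\<forall>m<Nr. \<forall>m'<Nr. distr M (cvec_space Nt) (\<lambda>x. mat_row_fun Nt (H x) m) =
                      distr M (cvec_space Nt) (\<lambda>x. mat_row_fun Nt (H x) m')) \<and>
     (\<forall>m<Nr. complex_gaussian M Nt (\<lambda>x. mat_row_fun Nt (H x) m) \<and>
             circularly_symmetric M Nt (\<lambda>x. mat_row_fun Nt (H x) m) \<and>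
             zero_mean M Nt (\<lambda>x. mat_row_fun Nt (H x) m) \<and>
             (\<forall>a<Nt. \<forall>b<Nt. (LINT x|M. cnj (H x $$ (m, a)) * H x $$ (m, b)) = S $$ (a, b)))"

section \<open>Toeplitz covariance matrices and their symbol\<close>

definition toeplitz :: "(int \<Rightarrow> complex) \<Rightarrow> nat \<Rightarrow> complex mat" where
  "toeplitz \<sigma> n = Matrix.mat n n (\<lambda>(i, j). \<sigma> (int i - int j))"

abbreviation period_measure :: "real measure" where
  "period_measure \<equiv> lebesgue_on {0..2 * pi}"

text \<open>For square-summable \<open>\<sigma>\<close> the series $\sum_k \sigma(k) e^{-jk\omega}$ is read in the sense of
  $L^2[0, 2\pi]$. Square integrability of \<open>s\<close> is stated explicitly because the Bochner integral
  of a non-integrable function is 0.\<close>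

definition has_symbol :: "(int \<Rightarrow> complex) \<Rightarrow> (real \<Rightarrow> real) \<Rightarrow> bool" where
  "has_symbol \<sigma> s \<longleftrightarrow>
     s \<in> borel_measurable period_measure \<and>
     integrable period_measure (\<lambda>\<omega>. (s \<omega>)\<^sup>2) \<and>
     (\<lambda>K. LINT \<omega>|period_measure.
            (cmod (complex_of_real (s \<omega>)
                   - (\<Sum>k\<in>{- int K..int K}. \<sigma> k * cis (- (of_int k * \<omega>)))))\<^sup>2)
       \<longlonglongrightarrow> 0 \<and>
     (\<forall>k. \<sigma> k = 1 / (2 * pi) *
            (LINT \<omega>|period_measure. complex_of_real (s \<omega>) * cis (of_int k * \<omega>)))"

definition essinf :: "'a measure \<Rightarrow> ('a \<Rightarrow> real) \<Rightarrow> ereal" where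
  "essinf M f = - esssup M (\<lambda>x. - ereal (f x))"

section \<open>Precoder and SNR\<close>

definition unitary_mat :: "nat \<Rightarrow> complex mat \<Rightarrow> bool" where
  "unitary_mat n W \<longleftrightarrow> W \<in> carrier_mat n n \<and>
     W * mat_adjoint W = 1\<^sub>m n \<and> mat_adjoint W * W = 1\<^sub>m n"

text \<open>\<open>l\<close> lists the eigenvalues; the diagonal matrix $\Lambda$ is
  \<open>mat_diag n (\<lambda>i. complex_of_real (l i))\<close>.\<close>

definition eigenvalue_decomposition ::
  "nat \<Rightarrow> complex mat \<Rightarrow> complex mat \<Rightarrow> (nat \<Rightarrow> real) \<Rightarrow> bool" where
  "eigenvalue_decomposition n S W l \<longleftrightarrow>
     unitary_mat n W \<and>
     S = W * mat_diag n (\<lambda>i. complex_of_real (l i)) * mat_adjoint W \<and>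
     (\<forall>i j. i \<le> j \<longrightarrow> j < n \<longrightarrow> l i \<le> l j)"

text \<open>Indices start from 0 here, so the exponent has $mn$ instead of $(m-1)(n-1)$.\<close>

definition dft_mat :: "nat \<Rightarrow> complex mat" where
  "dft_mat N = Matrix.mat N N
     (\<lambda>(m, n). complex_of_real (1 / sqrt (real N)) *
               exp (- (2 * complex_of_real pi * \<i> * of_nat m * of_nat n / of_nat N)))"

definition precoder :: "nat \<Rightarrow> complex mat \<Rightarrow> (nat \<Rightarrow> real) \<Rightarrow> complex mat" where
  "precoder n W l =
     complex_of_real (1 / sqrt (\<Sum>i<n. l i powr (-1/2))) \<cdot>\<^sub>m
       (W * mat_diag n (\<lambda>i. complex_of_real (l i powr (-1/4))) * dft_mat n)"

text \<open>\<open>nv\<close> is the noise variance, \<open>k \<ge> 1\<close> is the 1-based sub-channel index. Where the inverse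
  exists, the value is real (the inverted matrix is Hermitian); it is left in
  \<open>complex\<close> so that no projection is needed.\<close>

definition snr :: "real \<Rightarrow> complex mat \<Rightarrow> complex mat \<Rightarrow> nat \<Rightarrow> complex" where
  "snr nv F H k =
     1 / (complex_of_real nv *
          the (mat_inverse (mat_adjoint F * mat_adjoint H * H * F)) $$ (k - 1, k - 1))"

text \<open>The numbers \<open>Nt\<close> for which \<open>Nr = \<beta> * Nt\<close> is an integer; the limit is taken along these.\<close>

definition admissible_sizes :: "real \<Rightarrow> nat set" where
  "admissible_sizes \<beta> = {Nt. \<beta> * real Nt \<in> \<nat>}"

end

theory Submission
  imports Defs "HOL-Real_Asymp.Real_Asymp"
begin

text \<open>Write \<open>A = H F\<close>. The SNR of a sub-channel is \<open>\<eta>\<close> times the squared distance of the corresponding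
  column of \<open>A\<close> from the span of the other columns. That column may be replaced by its residual after
  regression on the others, which is a Gaussian vector with independent entries of variance
  \<open>\<nu> = N / (tr \<Lambda>\<^sup>-\<^sup>1\<^sup>/\<^sup>2)\<^sup>2\<close> and is independent of the other columns. Conditionally on them the
  squared distance is therefore \<open>\<nu>\<close> times a Gamma variable with parameter \<open>r = N\<^sub>r - N + 1\<close>, whose
  Chernoff bounds are summable in \<open>N\<close>, so that the Borel--Cantelli lemma applies. Szego's theorem gives
  that \<open>tr \<Lambda>\<^sup>-\<^sup>1\<^sup>/\<^sup>2 / N\<close> converges to the mean of \<open>1 / sqrt s\<close>; it is obtained by comparing the Toeplitz matrix with a circulant one in the
  Frobenius norm.

  Independence of uncorrelated jointly Gaussian vectors is used in the form that the joint characteristic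
  function determines the law, which reduces to the one-dimensional uniqueness theorem by replacing one
  coordinate at a time by an indicator.\<close>

section \<open>Uniqueness of multivariate characteristic functions\<close>

text \<open>Let D be the diagonal matrix of eigenvalues, T the trace of D^(-1/2) and V the DFT
  matrix. A row of H F has covariance F^H S F = T^(-1) V^H D^(1/2) V, with inverse T V^H D^(-1/2) V.
  All entries of V have modulus N^(-1/2), so each diagonal entry of the inverse is T^2 / N; its
  reciprocal is the residual variance \<nu>, the same for every column. As r is of order (\<beta> -
  1) N, the typical squared distance \<nu> r has the claimed limit once T / N converges. Three
  obstacles shape the proof. Matrices of different sizes may depend on each other arbitrarily, so
  almost sure convergence has to come from summable tails alone. The SNR is meaningful only for an
  invertible Gram matrix, so almost sure independence of the columns needs its own argument, and the
  distance is kept as a quotient of determinants. The symbol is only square integrable and may be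
  unbounded, so spectra are compared through bounded Lipschitz functions with mean-square errors;
  the positive essential infimum allows 1 / sqrt to be replaced by such a function.\<close>

lemma borel_measurable_cis [measurable]: "cis \<in> borel_measurable borel"
  unfolding cis_conv_exp by (intro borel_measurable_continuous_onI continuous_intros)

text \<open>Dividing by the common total mass a, obtained from s = 0, turns both weighted measures
  into probability measures, to which the one-dimensional uniqueness theorem applies; for a = 0 both
  weights vanish almost everywhere. The weight lets the remaining coordinates be carried along while
  one coordinate is treated.\<close>

lemma weighted_char_unique:
  fixes X :: "'a \<Rightarrow> real" and Y :: "'b \<Rightarrow> real"
  assumes M: "finite_measure M" and N: "finite_measure N"
    and [measurable]: "X \<in> borel_measurable M" "Y \<in> borel_measurable N"
    and [measurable]: "g \<in> borel_measurable M" "h \<in> borel_measurable N"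
    and g: "\<And>x. 0 \<le> g x" "\<And>x. g x \<le> C" and h: "\<And>x. 0 \<le> h x" "\<And>x. h x \<le> C"
    and eq: "\<And>s. (LINT x|M. complex_of_real (g x) * cis (s * X x)) =
                 (LINT y|N. complex_of_real (h y) * cis (s * Y y))"
    and B: "B \<in> sets borel"
  shows "(LINT x|M. g x * indicator B (X x)) = (LINT y|N. h y * indicator B (Y y))"
proof -
  interpret M: finite_measure M by fact
  interpret N: finite_measure N by fact
  have ig: "integrable M g"
    by (rule M.integrable_const_bound[where B=C]) (use g in auto)
  have ih: "integrable N h"
    by (rule N.integrable_const_bound[where B=C]) (use h in auto)
  define a where "a = integral\<^sup>L M g"
  have a0: "a \<ge> 0" unfolding a_def by (simp add: g)
  have ga: "a = integral\<^sup>L N h"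
    using eq[of 0] ig ih unfolding a_def
    by (simp add: integral_complex_of_real)
  show ?thesis
  proof (cases "a = 0")
    case True
    have "AE x in M. g x = 0"
      using integral_nonneg_eq_0_iff_AE[OF ig] g True a_def by auto
    moreover have "AE x in N. h x = 0"
      using integral_nonneg_eq_0_iff_AE[OF ih] h True ga by auto
    ultimately have "(LINT x|M. g x * indicator B (X x)) = 0" "(LINT x|N. h x * indicator B (Y x)) = 0"
      by (auto intro!: integral_eq_zero_AE elim: eventually_mono)
    then show ?thesis by simp
  next
    case False
    then have a: "a > 0" using a0 by simp
    have law: "real_distribution (distr (density K (\<lambda>x. ennreal (f x / a))) borel Z)"
      and ch: "char (distr (density K (\<lambda>x. ennreal (f x / a))) borel Z) t =
        (LINT x|K. complex_of_real (f x) * cis (t * Z x)) / a"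
      and pr: "measure (distr (density K (\<lambda>x. ennreal (f x / a))) borel Z) B
        = (LINT x|K. f x * indicator B (Z x)) / a"
      if K: "integrable K f" "integral\<^sup>L K f = a" and [measurable]: "f \<in> borel_measurable K"
        "Z \<in> borel_measurable K" and f: "\<And>x. 0 \<le> f x" for K :: "'c measure" and f Z t
    proof -
      have "emeasure (density K (\<lambda>x. ennreal (f x / a))) (space K) = 1"
        using K a f by (subst emeasure_density) (auto simp: nn_integral_eq_integral cong: nn_integral_cong)
      then interpret D: prob_space "density K (\<lambda>x. ennreal (f x / a))"
        by (intro prob_spaceI) simp
      interpret D2: prob_space "distr (density K (\<lambda>x. ennreal (f x / a))) borel Z"
        by (rule D.prob_space_distr) simp
      show "real_distribution (distr (density K (\<lambda>x. ennreal (f x / a))) borel Z)"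
        by unfold_locales simp
      show "char (distr (density K (\<lambda>x. ennreal (f x / a))) borel Z) t =
        (LINT x|K. complex_of_real (f x) * cis (t * Z x)) / a"
        unfolding char_def
        by (subst integral_distr) (use a f in \<open>auto simp: integral_density scaleR_conv_of_real cis_conv_exp mult.assoc\<close>)
      have "measure (distr (density K (\<lambda>x. ennreal (f x / a))) borel Z) B
         = (LINT x|distr (density K (\<lambda>x. ennreal (f x / a))) borel Z. indicator B x)"
        using B by simp
      also have "\<dots> = (LINT x|K. f x / a * indicator B (Z x))"
        by (subst integral_distr) (use a f B in \<open>auto simp: integral_density\<close>)
      finally show "measure (distr (density K (\<lambda>x. ennreal (f x / a))) borel Z) B
        = (LINT x|K. f x * indicator B (Z x)) / a" by simp
    qed
    have "distr (density M (\<lambda>x. ennreal (g x / a))) borel X = distr (density N (\<lambda>x. ennreal (h x / a))) borel Y"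
    proof (intro Levy_uniqueness law ext)
      show "char (distr (density M (\<lambda>x. ennreal (g x / a))) borel X) t =
        char (distr (density N (\<lambda>x. ennreal (h x / a))) borel Y) t" for t
        using ig ih ga a_def g h by (subst (1 2) ch) (auto simp: eq)
    qed (use ig ih ga a_def g h in auto)
    then show ?thesis
      using pr[of M g X] pr[of N h Y] ig ih ga a_def g h a by simp
  qed
qed

text \<open>One-dimensional uniqueness needs nonnegative weights, but the phase
  \<open>cis (\<theta> x)\<close> of the remaining coordinates is complex. It is replaced by the
  weights 1 + e cos (\<theta> - c), nonnegative for |e| \<le> 1, and recovered at the end as a
  linear combination of three of them.\<close>

lemma char_indicator_step:
  fixes X \<theta> :: "'a \<Rightarrow> real" and Y \<phi> :: "'b \<Rightarrow> real"
  assumes M: "prob_space M" and N: "prob_space N"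
    and [measurable]: "X \<in> borel_measurable M" "Y \<in> borel_measurable N"
      "\<theta> \<in> borel_measurable M" "\<phi> \<in> borel_measurable N"
      "U \<in> borel_measurable M" "V \<in> borel_measurable N"
    and U: "\<And>x. 0 \<le> U x" "\<And>x. U x \<le> 1" and V: "\<And>x. 0 \<le> V x" "\<And>x. V x \<le> (1::real)"
    and eq: "\<And>s e. (LINT x|M. complex_of_real (U x) * cis (s * X x + e * \<theta> x)) =
                 (LINT y|N. complex_of_real (V y) * cis (s * Y y + e * \<phi> y))"
    and B: "B \<in> sets borel"
  shows "(LINT x|M. complex_of_real (U x * indicator B (X x)) * cis (\<theta> x)) =
         (LINT y|N. complex_of_real (V y * indicator B (Y y)) * cis (\<phi> y))"
proof -
  have cos_eq: "complex_of_real (cos t) = (cis t + cis (-t)) / 2" for t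
    by (simp add: complex_eq_iff)
  have ci: "integrable K (\<lambda>x. complex_of_real (f x) * cis (h x))"
    if "prob_space K" and [measurable]: "f \<in> borel_measurable K" "h \<in> borel_measurable K"
      and f: "\<And>x. 0 \<le> f x" "\<And>x. f x \<le> 1" for K :: "'c measure" and f h
  proof -
    interpret prob_space K by fact
    show ?thesis by (rule integrable_const_bound[where B=1]) (use f in \<open>auto simp: norm_mult\<close>)
  qed
  have key: "(LINT x|M. U x * (1 + e * cos (\<theta> x - c)) * indicator B (X x)) =
      (LINT y|N. V y * (1 + e * cos (\<phi> y - c)) * indicator B (Y y))" if e: "\<bar>e\<bar> \<le> 1" for c e
  proof (rule weighted_char_unique[where C=2, OF prob_space.finite_measure[OF M] prob_space.finite_measure[OF N]])
    have ec: "\<bar>e * cos t\<bar> \<le> 1" for t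
      using e by (simp add: abs_mult mult_le_one)
    show "0 \<le> U x * (1 + e * cos (\<theta> x - c))" "0 \<le> V y * (1 + e * cos (\<phi> y - c))" for x y
      using U V ec[of "\<theta> x - c"] ec[of "\<phi> y - c"] by (auto intro!: mult_nonneg_nonneg)
    have "1 + e * cos (\<theta> x - c) \<le> 2" "1 + e * cos (\<phi> y - c) \<le> 2" for x y
      using ec[of "\<theta> x - c"] ec[of "\<phi> y - c"] by auto
    then show "U x * (1 + e * cos (\<theta> x - c)) \<le> 2" "V y * (1 + e * cos (\<phi> y - c)) \<le> 2" for x y
      using U[of x] V[of y] mult_mono[of "U x" 1 "1 + e * cos (\<theta> x - c)" 2] mult_mono[of "V y" 1 "1 + e * cos (\<phi> y - c)" 2]
       ec[of "\<theta> x - c"] ec[of "\<phi> y - c"] by auto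
    fix s
    \<comment> \<open>Euler's formula splits the weight into the multiples 0, 1 and -1 of the phase;
      this is why the hypothesis \<open>eq\<close> ranges over all multiples of the phase.\<close>
    have exp: "complex_of_real (u * (1 + e * cos (t - c))) * cis (s * z) =
      complex_of_real u * cis (s * z + 0 * t) + e / 2 * cis (-c) * (complex_of_real u * cis (s * z + 1 * t))
       + e / 2 * cis c * (complex_of_real u * cis (s * z + (-1) * t))" for u t z
      unfolding of_real_mult of_real_add cos_eq by (simp add: algebra_simps cis_mult add_divide_distrib)
    show "(LINT x|M. complex_of_real (U x * (1 + e * cos (\<theta> x - c))) * cis (s * X x)) =
      (LINT y|N. complex_of_real (V y * (1 + e * cos (\<phi> y - c))) * cis (s * Y y))"
    proof -
      have lin: "(LINT x|K. f x + p * g x + q * h x) = integral\<^sup>L K f + p * integral\<^sup>L K g + q * integral\<^sup>L K h"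
        if "integrable K f" "integrable K g" "integrable K h" for K :: "'c measure" and f g h and p q :: complex
        using that by simp
      have "(LINT x|M. complex_of_real (U x * (1 + e * cos (\<theta> x - c))) * cis (s * X x)) =
        (LINT x|M. complex_of_real (U x) * cis (s * X x + 0 * \<theta> x)) + e / 2 * cis (-c) *
        (LINT x|M. complex_of_real (U x) * cis (s * X x + 1 * \<theta> x)) + e / 2 * cis c *
        (LINT x|M. complex_of_real (U x) * cis (s * X x + (-1) * \<theta> x))"
        unfolding exp by (intro lin ci M U) measurable
      also have "\<dots> = (LINT x|N. complex_of_real (V x) * cis (s * Y x + 0 * \<phi> x)) + e / 2 * cis (-c) *
        (LINT x|N. complex_of_real (V x) * cis (s * Y x + 1 * \<phi> x)) + e / 2 * cis c *
        (LINT x|N. complex_of_real (V x) * cis (s * Y x + (-1) * \<phi> x))"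
        unfolding eq ..
      also have "\<dots> = (LINT y|N. complex_of_real (V y * (1 + e * cos (\<phi> y - c))) * cis (s * Y y))"
        unfolding exp by (intro lin[symmetric] ci N V) measurable
      finally show ?thesis .
    qed
  qed (use B in auto)
  have b: "integrable K (\<lambda>x. f x * (1 + e * cos (h x - c)) * indicator B (Z x))"
    if "prob_space K" and [measurable]: "f \<in> borel_measurable K" "h \<in> borel_measurable K" "Z \<in> borel_measurable K"
      and f: "\<And>x. 0 \<le> f x" "\<And>x. f x \<le> 1" and e: "\<bar>e\<bar> \<le> 1" for K :: "'c measure" and f h Z and c e :: real
  proof -
    interpret prob_space K by fact
    have ec: "\<bar>e * cos t\<bar> \<le> 1" for t
      using e by (simp add: abs_mult mult_le_one)
    have "f x * \<bar>1 + e * cos (h x - c)\<bar> \<le> 2" for x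
      using f[of x] mult_mono[of "f x" 1 "\<bar>1 + e * cos (h x - c)\<bar>" 2] ec[of "h x - c"] by auto
    then show ?thesis using B f
      by (intro integrable_const_bound[where B=2]) (auto simp: abs_mult split: split_indicator)
  qed
  \<comment> \<open>cos t is cos (t - 0) and sin t is cos (t - pi/2); subtracting (1 + i) times the
    constant weight, with i the imaginary unit, removes the two ones.\<close>
  have dec: "complex_of_real (u * i) * cis t = complex_of_real (u * (1 + 1 * cos (t - 0)) * i)
     + \<i> * complex_of_real (u * (1 + 1 * cos (t - pi/2)) * i) - (1 + \<i>) * complex_of_real (u * (1 + 0 * cos (t - 0)) * i)" for u t i
    by (simp add: complex_eq_iff algebra_simps cos_diff)
  have fin: "(LINT x|K. complex_of_real (f x * indicator B (Z x)) * cis (h x)) =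
      complex_of_real (LINT x|K. f x * (1 + 1 * cos (h x - 0)) * indicator B (Z x))
     + \<i> * complex_of_real (LINT x|K. f x * (1 + 1 * cos (h x - pi/2)) * indicator B (Z x))
     - (1 + \<i>) * complex_of_real (LINT x|K. f x * (1 + 0 * cos (h x - 0)) * indicator B (Z x))"
    if K: "prob_space K" and [measurable]: "f \<in> borel_measurable K" "h \<in> borel_measurable K" "Z \<in> borel_measurable K"
      and f: "\<And>x. 0 \<le> f x" "\<And>x. f x \<le> 1" for K :: "'c measure" and f h Z
  proof -
    note bb = b[OF K that(2-4) f]
    have lin: "(LINT x|K. complex_of_real (f x) + \<i> * complex_of_real (g x) - (1 + \<i>) * complex_of_real (h x)) =
       complex_of_real (integral\<^sup>L K f) + \<i> * complex_of_real (integral\<^sup>L K g) - (1 + \<i>) * complex_of_real (integral\<^sup>L K h)"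
      if "integrable K f" "integrable K g" "integrable K h" for f g h :: "'c \<Rightarrow> real"
      using that by simp
    show ?thesis unfolding dec by (intro lin bb) auto
  qed
  show ?thesis
    by (subst (1 2) fin) (use U V M N key[of 1 0] key[of 1 "pi/2"] key[of 0 0] in simp_all)
qed
text \<open>The intermediate statement \<open>main\<close> has indicators on J and a phase on the
  complement. For J empty it is the hypothesis, and for J = I it says that all boxes have equal
  measure.\<close>

theorem multivariate_char_unique:
  fixes X :: "'i \<Rightarrow> 'a \<Rightarrow> real" and Y :: "'i \<Rightarrow> 'b \<Rightarrow> real"
  assumes M: "prob_space M" and N: "prob_space N" and I: "finite I"
    and X [measurable]: "\<And>i. i \<in> I \<Longrightarrow> X i \<in> borel_measurable M"
    and Y [measurable]: "\<And>i. i \<in> I \<Longrightarrow> Y i \<in> borel_measurable N"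
    and eq: "\<And>t. (LINT x|M. cis (\<Sum>i\<in>I. t i * X i x)) = (LINT y|N. cis (\<Sum>i\<in>I. t i * Y i y))"
  shows "distr M (Pi\<^sub>M I (\<lambda>_. borel)) (\<lambda>x. \<lambda>i\<in>I. X i x) = distr N (Pi\<^sub>M I (\<lambda>_. borel)) (\<lambda>y. \<lambda>i\<in>I. Y i y)"
proof -
  interpret M: prob_space M by fact
  interpret N: prob_space N by fact
  have main: "(LINT x|M. complex_of_real (\<Prod>i\<in>J. indicator (A i) (X i x)) * cis (\<Sum>i\<in>I-J. t i * X i x)) =
        (LINT y|N. complex_of_real (\<Prod>i\<in>J. indicator (A i) (Y i y)) * cis (\<Sum>i\<in>I-J. t i * Y i y))"
    if "finite J" "J \<subseteq> I" and A: "\<And>i. i \<in> I \<Longrightarrow> A i \<in> sets borel" for J A t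
    using that(1,2)
  proof (induction J arbitrary: t)
    case empty
    then show ?case using eq by simp
  next
    case (insert j J)
    have j: "j \<in> I" and J: "J \<subseteq> I" and fJ: "finite J" using insert by auto
    have IJ: "I - J = insert j (I - insert j J)" using j insert.hyps by auto
    have fin: "finite (I - insert j J)" using I by auto
    have [measurable]: "A i \<in> sets borel" if "i \<in> J" for i using A J that by auto
    have [measurable]: "X j \<in> borel_measurable M" "Y j \<in> borel_measurable N" using j by auto
    have [measurable]: "X i \<in> borel_measurable M" "Y i \<in> borel_measurable N" if "i \<in> J" for i using J that by auto
    \<comment> \<open>The multiplier e of the other coordinates and the free frequency s of
      coordinate j fit into one frequency vector, so the induction hypothesis, general in t, covers
      all s and e.\<close>
    have sm: "s * X j x + e * (\<Sum>i\<in>I - insert j J. t i * X i x) = (\<Sum>i\<in>I-J. ((\<lambda>i. e * t i)(j := s)) i * X i x)"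
       "s * Y j y + e * (\<Sum>i\<in>I - insert j J. t i * Y i y) = (\<Sum>i\<in>I-J. ((\<lambda>i. e * t i)(j := s)) i * Y i y)" for s e x y
      unfolding IJ using fin by (auto simp: sum_distrib_left mult.assoc intro!: sum.cong)
    have "(LINT x|M. complex_of_real ((\<Prod>i\<in>J. indicator (A i) (X i x)) * indicator (A j) (X j x)) * cis (\<Sum>i\<in>I - insert j J. t i * X i x)) =
        (LINT y|N. complex_of_real ((\<Prod>i\<in>J. indicator (A i) (Y i y)) * indicator (A j) (Y j y)) * cis (\<Sum>i\<in>I - insert j J. t i * Y i y))"
      by (rule char_indicator_step[OF M N])
         (simp_all only: sm insert.IH[OF J], auto simp: A j intro!: prod_nonneg prod_le_1)
    then show ?case using insert.hyps by (simp add: mult.commute)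
  qed
  show ?thesis
  proof (rule measure_eqI_PiM_finite[OF I])
    fix A :: "'i \<Rightarrow> real set" assume A: "\<And>i. i \<in> I \<Longrightarrow> A i \<in> sets borel"
    note [measurable] = A
    have pr: "emeasure (distr K (Pi\<^sub>M I (\<lambda>_. borel)) (\<lambda>x. \<lambda>i\<in>I. Z i x)) (Pi\<^sub>E I A)
        = (LINT x|K. (\<Prod>i\<in>I. indicator (A i) (Z i x)))"
      if "prob_space K" and [measurable]: "\<And>i. i \<in> I \<Longrightarrow> Z i \<in> borel_measurable K" for K :: "'c measure" and Z
    proof -
      interpret prob_space K by fact
      have S: "{x\<in>space K. \<forall>i\<in>I. Z i x \<in> A i} \<in> sets K" using I by measurable
      have "emeasure (distr K (Pi\<^sub>M I (\<lambda>_. borel)) (\<lambda>x. \<lambda>i\<in>I. Z i x)) (Pi\<^sub>E I A)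
         = emeasure K ((\<lambda>x. \<lambda>i\<in>I. Z i x) -` Pi\<^sub>E I A \<inter> space K)"
        using I A by (intro emeasure_distr sets_PiM_I_finite) auto
      also have "(\<lambda>x. \<lambda>i\<in>I. Z i x) -` Pi\<^sub>E I A \<inter> space K = {x\<in>space K. \<forall>i\<in>I. Z i x \<in> A i}"
        by (auto simp: PiE_iff)
      also have "emeasure K \<dots> = (LINT x|K. indicator {x\<in>space K. \<forall>i\<in>I. Z i x \<in> A i} x)"
        using S by (simp add: emeasure_eq_measure)
      also have "\<dots> = (LINT x|K. (\<Prod>i\<in>I. indicator (A i) (Z i x)))"
        by (intro arg_cong[where f=ennreal] Bochner_Integration.integral_cong refl)
           (use I in \<open>auto simp: indicator_def\<close>)
      finally show ?thesis .
    qed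
    have "complex_of_real (LINT x|M. (\<Prod>i\<in>I. indicator (A i) (X i x))) = complex_of_real (LINT x|N. (\<Prod>i\<in>I. indicator (A i) (Y i x)))"
      using main[of I A "\<lambda>_. 0", OF I subset_refl A] by (simp add: integral_complex_of_real flip: of_real_prod)
    then show "emeasure (distr M (Pi\<^sub>M I (\<lambda>_. borel)) (\<lambda>x. \<lambda>i\<in>I. X i x)) (Pi\<^sub>E I A)
      = emeasure (distr N (Pi\<^sub>M I (\<lambda>_. borel)) (\<lambda>x. \<lambda>i\<in>I. Y i x)) (Pi\<^sub>E I A)"
      by (simp add: pr[OF M X] pr[OF N Y])
  next
    show "range (\<lambda>_::nat. Pi\<^sub>E I (\<lambda>_. UNIV)) \<subseteq> prod_algebra I (\<lambda>_. borel :: real measure)"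
      using I by (auto intro!: prod_algebraI_finite)
    interpret D: prob_space "distr M (Pi\<^sub>M I (\<lambda>_. borel)) (\<lambda>x. \<lambda>i\<in>I. X i x)"
      by (rule M.prob_space_distr) auto
    show "emeasure (distr M (Pi\<^sub>M I (\<lambda>_. borel)) (\<lambda>x. \<lambda>i\<in>I. X i x)) (Pi\<^sub>E I (\<lambda>_. UNIV)) \<noteq> \<infinity>"
      by (simp add: D.emeasure_eq_measure)
  qed (auto simp: space_PiM)
qed

corollary complex_char_unique:
  fixes X :: "'i \<Rightarrow> 'a \<Rightarrow> complex" and Y :: "'i \<Rightarrow> 'b \<Rightarrow> complex"
  assumes M: "prob_space M" and N: "prob_space N" and I: "finite I"
    and X [measurable]: "\<And>i. i \<in> I \<Longrightarrow> X i \<in> borel_measurable M"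
    and Y [measurable]: "\<And>i. i \<in> I \<Longrightarrow> Y i \<in> borel_measurable N"
    and eq: "\<And>c. (LINT x|M. cis (Re (\<Sum>i\<in>I. c i * X i x))) = (LINT y|N. cis (Re (\<Sum>i\<in>I. c i * Y i y)))"
  shows "distr M (Pi\<^sub>M I (\<lambda>_. borel)) (\<lambda>x. \<lambda>i\<in>I. X i x) = distr N (Pi\<^sub>M I (\<lambda>_. borel)) (\<lambda>y. \<lambda>i\<in>I. Y i y)"
proof -
  define part :: "('i \<times> bool) \<Rightarrow> ('i \<Rightarrow> complex) \<Rightarrow> real"
    where "part = (\<lambda>(i,b) z. if b then Re (z i) else Im (z i))"
  let ?J = "I \<times> (UNIV :: bool set)"
  let ?g = "\<lambda>z :: 'i \<times> bool \<Rightarrow> real. \<lambda>i\<in>I. Complex (z (i,True)) (z (i,False))"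
  have Complex_eq': "Complex a b = complex_of_real a + \<i> * complex_of_real b" for a b
    by (simp add: complex_eq_iff)
  have g: "?g \<in> measurable (Pi\<^sub>M ?J (\<lambda>_. borel)) (Pi\<^sub>M I (\<lambda>_. borel))"
    unfolding Complex_eq' by measurable
  have pm: "(\<lambda>x. part p (\<lambda>i. Z i x)) \<in> borel_measurable K"
    if "p \<in> ?J" "\<And>i. i \<in> I \<Longrightarrow> Z i \<in> borel_measurable K" for K :: "'c measure" and p Z
    using that unfolding part_def by (cases p) auto
  \<comment> \<open>The minus sign comes from Re (c z) = Re c Re z - Im c Im z.\<close>
  have sm: "(\<Sum>p\<in>?J. t p * part p z) = Re (\<Sum>i\<in>I. Complex (t (i,True)) (- t (i,False)) * z i)" for t z
  proof -
    have "(\<Sum>p\<in>?J. t p * part p z) = (\<Sum>i\<in>I. \<Sum>b\<in>UNIV. t (i,b) * part (i,b) z)"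
      using I by (simp add: sum.cartesian_product)
    then show ?thesis
      by (simp add: UNIV_bool part_def sum.distrib algebra_simps)
  qed
  have "distr M (Pi\<^sub>M ?J (\<lambda>_. borel)) (\<lambda>x. \<lambda>p\<in>?J. part p (\<lambda>i. X i x)) =
        distr N (Pi\<^sub>M ?J (\<lambda>_. borel)) (\<lambda>x. \<lambda>p\<in>?J. part p (\<lambda>i. Y i x))"
  proof (rule multivariate_char_unique[OF M N])
    show "(LINT x|M. cis (\<Sum>p\<in>?J. t p * part p (\<lambda>i. X i x))) = (LINT x|N. cis (\<Sum>p\<in>?J. t p * part p (\<lambda>i. Y i x)))" for t
      unfolding sm by (rule eq)
  qed (use I in \<open>auto intro: pm X Y\<close>)
  from arg_cong[OF this, of "\<lambda>D. distr D (Pi\<^sub>M I (\<lambda>_. borel)) ?g"]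
  show ?thesis using g
  proof (subst (asm) (1 2) distr_distr)
    show "(\<lambda>x. \<lambda>p\<in>?J. part p (\<lambda>i. X i x)) \<in> measurable M (Pi\<^sub>M ?J (\<lambda>_. borel))"
      "(\<lambda>x. \<lambda>p\<in>?J. part p (\<lambda>i. Y i x)) \<in> measurable N (Pi\<^sub>M ?J (\<lambda>_. borel))"
      by (intro measurable_restrict pm X Y; simp)+
    have X': "?g \<circ> (\<lambda>x. \<lambda>p\<in>?J. part p (\<lambda>i. X i x)) = (\<lambda>x. \<lambda>i\<in>I. X i x)"
      and Y': "?g \<circ> (\<lambda>x. \<lambda>p\<in>?J. part p (\<lambda>i. Y i x)) = (\<lambda>x. \<lambda>i\<in>I. Y i x)"
      by (auto simp: comp_def part_def restrict_def fun_eq_iff)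
    show ?thesis if "distr M (Pi\<^sub>M I (\<lambda>_. borel)) (?g \<circ> (\<lambda>x. \<lambda>p\<in>?J. part p (\<lambda>i. X i x))) =
      distr N (Pi\<^sub>M I (\<lambda>_. borel)) (?g \<circ> (\<lambda>x. \<lambda>p\<in>?J. part p (\<lambda>i. Y i x)))"
      using that unfolding X' Y' .
  qed (use g in auto)
qed

section \<open>Standard complex Gaussian vectors\<close>

text \<open>Both real coordinates of an entry have variance 1, so an entry has second absolute
  moment 2. This is the origin of the divisions by 2 in the norm estimates and of the factor sqrt
  (\<nu> / 2) for entries of variance \<nu>.\<close>

definition std_cgauss :: "nat \<Rightarrow> (nat \<times> bool \<Rightarrow> real) measure" where
  "std_cgauss n = Pi\<^sub>M ({..<n} \<times> UNIV) (\<lambda>_. std_normal_distribution)"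

definition cg :: "(nat \<times> bool \<Rightarrow> real) \<Rightarrow> nat \<Rightarrow> complex" where
  "cg g m = Complex (g (m, True)) (g (m, False))"

lemma prob_space_std_normal: "prob_space std_normal_distribution"
  by (rule prob_space_normal_density) simp

lemma std_normal_product: "product_sigma_finite (\<lambda>_ :: nat \<times> bool. std_normal_distribution)"
  unfolding product_sigma_finite_def
  using prob_space_std_normal prob_space_imp_sigma_finite by blast

lemma prob_space_std_cgauss: "prob_space (std_cgauss n)"
  unfolding std_cgauss_def by (intro prob_space_PiM prob_space_std_normal)

lemma measurable_cg [measurable]: "m < n \<Longrightarrow> (\<lambda>g. cg g m) \<in> borel_measurable (std_cgauss n)"
proof -
  assume m: "m < n"
  have "Complex a b = complex_of_real a + \<i> * complex_of_real b" for a b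
    by (simp add: complex_eq_iff)
  moreover have "(\<lambda>g. g (m, b)) \<in> borel_measurable (std_cgauss n)" for b
  proof -
    have "(\<lambda>g. g (m, b)) \<in> measurable (std_cgauss n) std_normal_distribution"
      unfolding std_cgauss_def using m by (intro measurable_component_singleton) auto
    then show ?thesis by simp
  qed
  ultimately show ?thesis unfolding cg_def by simp
qed

lemma char_std_cgauss:
  "(LINT g|std_cgauss n. cis (Re (\<Sum>m<n. c m * cg g m))) = exp (- (\<Sum>m<n. (cmod (c m))\<^sup>2) / 2)"
proof -
  define t where "t = (\<lambda>(m,b). if b then Re (c m) else - Im (c m))"
  interpret prob_space std_normal_distribution by (rule prob_space_std_normal)
  have cisprod: "cis (sum f A) = (\<Prod>i\<in>A. cis (f i))" if "finite A" for f and A :: "(nat \<times> bool) set"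
    using that by (induction A rule: finite_induct) (auto simp: cis_mult[symmetric])
  have split: "(\<Sum>p\<in>{..<n} \<times> UNIV. f p) = (\<Sum>m<n. f (m,True) + f (m,False))" for f :: "nat \<times> bool \<Rightarrow> real"
    by (simp add: sum.cartesian_product[of "\<lambda>m b. f (m,b)", simplified, symmetric] UNIV_bool add.commute)
  have 1: "Re (\<Sum>m<n. c m * cg g m) = (\<Sum>p\<in>{..<n} \<times> UNIV. t p * g p)" for g
    unfolding split by (simp add: t_def cg_def)
  have 2: "(\<Sum>m<n. (cmod (c m))\<^sup>2) = (\<Sum>p\<in>{..<n} \<times> UNIV. (t p)\<^sup>2)"
    unfolding split by (simp add: t_def cmod_power2)
  have ch: "(LINT x|std_normal_distribution. cis (s * x)) = exp (- (s\<^sup>2) / 2)" for s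
    using fun_cong[OF char_std_normal_distribution, of s] by (simp add: char_def cis_conv_exp)
  have "(LINT g|std_cgauss n. cis (Re (\<Sum>m<n. c m * cg g m))) =
     (LINT g|std_cgauss n. (\<Prod>p\<in>{..<n} \<times> UNIV. cis (t p * g p)))"
    unfolding 1 by (simp add: cisprod)
  also have "\<dots> = (\<Prod>p\<in>{..<n} \<times> UNIV. LINT x|std_normal_distribution. cis (t p * x))"
    unfolding std_cgauss_def
    by (rule product_sigma_finite.product_integral_prod[OF std_normal_product]) (auto intro!: integrable_const_bound[where B=1])
  also have "\<dots> = exp (- (\<Sum>p\<in>{..<n} \<times> UNIV. (t p)\<^sup>2) / 2)"
    by (simp add: ch exp_of_real[symmetric] exp_sum[symmetric] sum_negf sum_divide_distrib)
  finally show ?thesis unfolding 2 .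
qed

text \<open>Unitary invariance: the characteristic function depends only on the Euclidean norm of
  the coefficients, and passing from c to the combination of the conjugated q i preserves that
  norm.\<close>

lemma orthonormal_cgauss_distr:
  assumes on: "\<And>i j. i < r \<Longrightarrow> j < r \<Longrightarrow> (\<Sum>m<n. cnj (q i m) * q j m) = (if i = j then 1 else 0)"
  shows "distr (std_cgauss n) (Pi\<^sub>M {..<r} (\<lambda>_. borel)) (\<lambda>g. \<lambda>i\<in>{..<r}. \<Sum>m<n. cnj (q i m) * cg g m)
     = distr (std_cgauss r) (Pi\<^sub>M {..<r} (\<lambda>_. borel)) (\<lambda>g. \<lambda>i\<in>{..<r}. cg g i)"
proof (rule complex_char_unique[OF prob_space_std_cgauss prob_space_std_cgauss])
  fix c :: "nat \<Rightarrow> complex"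
  define d where "d m = (\<Sum>i<r. c i * cnj (q i m))" for m
  have "(\<Sum>i<r. c i * (\<Sum>m<n. cnj (q i m) * cg g m)) = (\<Sum>m<n. d m * cg g m)" for g
    unfolding d_def sum_distrib_left sum_distrib_right by (subst sum.swap) (simp add: mult.assoc)
  moreover have "(\<Sum>m<n. (cmod (d m))\<^sup>2) = (\<Sum>i<r. (cmod (c i))\<^sup>2)"
  proof -
    have "complex_of_real (\<Sum>m<n. (cmod (d m))\<^sup>2) = (\<Sum>m<n. d m * cnj (d m))"
      by (simp add: complex_norm_square del: of_real_power)
    also have "\<dots> = (\<Sum>m<n. \<Sum>i<r. \<Sum>j<r. c i * cnj (c j) * (cnj (q i m) * q j m))"
      unfolding d_def by (simp add: sum_product mult_ac)
    also have "\<dots> = (\<Sum>i<r. \<Sum>j<r. c i * cnj (c j) * (\<Sum>m<n. cnj (q i m) * q j m))"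
      unfolding sum_distrib_left by (subst sum.swap, rule sum.cong[OF refl], subst sum.swap, rule refl)
    also have "\<dots> = (\<Sum>i<r. \<Sum>j<r. if j = i then c i * cnj (c j) else 0)"
      by (intro sum.cong refl) (auto simp: on)
    also have "\<dots> = complex_of_real (\<Sum>i<r. (cmod (c i))\<^sup>2)"
      by (simp add: sum.delta complex_norm_square del: of_real_power)
    finally show ?thesis by (simp only: of_real_eq_iff)
  qed
  ultimately show "(LINT g|std_cgauss n. cis (Re (\<Sum>i<r. c i * (\<Sum>m<n. cnj (q i m) * cg g m))))
     = (LINT g|std_cgauss r. cis (Re (\<Sum>i<r. c i * cg g i)))"
    by (simp only: char_std_cgauss)
qed auto

text \<open>Tilting the standard normal density by exp (t x^2 / 2) gives 1 / sqrt (1 - t) times the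
  centred normal density of variance 1 / (1 - t).\<close>

lemma std_normal_square_mgf:
  assumes t: "t < 1"
  shows "integrable std_normal_distribution (\<lambda>x. exp (t / 2 * x\<^sup>2))"
    and "(LINT x|std_normal_distribution. exp (t / 2 * x\<^sup>2)) = 1 / sqrt (1 - t)"
proof -
  define s where "s = 1 / sqrt (1 - t)"
  have s: "s > 0" using t by (simp add: s_def)
  have s2: "s\<^sup>2 = 1 / (1 - t)" using t by (simp add: s_def power_divide)
  have eq: "std_normal_density x * exp (t / 2 * x\<^sup>2) = s * normal_density 0 s x" for x
  proof -
    have "- x\<^sup>2 / 2 + t / 2 * x\<^sup>2 = - x\<^sup>2 / (2 * s\<^sup>2)"
      unfolding s2 using t by (simp add: field_simps)
    then have "exp (- x\<^sup>2 / 2) * exp (t / 2 * x\<^sup>2) = exp (- x\<^sup>2 / (2 * s\<^sup>2))"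
      by (simp add: exp_add[symmetric])
    moreover have "sqrt (2 * pi * s\<^sup>2) = sqrt (2 * pi) * s"
      using s by (simp add: real_sqrt_mult)
    ultimately show ?thesis using s
      by (simp add: normal_density_def)
  qed
  have ni: "integrable lborel (\<lambda>x. s * normal_density 0 s x)"
    using integrable_normal_density[OF s] by simp
  show "integrable std_normal_distribution (\<lambda>x. exp (t / 2 * x\<^sup>2))"
    using ni by (subst integrable_density) (simp_all only: eq real_scaleR_def, auto)
  show "(LINT x|std_normal_distribution. exp (t / 2 * x\<^sup>2)) = 1 / sqrt (1 - t)"
    using integral_normal_density[OF s] by (subst integral_density) (simp_all only: eq real_scaleR_def, auto simp: s_def)
qed

text \<open>There are 2 r independent real coordinates, each contributing 1 / sqrt (1 - t). Half the
  squared norm thus has the moment generating function of a Gamma variable with shape r and scale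
  1.\<close>

lemma std_cgauss_norm_mgf:
  assumes t: "t < 1"
  shows "integrable (std_cgauss r) (\<lambda>g. exp (t * (\<Sum>m<r. (cmod (cg g m))\<^sup>2) / 2))"
    and "(LINT g|std_cgauss r. exp (t * (\<Sum>m<r. (cmod (cg g m))\<^sup>2) / 2)) = (1 / (1 - t)) ^ r"
proof -
  have split: "(\<Sum>p\<in>{..<r} \<times> UNIV. f p) = (\<Sum>m<r. f (m,True) + f (m,False))" for f :: "nat \<times> bool \<Rightarrow> real"
    by (simp add: sum.cartesian_product[of "\<lambda>m b. f (m,b)", simplified, symmetric] UNIV_bool add.commute)
  have 1: "exp (t * (\<Sum>m<r. (cmod (cg g m))\<^sup>2) / 2) = (\<Prod>p\<in>{..<r} \<times> UNIV. exp (t / 2 * (g p)\<^sup>2))" for g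
    by (simp add: exp_sum[symmetric] split cg_def cmod_power2 sum_distrib_left algebra_simps sum_divide_distrib add_divide_distrib)
  show "integrable (std_cgauss r) (\<lambda>g. exp (t * (\<Sum>m<r. (cmod (cg g m))\<^sup>2) / 2))"
    unfolding 1 std_cgauss_def
    by (intro product_sigma_finite.product_integrable_prod[OF std_normal_product] std_normal_square_mgf t) auto
  have "(LINT g|std_cgauss r. exp (t * (\<Sum>m<r. (cmod (cg g m))\<^sup>2) / 2)) = (\<Prod>p\<in>{..<r} \<times> (UNIV::bool set). 1 / sqrt (1 - t))"
    unfolding 1 std_cgauss_def
    by (subst product_sigma_finite.product_integral_prod[OF std_normal_product])
       (simp_all only: std_normal_square_mgf[OF t] finite_SigmaI finite_lessThan finite)
  also have "\<dots> = (1 / sqrt (1 - t)) ^ (2 * r)"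
    by (simp add: mult.commute)
  also have "\<dots> = (1 / (1 - t)) ^ r"
    using t by (simp add: power_mult power_divide)
  finally show "(LINT g|std_cgauss r. exp (t * (\<Sum>m<r. (cmod (cg g m))\<^sup>2) / 2)) = (1 / (1 - t)) ^ r" .
qed

text \<open>At t = 0 both expressions equal 1 and have derivative -\<epsilon>, so both are below 1
  for small positive t.\<close>

lemma chernoff_rate_exists:
  assumes \<epsilon>: "0 < (\<epsilon>::real)"
  shows "\<exists>t. 0 < t \<and> t < 1 \<and> exp (- t * (1 + \<epsilon>)) / (1 - t) < 1 \<and> exp (t * (1 - \<epsilon>)) / (1 + t) < 1"
proof -
  have up: "eventually (\<lambda>t. exp (- t * (1 + \<epsilon>)) / (1 - t) < 1) (at_right 0)"
    using \<epsilon> by real_asymp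
  have lo: "eventually (\<lambda>t. exp (t * (1 - \<epsilon>)) / (1 + t) < 1) (at_right 0)"
    using \<epsilon> by real_asymp
  have "eventually (\<lambda>t::real. 0 < t \<and> t < 1) (at_right 0)"
    by (auto simp: eventually_at_right_field intro!: exI[of _ 1])
  from eventually_conj[OF this eventually_conj[OF up lo]] show ?thesis
    using eventually_happens'[of "at_right (0::real)"] by auto
qed

text \<open>Chernoff's bound for both tails, which explains the factor 2. The rate \<rho> depends on
  \<epsilon> but not on the dimension r, and this makes the bounds summable in r.\<close>

lemma std_cgauss_norm_concentration:
  assumes \<epsilon>: "0 < \<epsilon>"
  obtains \<rho> where "0 < \<rho>" "\<rho> < 1"
    "\<And>r. measure (std_cgauss r) {g\<in>space (std_cgauss r). \<bar>(\<Sum>m<r. (cmod (cg g m))\<^sup>2) / 2 - real r\<bar> \<ge> \<epsilon> * real r} \<le> 2 * \<rho> ^ r"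
proof -
  obtain t where t: "0 < t" "t < 1" and a: "exp (- t * (1 + \<epsilon>)) / (1 - t) < 1" and b: "exp (t * (1 - \<epsilon>)) / (1 + t) < 1"
    using chernoff_rate_exists[OF \<epsilon>] by blast
  define \<rho> where "\<rho> = max (exp (- t * (1 + \<epsilon>)) / (1 - t)) (exp (t * (1 - \<epsilon>)) / (1 + t))"
  have \<rho>: "0 < \<rho>" "\<rho> < 1" using t a b unfolding \<rho>_def by (auto simp: less_max_iff_disj)
  show ?thesis
  proof (rule that[OF \<rho>])
    fix r
    interpret prob_space "std_cgauss r" by (rule prob_space_std_cgauss)
    let ?S = "\<lambda>g. (\<Sum>m<r. (cmod (cg g m))\<^sup>2)"
    \<comment> \<open>One exponential Markov inequality serves both tails: u = t with c = 1 +
      \<epsilon> is the upper one, and for u = -t with c = 1 - \<epsilon> the sign of u reverses the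
      inequality.\<close>
    have tail: "prob {g\<in>space (std_cgauss r). u * ?S g / 2 \<ge> u * c * real r} \<le> (exp (- u * c) / (1 - u)) ^ r"
      if u: "u < 1" for u c
    proof -
      have "prob {g\<in>space (std_cgauss r). exp (u * ?S g / 2) \<ge> exp (u * c * real r)} \<le>
         expectation (\<lambda>g. exp (u * ?S g / 2)) / exp (u * c * real r)"
        by (rule integral_Markov_inequality_measure[where A="{}"])
           (auto simp: std_cgauss_norm_mgf[OF u] std_cgauss_norm_mgf(1)[OF u])
      also have "\<dots> = (exp (- u * c) / (1 - u)) ^ r"
      proof -
        have "exp (- u * c) ^ r = inverse (exp (u * c * real r))"
          by (simp add: exp_of_nat2_mult[symmetric] exp_minus[symmetric])
        then show ?thesis using u
          by (simp add: std_cgauss_norm_mgf[OF u] power_divide field_simps)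
      qed
      finally show ?thesis by simp
    qed
    have "prob {g\<in>space (std_cgauss r). \<bar>?S g / 2 - real r\<bar> \<ge> \<epsilon> * real r} \<le>
      prob ({g\<in>space (std_cgauss r). t * ?S g / 2 \<ge> t * (1 + \<epsilon>) * real r} \<union>
            {g\<in>space (std_cgauss r). (-t) * ?S g / 2 \<ge> (-t) * (1 - \<epsilon>) * real r})"
    proof (rule finite_measure_mono)
      have "t * s / 2 \<ge> t * (1 + \<epsilon>) * real r \<or> (-t) * s / 2 \<ge> (-t) * (1 - \<epsilon>) * real r"
        if "\<bar>s / 2 - real r\<bar> \<ge> \<epsilon> * real r" for s
      proof -
        have "s / 2 \<ge> (1 + \<epsilon>) * real r \<or> s / 2 \<le> (1 - \<epsilon>) * real r"
          using that by (auto simp: abs_if algebra_simps split: if_splits)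
        then show ?thesis
          using mult_left_mono[of "(1 + \<epsilon>) * real r" "s / 2" t] mult_left_mono[of "s / 2" "(1 - \<epsilon>) * real r" t] t
          by (auto simp: mult.assoc)
      qed
      then show "{g\<in>space (std_cgauss r). \<bar>?S g / 2 - real r\<bar> \<ge> \<epsilon> * real r} \<subseteq>
        {g\<in>space (std_cgauss r). t * ?S g / 2 \<ge> t * (1 + \<epsilon>) * real r} \<union>
            {g\<in>space (std_cgauss r). (-t) * ?S g / 2 \<ge> (-t) * (1 - \<epsilon>) * real r}"
        by blast
    qed measurable
    also have "\<dots> \<le> prob {g\<in>space (std_cgauss r). t * ?S g / 2 \<ge> t * (1 + \<epsilon>) * real r} +
            prob {g\<in>space (std_cgauss r). (-t) * ?S g / 2 \<ge> (-t) * (1 - \<epsilon>) * real r}"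
      by (rule measure_Un_le) measurable
    also have "\<dots> \<le> (exp (- t * (1 + \<epsilon>)) / (1 - t)) ^ r + (exp (- (-t) * (1 - \<epsilon>)) / (1 - (-t))) ^ r"
      using t by (intro add_mono tail) auto
    also have "\<dots> \<le> \<rho> ^ r + \<rho> ^ r"
      using t by (intro add_mono power_mono) (auto simp: \<rho>_def)
    finally show "prob {g\<in>space (std_cgauss r). \<bar>?S g / 2 - real r\<bar> \<ge> \<epsilon> * real r} \<le> 2 * \<rho> ^ r" by simp
  qed
qed

text \<open>Orthonormal coordinates of a standard vector in dimension n have the law of a standard
  vector in dimension r, so the Chernoff bound in dimension r becomes available for them.\<close>

lemma orthonormal_cgauss_concentration:
  assumes on: "\<And>i j. i < r \<Longrightarrow> j < r \<Longrightarrow> (\<Sum>m<n. cnj (q i m) * q j m) = (if i = j then 1 else 0)"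
  shows "measure (std_cgauss n) {g\<in>space (std_cgauss n).
       \<bar>(\<Sum>i<r. (cmod (\<Sum>m<n. cnj (q i m) * cg g m))\<^sup>2) / 2 - real r\<bar> \<ge> \<epsilon> * real r}
     = measure (std_cgauss r) {g\<in>space (std_cgauss r). \<bar>(\<Sum>m<r. (cmod (cg g m))\<^sup>2) / 2 - real r\<bar> \<ge> \<epsilon> * real r}"
proof -
  define A where "A = {z\<in>space (Pi\<^sub>M {..<r} (\<lambda>_. borel :: complex measure)). \<bar>(\<Sum>i<r. (cmod (z i))\<^sup>2) / 2 - real r\<bar> \<ge> \<epsilon> * real r}"
  have A: "A \<in> sets (Pi\<^sub>M {..<r} (\<lambda>_. borel))" unfolding A_def by measurable
  have "measure (distr (std_cgauss n) (Pi\<^sub>M {..<r} (\<lambda>_. borel)) (\<lambda>g. \<lambda>i\<in>{..<r}. \<Sum>m<n. cnj (q i m) * cg g m)) A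
     = measure (distr (std_cgauss r) (Pi\<^sub>M {..<r} (\<lambda>_. borel)) (\<lambda>g. \<lambda>i\<in>{..<r}. cg g i)) A"
    by (simp only: orthonormal_cgauss_distr[OF on])
  then show ?thesis
    by (subst (asm) (1 2) measure_distr; (intro A measurable_restrict; measurable)?)
       (simp add: A_def vimage_def Int_def space_PiM conj_commute)
qed

section \<open>Linear forms in the rows of the channel matrix\<close>

lemma borel_measurable_cnj [measurable]: "cnj \<in> borel_measurable borel"
  by (intro borel_measurable_continuous_onI continuous_intros)

section \<open>Real Gaussian variables: moments, characteristic function, atoms\<close>

lemma gaussian_var_square_integrable:
  assumes "prob_space M" "gaussian_var M X"
  shows "integrable M (\<lambda>x. (X x)\<^sup>2)" "integrable M X"
proof -
  interpret prob_space M by fact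
  have [measurable]: "X \<in> borel_measurable M" using assms by (simp add: gaussian_var_def)
  show *: "integrable M (\<lambda>x. (X x)\<^sup>2)"
    using assms(2) unfolding gaussian_var_def
  proof (elim conjE disjE exE)
    fix c assume "AE x in M. X x = c"
    then have "AE x in M. (X x)\<^sup>2 = c\<^sup>2" by (auto elim: eventually_mono)
    then show ?thesis by (subst integrable_cong_AE[where g="\<lambda>_. c\<^sup>2"]) auto
  next
    fix \<mu> s :: real assume s: "0 < s" and d: "distributed M lborel X (normal_density \<mu> s)"
    have "integrable lborel (\<lambda>x. normal_density \<mu> s x * (x - \<mu>)\<^sup>2)"
      using integrable_normal_moment[OF s, of \<mu> 2] by simp
    moreover have "integrable lborel (\<lambda>x. normal_density \<mu> s x * (x - \<mu>) ^ 1)"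
      by (rule integrable_normal_moment[OF s])
    moreover have "integrable lborel (normal_density \<mu> s)" using s by simp
    ultimately have "integrable lborel (\<lambda>x. normal_density \<mu> s x * (x - \<mu>)\<^sup>2 + 2 * \<mu> * (normal_density \<mu> s x * (x - \<mu>) ^ 1)
       + \<mu>\<^sup>2 * normal_density \<mu> s x)" by auto
    also have "(\<lambda>x. normal_density \<mu> s x * (x - \<mu>)\<^sup>2 + 2 * \<mu> * (normal_density \<mu> s x * (x - \<mu>) ^ 1)
       + \<mu>\<^sup>2 * normal_density \<mu> s x) = (\<lambda>x. normal_density \<mu> s x * x\<^sup>2)"
      by (auto simp: fun_eq_iff power2_eq_square algebra_simps)
    finally show ?thesis
      using distributed_integrable[OF d, of "\<lambda>x. x\<^sup>2"] by simp
  qed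
  show "integrable M X" by (rule square_integrable_imp_integrable[OF _ *]) simp
qed

text \<open>Degenerate variables fit the formula: mean 0 forces the constant to be 0, and the second
  moment is then 0. Otherwise the variable is rescaled to the standard normal law.\<close>

lemma gaussian_var_char:
  assumes "prob_space M" and G: "gaussian_var M X" and mean: "(LINT x|M. X x) = 0"
  shows "(LINT x|M. cis (X x)) = exp (- (LINT x|M. (X x)\<^sup>2) / 2)"
proof -
  interpret prob_space M by fact
  have [measurable]: "X \<in> borel_measurable M" using G by (simp add: gaussian_var_def)
  show ?thesis
    using G unfolding gaussian_var_def
  proof (elim conjE disjE exE)
    fix c assume c: "AE x in M. X x = c"
    have "(LINT x|M. X x) = (LINT x|M. c)" by (rule integral_cong_AE) (use c in auto)
    then have "c = 0" using mean by (simp add: prob_space)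
    then have "(LINT x|M. cis (X x)) = (LINT x|M. 1)" "(LINT x|M. (X x)\<^sup>2) = (LINT x|M. 0)"
      using c by (auto intro!: integral_cong_AE elim: eventually_mono simp del: lebesgue_integral_const integral_zero)
    then show ?thesis by (simp add: prob_space)
  next
    fix \<mu> s :: real assume s: "0 < s" and d: "distributed M lborel X (normal_density \<mu> s)"
    have "\<mu> = 0" using mean normal_distributed_expectation[OF s d] by simp
    have var: "(LINT x|M. (X x)\<^sup>2) = s\<^sup>2"
      using normal_distributed_variance[OF s d] mean by simp
    have d': "distributed M lborel (\<lambda>x. X x / s) std_normal_density"
      using normal_standard_normal_convert[OF s, of X \<mu>] d \<open>\<mu> = 0\<close> by simp
    have "(LINT x|M. cis (X x)) = (LINT x|distr M borel (\<lambda>x. X x / s). cis (s * x))"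
      using s by (subst integral_distr) auto
    also have "distr M borel (\<lambda>x. X x / s) = std_normal_distribution"
      using distributed_distr_eq_density[OF d'] by (simp cong: distr_cong)
    also have "(LINT x|std_normal_distribution. cis (s * x)) = exp (- (s\<^sup>2) / 2)"
      using fun_cong[OF char_std_normal_distribution, of s] by (simp add: char_def cis_conv_exp)
    finally show ?thesis by (simp add: var)
  qed
qed

text \<open>The nonzero second moment excludes the degenerate alternative, whose constant would be
  the mean 0, and a law with a density does not charge a point.\<close>

lemma gaussian_var_AE_nonzero:
  assumes "prob_space M" and G: "gaussian_var M X" and mean: "(LINT x|M. X x) = 0"
    and var: "(LINT x|M. (X x)\<^sup>2) \<noteq> 0"
  shows "AE x in M. X x \<noteq> 0"
proof -
  interpret prob_space M by fact
  have [measurable]: "X \<in> borel_measurable M" using G by (simp add: gaussian_var_def)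
  show ?thesis
    using G unfolding gaussian_var_def
  proof (elim conjE disjE exE)
    fix c assume c: "AE x in M. X x = c"
    have "(LINT x|M. X x) = (LINT x|M. c)" by (rule integral_cong_AE) (use c in auto)
    then have "c = 0" using mean by (simp add: prob_space)
    then have "(LINT x|M. (X x)\<^sup>2) = (LINT x|M. 0)"
      using c by (auto intro!: integral_cong_AE elim: eventually_mono simp del: lebesgue_integral_const integral_zero)
    then show ?thesis using var by simp
  next
    fix \<mu> s :: real assume s: "0 < s" and d: "distributed M lborel X (normal_density \<mu> s)"
    have "AE x in distr M lborel X. x \<noteq> 0"
      unfolding distributed_distr_eq_density[OF d]
      by (subst AE_density) (use AE_lborel_singleton[of 0] in \<open>auto elim: eventually_mono\<close>)
    then show ?thesis by (subst (asm) AE_distr_iff) auto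
  qed
qed

text \<open>For a row \<open>h\<close> with covariance matrix \<open>S\<close> this is the second moment of \<open>\<Sum>a<N. d a * h a\<close>;
  it is real because \<open>S\<close> is Hermitian.\<close>

definition cform :: "nat \<Rightarrow> complex mat \<Rightarrow> (nat \<Rightarrow> complex) \<Rightarrow> real" where
  "cform N S d = Re (\<Sum>a<N. \<Sum>b<N. cnj (d a) * d b * S $$ (a, b))"

text \<open>The covariance gives only E |Y|^2 for the linear form Y. Invariance of the law under
  rotation by pi/2 exchanges its real and imaginary part up to sign, so each carries half of this
  second moment.\<close>

lemma complex_gaussian_linear:
  assumes P: "prob_space M" and G: "complex_gaussian M N X" and C: "circularly_symmetric M N X"
    and Z: "zero_mean M N X"
    and S: "\<And>a b. a < N \<Longrightarrow> b < N \<Longrightarrow> (LINT x|M. cnj (X x a) * X x b) = S $$ (a, b)"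
  shows "gaussian_var M (\<lambda>x. Re (\<Sum>i<N. d i * X x i))"
    and "(LINT x|M. Re (\<Sum>i<N. d i * X x i)) = 0"
    and "(LINT x|M. (Re (\<Sum>i<N. d i * X x i))\<^sup>2) = cform N S d / 2"
proof -
  interpret prob_space M by fact
  have [measurable]: "(\<lambda>x. X x i) \<in> borel_measurable M" if "i < N" for i
    using G that by (simp add: complex_gaussian_def)
  have G': "gaussian_var M (\<lambda>x. Re (\<Sum>i<N. c i * X x i))" for c
    using G by (simp add: complex_gaussian_def)
  show "gaussian_var M (\<lambda>x. Re (\<Sum>i<N. d i * X x i))" by (rule G')
  have coord: "gaussian_var M (\<lambda>x. Re (u * X x i))" if i: "i < N" for u i
  proof -
    have "(\<Sum>j<N. (if j = i then u else 0) * X x j) = u * X x i" for x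
      using i by (simp add: if_distrib[of "\<lambda>c. c * _"] cong: if_cong)
    then show ?thesis using G'[of "\<lambda>j. if j = i then u else 0"] by simp
  qed
  have gv1: "gaussian_var M (\<lambda>x. Re (X x i))" and gv2: "gaussian_var M (\<lambda>x. Im (X x i))" if "i < N" for i
    using coord[OF that, of 1] coord[OF that, of "- \<i>"] by simp_all
  have sq: "integrable M (\<lambda>x. (cmod (X x i))\<^sup>2)" if "i < N" for i
    unfolding cmod_power2
    by (intro Bochner_Integration.integrable_add gaussian_var_square_integrable[OF P] gv1 gv2 that)
  have int1: "integrable M (\<lambda>x. X x i)" if "i < N" for i
  proof -
    have "integrable M (\<lambda>x. complex_of_real (Re (X x i)) + \<i> * complex_of_real (Im (X x i)))"
      using gaussian_var_square_integrable(2)[OF P gv1[OF that]] gaussian_var_square_integrable(2)[OF P gv2[OF that]] by auto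
    then show ?thesis by (simp add: complex_eq[symmetric])
  qed
  have int2: "integrable M (\<lambda>x. cnj (X x a) * X x b)" if "a < N" "b < N" for a b
  proof (rule Bochner_Integration.integrable_bound)
    show "integrable M (\<lambda>x. (cmod (X x a))\<^sup>2 + (cmod (X x b))\<^sup>2)" using sq that by auto
    have "cmod (X x a) * cmod (X x b) \<le> (cmod (X x a))\<^sup>2 + (cmod (X x b))\<^sup>2" for x
    proof -
      have "2 * (cmod (X x a) * cmod (X x b)) \<le> (cmod (X x a))\<^sup>2 + (cmod (X x b))\<^sup>2"
        using sum_squares_bound[of "cmod (X x a)" "cmod (X x b)"] by simp
      moreover have "0 \<le> cmod (X x a) * cmod (X x b)" by simp
      ultimately show ?thesis by linarith
    qed
    then show "AE x in M. cmod (cnj (X x a) * X x b) \<le> norm ((cmod (X x a))\<^sup>2 + (cmod (X x b))\<^sup>2)"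
      by (auto simp: norm_mult)
  qed (use that in measurable)
  let ?Y = "\<lambda>x. \<Sum>i<N. d i * X x i"
  have intY: "integrable M ?Y" using int1 by auto
  have "(LINT x|M. ?Y x) = (\<Sum>i<N. d i * (LINT x|M. X x i))"
    by (subst Bochner_Integration.integral_sum) (use int1 in auto)
  also have "\<dots> = 0" using Z by (simp add: zero_mean_def)
  finally show "(LINT x|M. Re (?Y x)) = 0" by (simp only: integral_Re[OF intY]) simp
  have absY: "complex_of_real ((cmod (?Y x))\<^sup>2) = (\<Sum>a<N. \<Sum>b<N. cnj (d a) * d b * (cnj (X x a) * X x b))" for x
  proof -
    have "complex_of_real ((cmod (?Y x))\<^sup>2) = cnj (?Y x) * ?Y x"
      by (simp only: complex_norm_square mult.commute)
    also have "\<dots> = (\<Sum>a<N. \<Sum>b<N. cnj (d a) * d b * (cnj (X x a) * X x b))"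
      unfolding cnj_sum sum_product by (intro sum.cong refl) (simp add: mult_ac)
    finally show ?thesis .
  qed
  have "complex_of_real (LINT x|M. (cmod (?Y x))\<^sup>2) = (LINT x|M. complex_of_real ((cmod (?Y x))\<^sup>2))"
    by (rule integral_complex_of_real[symmetric])
  also have "\<dots> = (\<Sum>a<N. \<Sum>b<N. cnj (d a) * d b * S $$ (a, b))"
    unfolding absY using int2
    by (subst Bochner_Integration.integral_sum, force)+ (simp add: S)
  finally have abs: "(LINT x|M. (cmod (?Y x))\<^sup>2) = cform N S d"
    unfolding cform_def by (metis Re_complex_of_real)
  \<comment> \<open>A function on the coordinate space, so that the equality of laws can be applied
    to it.\<close>
  define R where "R u z = (Re (u * (\<Sum>i<N. d i * z i)))\<^sup>2" for u z
  have Rm: "R u \<in> borel_measurable (cvec_space N)" for u unfolding R_def by measurable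
  have "distr M (cvec_space N) (\<lambda>x. \<lambda>i\<in>{..<N}. cis (pi/2) * X x i) = distr M (cvec_space N) (\<lambda>x. \<lambda>i\<in>{..<N}. X x i)"
    using C unfolding circularly_symmetric_def by blast
  then have "(LINT z|distr M (cvec_space N) (\<lambda>x. \<lambda>i\<in>{..<N}. cis (pi/2) * X x i). R 1 z) =
    (LINT z|distr M (cvec_space N) (\<lambda>x. \<lambda>i\<in>{..<N}. X x i). R 1 z)" by simp
  then have "(LINT x|M. R 1 (\<lambda>i\<in>{..<N}. cis (pi/2) * X x i)) = (LINT x|M. R 1 (\<lambda>i\<in>{..<N}. X x i))"
    by (subst (asm) (1 2) integral_distr) (use Rm in \<open>auto intro!: measurable_restrict\<close>)
  moreover have "R 1 (\<lambda>i\<in>{..<N}. cis (pi/2) * X x i) = (Im (?Y x))\<^sup>2" for x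
  proof -
    have "(\<Sum>i<N. d i * (cis (pi/2) * X x i)) = \<i> * ?Y x"
      by (simp add: sum_distrib_left mult_ac)
    moreover have "R 1 (\<lambda>i\<in>{..<N}. cis (pi/2) * X x i) = (Re (\<Sum>i<N. d i * (cis (pi/2) * X x i)))\<^sup>2"
      by (simp add: R_def)
    moreover have "Re (\<i> * w) = - Im w" for w by simp
    ultimately show ?thesis by (simp only: power2_minus)
  qed
  moreover have "R 1 (\<lambda>i\<in>{..<N}. X x i) = (Re (?Y x))\<^sup>2" for x by (simp add: R_def)
  ultimately have eq: "(LINT x|M. (Im (?Y x))\<^sup>2) = (LINT x|M. (Re (?Y x))\<^sup>2)" by simp
  have r: "integrable M (\<lambda>x. (Re (?Y x))\<^sup>2)"
    by (rule gaussian_var_square_integrable[OF P G'])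
  have "gaussian_var M (\<lambda>x. Re (\<Sum>i<N. (- \<i> * d i) * X x i))" by (rule G')
  moreover have "(\<Sum>i<N. (- \<i> * d i) * X x i) = - \<i> * ?Y x" for x by (simp add: sum_distrib_left mult.assoc)
  ultimately have "gaussian_var M (\<lambda>x. Im (?Y x))" by simp
  then have i: "integrable M (\<lambda>x. (Im (?Y x))\<^sup>2)" by (rule gaussian_var_square_integrable[OF P])
  have "(LINT x|M. (cmod (?Y x))\<^sup>2) = (LINT x|M. (Re (?Y x))\<^sup>2) + (LINT x|M. (Im (?Y x))\<^sup>2)"
    unfolding cmod_power2 by (rule Bochner_Integration.integral_add[OF r i])
  then show "(LINT x|M. (Re (?Y x))\<^sup>2) = cform N S d / 2" using eq abs by simp
qed

lemma channel_matrix_entry_measurable: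
  assumes "channel_matrix M n N S H" "m < n" "j < N"
  shows "(\<lambda>x. H x $$ (m, j)) \<in> borel_measurable M"
  using assms unfolding channel_matrix_def complex_gaussian_def mat_row_fun_def by fastforce

lemma channel_matrix_row_linear:
  assumes P: "prob_space M" and H: "channel_matrix M n N S H" and m: "m < n"
  shows "gaussian_var M (\<lambda>x. Re (\<Sum>i<N. d i * H x $$ (m, i)))"
    and "(LINT x|M. Re (\<Sum>i<N. d i * H x $$ (m, i))) = 0"
    and "(LINT x|M. (Re (\<Sum>i<N. d i * H x $$ (m, i)))\<^sup>2) = cform N S d / 2"
proof -
  have row: "complex_gaussian M N (\<lambda>x. mat_row_fun N (H x) m)"
     "circularly_symmetric M N (\<lambda>x. mat_row_fun N (H x) m)"
     "zero_mean M N (\<lambda>x. mat_row_fun N (H x) m)"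
     "\<And>a b. a < N \<Longrightarrow> b < N \<Longrightarrow> (LINT x|M. cnj (mat_row_fun N (H x) m a) * mat_row_fun N (H x) m b) = S $$ (a, b)"
    using H m by (auto simp: channel_matrix_def mat_row_fun_def)
  note lin = complex_gaussian_linear[OF P row, of d]
  have eq: "(\<Sum>i<N. d i * mat_row_fun N (H x) m i) = (\<Sum>i<N. d i * H x $$ (m, i))" for x
    by (simp add: mat_row_fun_def)
  show "gaussian_var M (\<lambda>x. Re (\<Sum>i<N. d i * H x $$ (m, i)))"
    "(LINT x|M. Re (\<Sum>i<N. d i * H x $$ (m, i))) = 0"
    "(LINT x|M. (Re (\<Sum>i<N. d i * H x $$ (m, i)))\<^sup>2) = cform N S d / 2"
    using lin by (simp_all only: eq)
qed

text \<open>A row contributes a real Gaussian variable of variance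
  \<open>cform N S (c m) / 2\<close>, hence the denominator 4 in the exponent. The set K of rows is
  arbitrary because the argument for the minors splits off a single row.\<close>

lemma channel_matrix_char:
  assumes P: "prob_space M" and H: "channel_matrix M n N S H" and K: "K \<subseteq> {..<n}"
  shows "(LINT x|M. cis (Re (\<Sum>m\<in>K. \<Sum>j<N. c m j * H x $$ (m, j)))) = exp (- (\<Sum>m\<in>K. cform N S (c m)) / 4)"
proof -
  interpret prob_space M by fact
  have finK: "finite K" using K finite_subset by blast
  have ind: "indep_vars (\<lambda>_. cvec_space N) (\<lambda>m x. mat_row_fun N (H x) m) {..<n}"
    using H by (simp add: channel_matrix_def)
  have "indep_vars (\<lambda>_. borel) (\<lambda>m x. (\<lambda>z. cis (Re (\<Sum>j<N. c m j * z j))) (mat_row_fun N (H x) m)) K"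
    by (rule indep_vars_compose2[OF indep_vars_subset[OF ind K]]) measurable
  then have ind': "indep_vars (\<lambda>_. borel) (\<lambda>m x. cis (Re (\<Sum>j<N. c m j * H x $$ (m, j)))) K"
    by (simp add: mat_row_fun_def)
  have cisprod: "cis (sum f K) = (\<Prod>i\<in>K. cis (f i))" for f
    using finK by (induction K rule: finite_induct) (auto simp: cis_mult[symmetric])
  have "(LINT x|M. cis (Re (\<Sum>m\<in>K. \<Sum>j<N. c m j * H x $$ (m, j)))) =
     (LINT x|M. (\<Prod>m\<in>K. cis (Re (\<Sum>j<N. c m j * H x $$ (m, j)))))"
    by (simp only: Re_sum[of _ K] cisprod)
  also have "\<dots> = (\<Prod>m\<in>K. (LINT x|M. cis (Re (\<Sum>j<N. c m j * H x $$ (m, j)))))"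
  proof (rule indep_vars_lebesgue_integral[OF finK ind'])
    fix m assume "m \<in> K"
    then have m: "m < n" using K by auto
    have [measurable]: "(\<lambda>x. H x $$ (m, j)) \<in> borel_measurable M" if "j < N" for j
      by (rule channel_matrix_entry_measurable[OF H m that])
    show "integrable M (\<lambda>x. cis (Re (\<Sum>j<N. c m j * H x $$ (m, j))))"
      by (rule integrable_const_bound[where B=1]) auto
  qed
  also have "\<dots> = (\<Prod>m\<in>K. complex_of_real (exp (- (cform N S (c m) / 2) / 2)))"
  proof (intro prod.cong refl)
    fix m assume "m \<in> K"
    then have m: "m < n" using K by auto
    note lin = channel_matrix_row_linear[OF P H m, of "c m"]
    show "(LINT x|M. cis (Re (\<Sum>j<N. c m j * H x $$ (m, j)))) = complex_of_real (exp (- (cform N S (c m) / 2) / 2))"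
      using gaussian_var_char[OF P lin(1,2)] by (simp only: lin(3))
  qed
  also have "\<dots> = exp (- (\<Sum>m\<in>K. cform N S (c m)) / 4)"
    by (simp add: exp_sum[OF finK, symmetric] sum_negf sum_divide_distrib flip: of_real_prod)
  finally show ?thesis .
qed

section \<open>Gram matrices and distances between columns\<close>

definition hdot :: "nat \<Rightarrow> (nat \<Rightarrow> complex) \<Rightarrow> (nat \<Rightarrow> complex) \<Rightarrow> complex" where
  "hdot n x y = (\<Sum>m<n. cnj (x m) * y m)"

lemma hdot_commute: "hdot n x y = cnj (hdot n y x)"
  by (simp add: hdot_def mult.commute)

lemma hdot_self: "hdot n x x = complex_of_real (\<Sum>m<n. (cmod (x m))\<^sup>2)"
  by (simp add: hdot_def complex_norm_square mult.commute del: of_real_power)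

lemma hdot_self_eq_0: "hdot n x x = 0 \<longleftrightarrow> (\<forall>m<n. x m = 0)"
  unfolding hdot_self of_real_eq_0_iff by (subst sum_nonneg_eq_0_iff) auto

lemma hdot_sum_right: "hdot n x (\<lambda>m. \<Sum>i\<in>I. c i * f i m) = (\<Sum>i\<in>I. c i * hdot n x (f i))"
  unfolding hdot_def sum_distrib_left by (subst sum.swap) (simp add: mult_ac)

lemma hdot_diff_right: "hdot n x (\<lambda>m. y m - z m) = hdot n x y - hdot n x z"
  by (simp add: hdot_def algebra_simps sum_subtractf)

section \<open>Orthonormal systems orthogonal to given vectors\<close>

lemma singular_iff_kernel:
  fixes f :: "nat \<Rightarrow> nat \<Rightarrow> complex"
  shows "Determinant.det (Matrix.mat n n (\<lambda>(i, j). f i j)) = 0 \<longleftrightarrow>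
    (\<exists>y. (\<exists>j<n. y j \<noteq> 0) \<and> (\<forall>i<n. (\<Sum>j<n. f i j * y j) = 0))"
proof -
  have mv: "(Matrix.mat n n (\<lambda>(i, j). f i j) *\<^sub>v v = 0\<^sub>v n) \<longleftrightarrow> (\<forall>i<n. (\<Sum>j<n. f i j * v $ j) = 0)"
    if "v \<in> carrier_vec n" for v
    using that by (auto simp: vec_eq_iff scalar_prod_def atLeast0LessThan)
  show ?thesis
  proof
    assume "Determinant.det (Matrix.mat n n (\<lambda>(i, j). f i j)) = 0"
    then obtain v where v: "v \<in> carrier_vec n" "v \<noteq> 0\<^sub>v n" "Matrix.mat n n (\<lambda>(i, j). f i j) *\<^sub>v v = 0\<^sub>v n"
      by (subst (asm) det_0_iff_vec_prod_zero[of _ n]) auto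
    then show "\<exists>y. (\<exists>j<n. y j \<noteq> 0) \<and> (\<forall>i<n. (\<Sum>j<n. f i j * y j) = 0)"
      by (intro exI[of _ "\<lambda>j. v $ j"]) (use mv[OF v(1)] in \<open>auto simp: vec_eq_iff\<close>)
  next
    assume "\<exists>y. (\<exists>j<n. y j \<noteq> 0) \<and> (\<forall>i<n. (\<Sum>j<n. f i j * y j) = 0)"
    then obtain y where y: "\<exists>j<n. y j \<noteq> 0" "\<forall>i<n. (\<Sum>j<n. f i j * y j) = 0" by blast
    have c: "Matrix.vec n y \<in> carrier_vec n" by simp
    have "Matrix.mat n n (\<lambda>(i, j). f i j) *\<^sub>v Matrix.vec n y = 0\<^sub>v n"
      unfolding mv[OF c] using y by auto
    moreover have "Matrix.vec n y \<noteq> 0\<^sub>v n" using y by (auto simp: vec_eq_iff)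
    ultimately show "Determinant.det (Matrix.mat n n (\<lambda>(i, j). f i j)) = 0"
      by (subst det_0_iff_vec_prod_zero[of _ n]) (auto intro!: exI[of _ "Matrix.vec n y"])
  qed
qed

text \<open>Replacing row s by zero makes the matrix with rows \<open>cnj (c i)\<close> singular; a
  kernel vector is orthogonal to all the other vectors and can be normalised.\<close>

lemma ex_unit_orthogonal:
  fixes c :: "nat \<Rightarrow> nat \<Rightarrow> complex"
  assumes s: "s < n"
  obtains z where "hdot n z z = 1" "\<And>i. i < n \<Longrightarrow> i \<noteq> s \<Longrightarrow> hdot n (c i) z = 0"
proof -
  let ?f = "\<lambda>i j. if i = s then 0 else cnj (c i j)"
  have "Determinant.det (Matrix.mat n n (\<lambda>(i, j). ?f i j)) = 0"
    by (subst laplace_expansion_row[where i=s and n=n]) (use s in auto)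
  then obtain y where y: "\<exists>j<n. y j \<noteq> 0" "\<forall>i<n. (\<Sum>j<n. ?f i j * y j) = 0"
    unfolding singular_iff_kernel by blast
  define t where "t = (\<Sum>m<n. (cmod (y m))\<^sup>2)"
  have "t \<noteq> 0" using y(1) unfolding t_def by (subst sum_nonneg_eq_0_iff) auto
  moreover have "t \<ge> 0" unfolding t_def by (intro sum_nonneg) auto
  ultimately have t: "t > 0" by simp
  show ?thesis
  proof
    show "hdot n (\<lambda>m. y m / sqrt t) (\<lambda>m. y m / sqrt t) = 1"
      unfolding hdot_self using t
      by (simp add: norm_divide power_divide sum_divide_distrib[symmetric] t_def[symmetric])
    show "hdot n (c i) (\<lambda>m. y m / sqrt t) = 0" if "i < n" "i \<noteq> s" for i
      using y(2) that by (auto simp: hdot_def sum_divide_distrib[symmetric])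
  qed
qed

text \<open>Slots already in S hold q i, the other slots hold c i. The induction step refills slot s
  by a unit vector orthogonal to all other slots, hence to the earlier q i and to the remaining c
  j.\<close>

lemma ex_orthonormal_completion:
  assumes "finite S" "S \<subseteq> {..<n}"
  shows "\<exists>q. (\<forall>i\<in>S. \<forall>j\<in>S. hdot n (q i) (q j) = (if i = j then 1 else 0)) \<and>
             (\<forall>i\<in>S. \<forall>j\<in>{..<n} - S. hdot n (c j) (q i) = 0)"
  using assms
proof (induction S)
  case (insert s S)
  then obtain q where q: "\<forall>i\<in>S. \<forall>j\<in>S. hdot n (q i) (q j) = (if i = j then 1 else 0)"
    "\<forall>i\<in>S. \<forall>j\<in>{..<n} - S. hdot n (c j) (q i) = 0" by auto
  have s: "s < n" using insert by auto
  obtain z where z: "hdot n z z = 1" "\<And>i. i < n \<Longrightarrow> i \<noteq> s \<Longrightarrow> hdot n (if i \<in> S then q i else c i) z = 0"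
    by (rule ex_unit_orthogonal[OF s, of "\<lambda>i. if i \<in> S then q i else c i"]) blast
  have qz: "hdot n (q i) z = 0" "hdot n z (q i) = 0" if "i \<in> S" for i
  proof -
    show "hdot n (q i) z = 0" using z(2)[of i] that insert by auto
    then show "hdot n z (q i) = 0" by (subst hdot_commute) simp
  qed
  show ?case
    proof (intro exI[of _ "q(s := z)"] conjI ballI)
    show "hdot n ((q(s := z)) i) ((q(s := z)) j) = (if i = j then 1 else 0)" if "i \<in> insert s S" "j \<in> insert s S" for i j
      using that q(1) z(1) qz insert.hyps by auto
    show "hdot n (c j) ((q(s := z)) i) = 0" if "i \<in> insert s S" "j \<in> {..<n} - insert s S" for i j
      using that q(2) z(2)[of j] by auto
  qed
qed auto

text \<open>The q i together with the c j off S form a basis of the whole space. A vector orthogonal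
  to those c j equals its projection onto the span of the q i, since the remainder is orthogonal to
  the entire basis.\<close>

lemma orthonormal_completion_parseval:
  assumes S: "S \<subseteq> {..<n}"
    and on: "\<forall>i\<in>S. \<forall>j\<in>S. hdot n (q i) (q j) = (if i = j then 1 else 0)"
    and orth: "\<forall>i\<in>S. \<forall>j\<in>{..<n} - S. hdot n (c j) (q i) = 0"
    and ind: "\<And>v. (\<forall>m<n. (\<Sum>j\<in>{..<n} - S. v j * c j m) = 0) \<Longrightarrow> \<forall>j\<in>{..<n} - S. v j = 0"
    and z: "\<forall>j\<in>{..<n} - S. hdot n (c j) z = 0"
  shows "(\<Sum>m<n. (cmod (z m))\<^sup>2) = (\<Sum>i\<in>S. (cmod (hdot n (q i) z))\<^sup>2)"
proof -
  have finS: "finite S" using S finite_subset by blast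
  define e where "e i = (if i \<in> S then q i else c i)" for i
  define w where "w m = z m - (\<Sum>i\<in>S. hdot n (q i) z * q i m)" for m
  have ew: "hdot n (e i) w = 0" if "i < n" for i
  proof (cases "i \<in> S")
    case True
    have "(\<Sum>j\<in>S. hdot n (q j) z * hdot n (q i) (q j)) = (\<Sum>j\<in>S. if i = j then hdot n (q j) z else 0)"
      using True on by (intro sum.cong) auto
    then show ?thesis using True finS by (simp add: w_def[abs_def] hdot_diff_right hdot_sum_right e_def)
  next
    case False
    then show ?thesis using that z orth by (simp add: w_def[abs_def] hdot_diff_right hdot_sum_right e_def)
  qed
  have "w m = 0" if m: "m < n" for m
  proof (rule ccontr)
    assume "w m \<noteq> 0"
    \<comment> \<open>A nonzero remainder would be a kernel vector, so the matrix and its transpose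
      would be singular and the e j linearly dependent. Pairing the relation with q i clears the
      coefficients in S, and \<open>ind\<close> clears the others.\<close>
    then have "Determinant.det (Matrix.mat n n (\<lambda>(i, j). cnj (e i j))) = 0"
      unfolding singular_iff_kernel using ew m by (intro exI[of _ w]) (auto simp: hdot_def)
    then have "Determinant.det (Matrix.mat n n (\<lambda>(i, j). cnj (e j i))) = 0"
    proof -
      have "transpose_mat (Matrix.mat n n (\<lambda>(i, j). cnj (e j i))) = Matrix.mat n n (\<lambda>(i, j). cnj (e i j))"
        by (rule eq_matI) auto
      then show ?thesis
        using Determinant.det_transpose[of "Matrix.mat n n (\<lambda>(i, j). cnj (e j i))" n]
          \<open>Determinant.det (Matrix.mat n n (\<lambda>(i, j). cnj (e i j))) = 0\<close> by simp
    qed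
    then obtain v where v: "\<exists>j<n. v j \<noteq> 0" "\<forall>i<n. (\<Sum>j<n. cnj (e j i) * v j) = 0"
      unfolding singular_iff_kernel by blast
    define u where "u j = cnj (v j)" for j
    have comb: "(\<Sum>j<n. u j * e j i) = 0" if "i < n" for i
    proof -
      have "(\<Sum>j<n. u j * e j i) = cnj (\<Sum>j<n. cnj (e j i) * v j)"
        by (simp add: u_def mult.commute)
      then show ?thesis using v(2) that by simp
    qed
    have uS: "u i = 0" if i: "i \<in> S" for i
    proof -
      have "0 = hdot n (q i) (\<lambda>m. \<Sum>j<n. u j * e j m)"
        using comb by (simp add: hdot_def)
      also have "\<dots> = (\<Sum>j<n. u j * hdot n (q i) (e j))" by (rule hdot_sum_right)
      also have "\<dots> = (\<Sum>j<n. if j = i then u i else 0)"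
      proof (intro sum.cong refl)
        fix j assume "j \<in> {..<n}"
        then show "u j * hdot n (q i) (e j) = (if j = i then u i else 0)"
          using i on orth hdot_commute[of n "q i" "c j"] by (auto simp: e_def)
      qed
      also have "\<dots> = u i" using i S by (simp add: subset_iff)
      finally show ?thesis by simp
    qed
    have "\<forall>i<n. (\<Sum>j\<in>{..<n} - S. u j * c j i) = 0"
    proof (intro allI impI)
      fix i assume "i < n"
      have "(\<Sum>j\<in>{..<n} - S. u j * c j i) = (\<Sum>j<n. u j * e j i)"
        by (rule sum.mono_neutral_cong_left) (auto simp: uS e_def)
      then show "(\<Sum>j\<in>{..<n} - S. u j * c j i) = 0" using comb \<open>i < n\<close> by simp
    qed
    then have "\<forall>j\<in>{..<n} - S. u j = 0" by (rule ind)
    with uS v(1) show False unfolding u_def by auto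
  qed
  then have zq: "z m = (\<Sum>i\<in>S. hdot n (q i) z * q i m)" if "m < n" for m
    using that unfolding w_def by simp
  have "complex_of_real (\<Sum>m<n. (cmod (z m))\<^sup>2) = hdot n z z" by (simp add: hdot_self)
  also have "\<dots> = hdot n z (\<lambda>m. \<Sum>i\<in>S. hdot n (q i) z * q i m)"
    using zq unfolding hdot_def[of n z] by (intro sum.cong) auto
  also have "\<dots> = (\<Sum>i\<in>S. hdot n (q i) z * hdot n z (q i))" by (rule hdot_sum_right)
  also have "\<dots> = complex_of_real (\<Sum>i\<in>S. (cmod (hdot n (q i) z))\<^sup>2)"
  proof -
    have "u * hdot n z (q i) = u * cnj (hdot n (q i) z)" for u i by (subst hdot_commute) simp
    then show ?thesis by (simp only: complex_norm_square of_real_sum)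
  qed
  finally show ?thesis by (simp only: of_real_eq_iff)
qed

section \<open>The Gram matrix, its inverse and the distance of a column\<close>

definition cols_indep :: "nat \<Rightarrow> nat \<Rightarrow> (nat \<Rightarrow> nat \<Rightarrow> complex) \<Rightarrow> bool" where
  "cols_indep n N a \<longleftrightarrow> (\<forall>y. (\<forall>m<n. (\<Sum>j<N. a m j * y j) = 0) \<longrightarrow> (\<forall>j<N. y j = 0))"

definition gram_mat :: "nat \<Rightarrow> nat \<Rightarrow> (nat \<Rightarrow> nat \<Rightarrow> complex) \<Rightarrow> complex mat" where
  "gram_mat n N a = Matrix.mat N N (\<lambda>(i, j). \<Sum>m<n. cnj (a m i) * a m j)"

lemma gram_mat_apply:
  "(\<Sum>j<N. (\<Sum>m<n. cnj (a m i) * a m j) * y j) = hdot n (\<lambda>m. a m i) (\<lambda>m. \<Sum>j<N. a m j * y j)"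
  unfolding hdot_def sum_distrib_left sum_distrib_right by (subst sum.swap) (simp add: mult.assoc)

lemma gram_quadratic_form:
  assumes "\<And>m. m < n \<Longrightarrow> z m = (\<Sum>j<N. a m j * y j)"
  shows "hdot n z z = (\<Sum>i<N. cnj (y i) * hdot n (\<lambda>m. a m i) z)"
proof -
  have "hdot n z z = hdot n z (\<lambda>m. \<Sum>j<N. y j * a m j)"
    using assms unfolding hdot_def by (intro sum.cong) (auto simp: mult.commute)
  also have "\<dots> = (\<Sum>i<N. y i * hdot n z (\<lambda>m. a m i))"
    by (rule hdot_sum_right[of n z y "\<lambda>i m. a m i"])
  finally have "cnj (hdot n z z) = cnj (\<Sum>i<N. y i * hdot n z (\<lambda>m. a m i))" by simp
  also have "cnj (hdot n z z) = hdot n z z" by (rule hdot_commute[symmetric])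
  also have "cnj (\<Sum>i<N. y i * hdot n z (\<lambda>m. a m i)) = (\<Sum>i<N. cnj (y i) * hdot n (\<lambda>m. a m i) z)"
    by (simp add: hdot_commute[symmetric])
  finally show ?thesis .
qed

text \<open>For A the matrix with entries a, y^H A^H A y is the squared norm of A y, so the Gram
  matrix and A have the same kernel.\<close>

lemma det_gram_mat_nonzero_iff: "Determinant.det (gram_mat n N a) \<noteq> 0 \<longleftrightarrow> cols_indep n N a"
proof -
  have "(\<forall>i<N. hdot n (\<lambda>m. a m i) (\<lambda>m. \<Sum>j<N. a m j * y j) = 0) \<longleftrightarrow> (\<forall>m<n. (\<Sum>j<N. a m j * y j) = 0)" for y
  proof
    assume "\<forall>i<N. hdot n (\<lambda>m. a m i) (\<lambda>m. \<Sum>j<N. a m j * y j) = 0"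
    then have "hdot n (\<lambda>m. \<Sum>j<N. a m j * y j) (\<lambda>m. \<Sum>j<N. a m j * y j) = 0"
      by (subst gram_quadratic_form[where N=N and a=a and y=y]) auto
    then show "\<forall>m<n. (\<Sum>j<N. a m j * y j) = 0" unfolding hdot_self_eq_0 .
  qed (simp add: hdot_def)
  then show ?thesis unfolding gram_mat_def singular_iff_kernel gram_mat_apply cols_indep_def by blast
qed

text \<open>The squared distance of column \<open>k\<close> from the span of the other columns, written as a
  rational function of the entries so that it is a Borel function of the matrix.\<close>

definition col_dist2 :: "nat \<Rightarrow> nat \<Rightarrow> nat \<Rightarrow> (nat \<Rightarrow> nat \<Rightarrow> complex) \<Rightarrow> complex" where
  "col_dist2 n N k a = Determinant.det (gram_mat n N a) / cofactor (gram_mat n N a) k k"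

text \<open>Here y is column k of the inverse Gram matrix and z = A y is the dual vector: it has
  product 1 with column k and 0 with the other columns. Expanding one factor gives |z|^2 = y k, and
  Parseval gives |z|^2 = |y k|^2 P, where P is the squared length of the projection of column k;
  hence y k P = 1. The index set consists of the n - N + 1 slots that the other columns leave
  free.\<close>

lemma gram_inverse_diag_eq_projection:
  assumes ind: "cols_indep n N a" and k: "k < N" and N: "N \<le> n"
    and on: "\<forall>i\<in>insert k {N..<n}. \<forall>j\<in>insert k {N..<n}. hdot n (q i) (q j) = (if i = j then 1 else 0)"
    and orth: "\<forall>i\<in>insert k {N..<n}. \<forall>j\<in>{..<N}-{k}. hdot n (\<lambda>m. a m j) (q i) = 0"
    and y: "\<And>i. i < N \<Longrightarrow> hdot n (\<lambda>m. a m i) (\<lambda>m. \<Sum>j<N. a m j * y j) = (if i = k then 1 else 0)"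
  shows "y k * complex_of_real (\<Sum>i\<in>insert k {N..<n}. (cmod (hdot n (q i) (\<lambda>m. a m k)))\<^sup>2) = 1"
proof -
  let ?S = "insert k {N..<n}"
  have nS: "{..<n} - ?S = {..<N} - {k}" using N k by auto
  define z where "z m = (\<Sum>j<N. a m j * y j)" for m
  have zc: "hdot n (\<lambda>m. a m i) z = (if i = k then 1 else 0)" if "i < N" for i
    using y[OF that] unfolding z_def[abs_def] .
  have "hdot n z z = (\<Sum>i<N. cnj (y i) * hdot n (\<lambda>m. a m i) z)"
    by (rule gram_quadratic_form) (simp add: z_def)
  also have "\<dots> = (\<Sum>i<N. if i = k then cnj (y k) else 0)"
    by (intro sum.cong) (auto simp: zc)
  also have "\<dots> = cnj (y k)" using k by simp
  finally have zz: "hdot n z z = cnj (y k)" .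
  then have "y k = cnj (complex_of_real (\<Sum>m<n. (cmod (z m))\<^sup>2))" unfolding hdot_self by simp
  then have yk: "y k = complex_of_real (\<Sum>m<n. (cmod (z m))\<^sup>2)" by simp
  have "y k \<noteq> 0"
  proof
    assume "y k = 0"
    then have "\<forall>m<n. z m = 0" using zz by (simp add: hdot_self_eq_0)
    then have "hdot n (\<lambda>m. a m k) z = 0" by (simp add: hdot_def)
    then show False using zc[OF k] by simp
  qed
  have "(\<Sum>m<n. (cmod (z m))\<^sup>2) = (\<Sum>i\<in>?S. (cmod (hdot n (q i) z))\<^sup>2)"
  proof (rule orthonormal_completion_parseval[where c="\<lambda>j m. a m j"])
    show "?S \<subseteq> {..<n}" using N k by auto
    show "\<forall>j\<in>{..<n} - ?S. hdot n (\<lambda>m. a m j) z = 0"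
      unfolding nS using zc by auto
    show "\<forall>j\<in>{..<n} - ?S. v j = 0" if v: "\<forall>m<n. (\<Sum>j\<in>{..<n} - ?S. v j * a m j) = 0" for v
    proof -
      have "\<forall>m<n. (\<Sum>j<N. a m j * (if j = k then 0 else v j)) = 0"
      proof (intro allI impI)
        fix m assume "m < n"
        have "(\<Sum>j<N. a m j * (if j = k then 0 else v j)) = (\<Sum>j\<in>{..<N} - {k}. v j * a m j)"
          by (rule sum.mono_neutral_cong_right) auto
        then show "(\<Sum>j<N. a m j * (if j = k then 0 else v j)) = 0" using v \<open>m < n\<close> unfolding nS by simp
      qed
      from ind[unfolded cols_indep_def, rule_format, of "\<lambda>j. if j = k then 0 else v j", OF this[rule_format]]
      have "(if j = k then 0 else v j) = 0" if "j < N" for j using that by blast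
      then show ?thesis unfolding nS by (metis DiffE lessThan_iff singletonI)
    qed
  qed (use on orth in \<open>auto simp: nS\<close>)
  also have "\<dots> = (\<Sum>i\<in>?S. (cmod (y k))\<^sup>2 * (cmod (hdot n (q i) (\<lambda>m. a m k)))\<^sup>2)"
  proof (intro sum.cong refl)
    fix i assume i: "i \<in> ?S"
    have "hdot n (q i) z = hdot n (q i) (\<lambda>m. \<Sum>j<N. y j * a m j)"
      unfolding z_def[abs_def] by (simp add: mult.commute)
    also have "\<dots> = (\<Sum>j<N. y j * hdot n (q i) (\<lambda>m. a m j))"
      by (rule hdot_sum_right[of n "q i" y "\<lambda>j m. a m j"])
    also have "\<dots> = (\<Sum>j<N. if j = k then y k * hdot n (q i) (\<lambda>m. a m k) else 0)"
    proof (intro sum.cong refl)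
      fix j assume "j \<in> {..<N}"
      then show "y j * hdot n (q i) (\<lambda>m. a m j) = (if j = k then y k * hdot n (q i) (\<lambda>m. a m k) else 0)"
        using i orth hdot_commute[of n "q i" "\<lambda>m. a m j"] by auto
    qed
    also have "\<dots> = y k * hdot n (q i) (\<lambda>m. a m k)" using k by simp
    finally show "(cmod (hdot n (q i) z))\<^sup>2 = (cmod (y k))\<^sup>2 * (cmod (hdot n (q i) (\<lambda>m. a m k)))\<^sup>2"
      by (simp add: norm_mult power_mult_distrib)
  qed
  also have "\<dots> = (cmod (y k))\<^sup>2 * (\<Sum>i\<in>?S. (cmod (hdot n (q i) (\<lambda>m. a m k)))\<^sup>2)" (is "_ = _ * ?P")
    by (rule sum_distrib_left[symmetric])
  finally have eq: "(\<Sum>m<n. (cmod (z m))\<^sup>2) = (cmod (y k))\<^sup>2 * ?P" (is "?Z = _") .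
  have "cmod (y k) = ?Z" unfolding yk norm_of_real by (simp add: sum_nonneg)
  with eq have "?Z = ?Z * (?Z * ?P)" by (simp only: power2_eq_square mult.assoc)
  moreover have "?Z \<noteq> 0" using \<open>y k \<noteq> 0\<close> unfolding yk of_real_eq_0_iff .
  ultimately have "?Z * ?P = 1" by simp
  then show ?thesis unfolding yk of_real_mult[symmetric] by simp
qed

text \<open>Cramer's rule supplies y: its entry k is the cofactor divided by the determinant. The
  cofactor is nonzero because its product with the squared projection is the determinant.\<close>

lemma col_dist2_eq_projection:
  assumes ind: "cols_indep n N a" and k: "k < N" and N: "N \<le> n"
    and on: "\<forall>i\<in>insert k {N..<n}. \<forall>j\<in>insert k {N..<n}. hdot n (q i) (q j) = (if i = j then 1 else 0)"
    and orth: "\<forall>i\<in>insert k {N..<n}. \<forall>j\<in>{..<N}-{k}. hdot n (\<lambda>m. a m j) (q i) = 0"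
  shows "col_dist2 n N k a = complex_of_real (\<Sum>i\<in>insert k {N..<n}. (cmod (hdot n (q i) (\<lambda>m. a m k)))\<^sup>2)"
proof -
  let ?G = "gram_mat n N a"
  have G: "?G \<in> carrier_mat N N" by (simp add: gram_mat_def)
  have d: "Determinant.det ?G \<noteq> 0" using ind by (simp add: det_gram_mat_nonzero_iff)
  define y where "y j = adj_mat ?G $$ (j, k) / Determinant.det ?G" for j
  have "hdot n (\<lambda>m. a m i) (\<lambda>m. \<Sum>j<N. a m j * y j) = (if i = k then 1 else 0)" if i: "i < N" for i
  proof -
    have "(?G * adj_mat ?G) $$ (i, k) = (Determinant.det ?G \<cdot>\<^sub>m 1\<^sub>m N) $$ (i, k)"
      using adj_mat(2)[OF G] by simp
    also have "\<dots> = (if i = k then Determinant.det ?G else 0)" using i k by simp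
    also have "(?G * adj_mat ?G) $$ (i, k) = (\<Sum>j<N. (\<Sum>m<n. cnj (a m i) * a m j) * adj_mat ?G $$ (j, k))"
      using i k adj_mat(1)[OF G] G by (auto simp: scalar_prod_def atLeast0LessThan gram_mat_def)
    finally have "(\<Sum>j<N. (\<Sum>m<n. cnj (a m i) * a m j) * y j) = (if i = k then 1 else 0)"
      using d by (simp add: y_def sum_divide_distrib[symmetric])
    then show ?thesis unfolding gram_mat_apply .
  qed
  from gram_inverse_diag_eq_projection[OF ind k N on orth this]
  have "y k * complex_of_real (\<Sum>i\<in>insert k {N..<n}. (cmod (hdot n (q i) (\<lambda>m. a m k)))\<^sup>2) = 1" by blast
  moreover have "y k = cofactor ?G k k / Determinant.det ?G"
    using k G by (simp add: y_def adj_mat_def)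
  ultimately have eq: "cofactor ?G k k * complex_of_real (\<Sum>i\<in>insert k {N..<n}. (cmod (hdot n (q i) (\<lambda>m. a m k)))\<^sup>2)
      = Determinant.det ?G"
    using d by (simp add: field_simps del: of_real_sum of_real_power)
  then have "cofactor ?G k k \<noteq> 0" using d by auto
  then show ?thesis unfolding col_dist2_def eq[symmetric] by simp
qed

text \<open>The link between the partial function \<open>mat_inverse\<close> of the SNR and the
  quotient of determinants: independence makes the result a \<open>Some\<close>, and the diagonal
  entry of the inverse is the cofactor over the determinant.\<close>

lemma mat_inverse_gram_diag:
  assumes ind: "cols_indep n N a" and k: "k < N" and N: "N \<le> n"
  shows "1 / (the (mat_inverse (gram_mat n N a)) $$ (k, k)) = col_dist2 n N k a"
proof -
  let ?G = "gram_mat n N a"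
  have G: "?G \<in> carrier_mat N N" by (simp add: gram_mat_def)
  have d: "Determinant.det ?G \<noteq> 0" using ind by (simp add: det_gram_mat_nonzero_iff)
  then obtain R where R: "mat_inverse ?G = Some R"
    using mat_inverse(1)[OF G, where b="()"] det_non_zero_imp_unit[OF G d, where b="()"]
    by (cases "mat_inverse ?G") auto
  note inv = mat_inverse(2)[OF G R]
  have "?G * (adj_mat ?G) = Determinant.det ?G \<cdot>\<^sub>m 1\<^sub>m N" by (rule adj_mat(2)[OF G])
  then have "R * (?G * adj_mat ?G) = R * (Determinant.det ?G \<cdot>\<^sub>m 1\<^sub>m N)" by simp
  then have "adj_mat ?G = Determinant.det ?G \<cdot>\<^sub>m R"
    using inv adj_mat(1)[OF G] G by (subst (asm) assoc_mult_mat[symmetric, of _ N N _ N _ N]) auto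
  then have "cofactor ?G k k = Determinant.det ?G * R $$ (k, k)"
    using inv k G by (metis (no_types, lifting) adj_mat_def carrier_matD(1) carrier_matD(2) case_prod_conv index_mat(1) index_smult_mat(1))
  then show ?thesis using d by (simp add: R col_dist2_def)
qed

section \<open>Almost sure linear independence of the columns\<close>

lemma borel_measurable_det:
  assumes "\<And>i j. i < n \<Longrightarrow> j < n \<Longrightarrow> (\<lambda>x. f x i j) \<in> borel_measurable M"
  shows "(\<lambda>x. Determinant.det (Matrix.mat n n (\<lambda>(i, j). f x i j :: complex))) \<in> borel_measurable M"
proof -
  have "Determinant.det (Matrix.mat n n (\<lambda>(i, j). f x i j)) =
     (\<Sum>p | p permutes {0..<n}. signof p * (\<Prod>i = 0..<n. f x i (p i)))" for x
    by (subst Determinant.det_def'[of _ n])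
       (auto intro!: sum.cong prod.cong simp: permutes_in_image)
  moreover have "(\<lambda>x. \<Sum>p | p permutes {0..<n}. signof p * (\<Prod>i = 0..<n. f x i (p i))) \<in> borel_measurable M"
  proof (intro borel_measurable_sum borel_measurable_times borel_measurable_const borel_measurable_prod)
    fix p i assume "p \<in> {p. p permutes {0..<n}}" "i \<in> {0..<n}"
    then have "p i < n" using permutes_in_image[of p "{0..<n}" i] by auto
    then show "(\<lambda>x. f x i (p i)) \<in> borel_measurable M"
      using assms \<open>i \<in> {0..<n}\<close> by auto
  qed
  ultimately show ?thesis by simp
qed

lemma borel_measurable_det_gram_mat:
  assumes a: "\<And>m j. m < n \<Longrightarrow> j < N \<Longrightarrow> (\<lambda>x. a x m j) \<in> borel_measurable M"
  shows "(\<lambda>x. Determinant.det (gram_mat n N (a x))) \<in> borel_measurable M"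
  unfolding gram_mat_def
proof (rule borel_measurable_det)
  fix i j assume ij: "i < N" "j < N"
  then have [measurable]: "m < n \<Longrightarrow> (\<lambda>x. a x m i) \<in> borel_measurable M" "m < n \<Longrightarrow> (\<lambda>x. a x m j) \<in> borel_measurable M" for m
    using a by auto
  show "(\<lambda>x. \<Sum>m<n. cnj (a x m i) * a x m j) \<in> borel_measurable M" by measurable
qed

lemma borel_measurable_col_dist2:
  assumes a: "\<And>m j. m < n \<Longrightarrow> j < N \<Longrightarrow> (\<lambda>x. a x m j) \<in> borel_measurable M" and k: "k < N"
  shows "(\<lambda>x. col_dist2 n N k (a x)) \<in> borel_measurable M"
proof -
  \<comment> \<open>The index map that skips k, so that the minor is again a matrix given by its
    entries.\<close>
  define sk where "sk i = (if i < k then i else Suc i)" for i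
  have sk: "sk i < N" if "i < N - 1" for i using that by (auto simp: sk_def)
  have "mat_delete (gram_mat n N (a x)) k k =
      Matrix.mat (N - 1) (N - 1) (\<lambda>(i, j). \<Sum>m<n. cnj (a x m (sk i)) * a x m (sk j))" for x
    by (rule eq_matI) (auto simp: mat_delete_def gram_mat_def sk_def)
  moreover have "(\<lambda>x. Determinant.det (Matrix.mat (N - 1) (N - 1) (\<lambda>(i, j). \<Sum>m<n. cnj (a x m (sk i)) * a x m (sk j)))) \<in> borel_measurable M"
  proof (rule borel_measurable_det)
    fix i j assume ij: "i < N - 1" "j < N - 1"
    then have [measurable]: "m < n \<Longrightarrow> (\<lambda>x. a x m (sk i)) \<in> borel_measurable M" "m < n \<Longrightarrow> (\<lambda>x. a x m (sk j)) \<in> borel_measurable M" for m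
      using a sk by auto
    show "(\<lambda>x. \<Sum>m<n. cnj (a x m (sk i)) * a x m (sk j)) \<in> borel_measurable M" by measurable
  qed
  ultimately show ?thesis
    unfolding col_dist2_def cofactor_def
    by (intro borel_measurable_divide borel_measurable_times borel_measurable_const borel_measurable_det_gram_mat[OF a]) auto
qed

lemma integral_pair_product:
  fixes f :: "'a \<Rightarrow> complex" and g :: "'b \<Rightarrow> complex"
  assumes M: "prob_space M" and N: "prob_space N"
    and [measurable]: "f \<in> borel_measurable M" "g \<in> borel_measurable N"
    and b: "\<And>x. norm (f x) \<le> 1" "\<And>x. norm (g x) \<le> 1"
  shows "(LINT z|(M \<Otimes>\<^sub>M N). f (fst z) * g (snd z)) = integral\<^sup>L M f * integral\<^sup>L N g"
proof -
  interpret M: prob_space M by fact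
  interpret N: prob_space N by fact
  interpret P: pair_prob_space M N ..
  have "integrable (M \<Otimes>\<^sub>M N) (\<lambda>(x,y). f x * g y)"
    by (rule P.integrable_const_bound[where B=1]) (auto simp: norm_mult split_beta' intro!: mult_le_one b AE_I2)
  from P.integral_fst'[OF this] show ?thesis
    by (simp add: split_beta')
qed

lemma AE_cong_distr:
  assumes eq: "distr M K X = distr N K Y" and X: "X \<in> measurable M K" and Y: "Y \<in> measurable N K"
    and B: "{z\<in>space K. P z} \<in> sets K"
  shows "(AE x in M. P (X x)) \<longleftrightarrow> (AE y in N. P (Y y))"
  unfolding AE_distr_iff[OF X B, symmetric] AE_distr_iff[OF Y B, symmetric] eq ..

text \<open>Induction on the size of the minor. Row j may be taken from an independent copy of the
  channel without changing the joint law. For fixed earlier rows the next minor is a linear form in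
  that row, whose coefficient at column j is the previous minor; as this is nonzero, the form is a
  nondegenerate Gaussian variable and vanishes with probability 0.\<close>

lemma channel_matrix_leading_minor_AE:
  assumes P: "prob_space M" and H: "channel_matrix M n N S H" and N: "N \<le> n"
    and pd: "\<And>d. \<exists>a<N. d a \<noteq> 0 \<Longrightarrow> cform N S d \<noteq> 0"
    and j: "j \<le> N"
  shows "AE x in M. Determinant.det (Matrix.mat j j (\<lambda>(a, b). H x $$ (a, b))) \<noteq> 0"
  using j
proof (induction j)
  case 0
  show ?case by (simp add: Determinant.det_dim_zero)
next
  case (Suc j)
  interpret prob_space M by fact
  interpret PP: pair_prob_space M M ..
  let ?I = "{..j} \<times> {..j}"
  let ?P = "M \<Otimes>\<^sub>M M"
  have mH: "(\<lambda>x. H x $$ (m, b)) \<in> borel_measurable M" if "m \<le> j" "b \<le> j" for m b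
    by (rule channel_matrix_entry_measurable[OF H]) (use that Suc N in auto)
  \<comment> \<open>Rows before j come from the first copy of the probability space, row j from the
    second.\<close>
  define Y where "Y = (\<lambda>(m,b) z. if m < j then H (fst z) $$ (m, b) else H (snd z) $$ (m, b))"
  have mY: "Y p \<in> borel_measurable ?P" if "p \<in> ?I" for p
  proof (cases p)
    case (Pair m b)
    then have [measurable]: "(\<lambda>x. H x $$ (m, b)) \<in> borel_measurable M" using that mH by auto
    show ?thesis unfolding Pair Y_def by simp
  qed
  define D where "D z = Determinant.det (Matrix.mat (Suc j) (Suc j) (\<lambda>(a, b). z (a, b)))" for z :: "nat \<times> nat \<Rightarrow> complex"
  have Dm: "D \<in> borel_measurable (Pi\<^sub>M ?I (\<lambda>_. borel))"
    unfolding D_def by (rule borel_measurable_det[where f="\<lambda>z i j. z (i,j)"]) auto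
  have law: "distr M (Pi\<^sub>M ?I (\<lambda>_. borel)) (\<lambda>x. \<lambda>p\<in>?I. H x $$ p) = distr ?P (Pi\<^sub>M ?I (\<lambda>_. borel)) (\<lambda>x. \<lambda>p\<in>?I. Y p x)"
  proof (rule complex_char_unique[OF P PP.prob_space_axioms])
    fix c :: "nat \<times> nat \<Rightarrow> complex"
    define d where "d m b = (if b \<le> j then c (m, b) else 0)" for m b
    have dsum: "(\<Sum>b<N. d m b * h b) = (\<Sum>b\<le>j. c (m, b) * h b)" for m h
      by (rule sum.mono_neutral_cong_right) (use Suc in \<open>auto simp: d_def\<close>)
    have atM: "{..j} = insert j {..<j}" by auto
    have sub: "{..j} \<subseteq> {..<n}" "{..<j} \<subseteq> {..<n}" "{j} \<subseteq> {..<n}" using Suc N by auto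
    have L: "(\<Sum>p\<in>?I. c p * H x $$ p) = (\<Sum>m\<in>{..j}. \<Sum>b<N. d m b * H x $$ (m, b))" for x
      unfolding dsum by (simp add: sum.cartesian_product)
    have R: "(\<Sum>p\<in>?I. c p * Y p z) = (\<Sum>m\<in>{..<j}. \<Sum>b<N. d m b * H (fst z) $$ (m, b)) + (\<Sum>m\<in>{j}. \<Sum>b<N. d m b * H (snd z) $$ (m, b))" for z
    proof -
      have "(\<Sum>p\<in>?I. c p * Y p z) = (\<Sum>m\<in>{..j}. \<Sum>b\<le>j. c (m, b) * Y (m, b) z)"
        by (simp add: sum.cartesian_product)
      also have "\<dots> = (\<Sum>m\<in>{..<j}. \<Sum>b\<le>j. c (m, b) * Y (m, b) z) + (\<Sum>b\<le>j. c (j, b) * Y (j, b) z)"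
        unfolding atM by (subst sum.insert) (auto simp: add.commute atM[symmetric])
      also have "\<dots> = (\<Sum>m\<in>{..<j}. \<Sum>b\<le>j. c (m, b) * H (fst z) $$ (m, b)) + (\<Sum>b\<le>j. c (j, b) * H (snd z) $$ (j, b))"
        by (intro arg_cong2[where f="(+)"] sum.cong refl) (auto simp: Y_def)
      finally show ?thesis by (simp add: dsum)
    qed
    have mb: "(\<lambda>x. \<Sum>b<N. d m b * H x $$ (m, b)) \<in> borel_measurable M" if "m \<le> j" for m
      unfolding dsum by (intro borel_measurable_sum borel_measurable_times borel_measurable_const mH) (use that in auto)
    then have [measurable]: "(\<lambda>x. \<Sum>m<j. \<Sum>b<N. d m b * H x $$ (m, b)) \<in> borel_measurable M"
        "(\<lambda>x. \<Sum>b<N. d j b * H x $$ (j, b)) \<in> borel_measurable M"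
      by auto
    have "(LINT z|?P. cis (Re (\<Sum>p\<in>?I. c p * Y p z))) =
      (LINT z|?P. cis (Re (\<Sum>m\<in>{..<j}. \<Sum>b<N. d m b * H (fst z) $$ (m, b))) * cis (Re (\<Sum>m\<in>{j}. \<Sum>b<N. d m b * H (snd z) $$ (m, b))))"
      unfolding R by (simp only: plus_complex.sel cis_mult)
    also have "\<dots> = (LINT x|M. cis (Re (\<Sum>m\<in>{..<j}. \<Sum>b<N. d m b * H x $$ (m, b)))) * (LINT x|M. cis (Re (\<Sum>m\<in>{j}. \<Sum>b<N. d m b * H x $$ (m, b))))"
      by (rule integral_pair_product[OF P P]) (simp_all del: Re_sum)
    \<comment> \<open>The exponents are additive over rows, so the product over two copies is the
      characteristic function of all rows within one copy.\<close>
    also have "\<dots> = (LINT x|M. cis (Re (\<Sum>m\<in>{..j}. \<Sum>b<N. d m b * H x $$ (m, b))))"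
      unfolding channel_matrix_char[OF P H sub(1)] channel_matrix_char[OF P H sub(2)] channel_matrix_char[OF P H sub(3)]
      unfolding of_real_mult[symmetric] exp_add[symmetric]
      by (subst atM) (simp add: algebra_simps add_divide_distrib diff_divide_distrib)
    finally show "(LINT x|M. cis (Re (\<Sum>p\<in>?I. c p * H x $$ p))) = (LINT z|?P. cis (Re (\<Sum>p\<in>?I. c p * Y p z)))"
      unfolding L by simp
  qed (use mH mY in auto)
  have mX': "(\<lambda>x. \<lambda>p\<in>?I. H x $$ p) \<in> measurable M (Pi\<^sub>M ?I (\<lambda>_. borel))"
    by (intro measurable_restrict) (use mH in auto)
  have mY': "(\<lambda>x. \<lambda>p\<in>?I. Y p x) \<in> measurable ?P (Pi\<^sub>M ?I (\<lambda>_. borel))"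
    by (intro measurable_restrict mY)
  have "AE z in ?P. D (\<lambda>p\<in>?I. Y p z) \<noteq> 0"
  proof (rule PP.AE_pair_measure)
    show "{z \<in> space ?P. D (\<lambda>p\<in>?I. Y p z) \<noteq> 0} \<in> sets ?P"
      using measurable_compose[OF mY' Dm] by measurable
    have "AE x' in M. D (\<lambda>p\<in>?I. Y p (x, x')) \<noteq> 0"
      if x: "Determinant.det (Matrix.mat j j (\<lambda>(a, b). H x $$ (a, b))) \<noteq> 0" for x
    proof -
      \<comment> \<open>Cofactors along row j do not see that row; it is set to 0, so that
        \<open>A0\<close> depends on the first copy only.\<close>
      define A0 where "A0 = Matrix.mat (Suc j) (Suc j) (\<lambda>(a, b). if a < j then H x $$ (a, b) else 0)"
      define d where "d b = (if b \<le> j then cofactor A0 j b else 0)" for b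
      have cof: "cofactor (Matrix.mat (Suc j) (Suc j) (\<lambda>(a, b). Y (a, b) (x, x'))) j b = cofactor A0 j b" for b x'
      proof -
        have "mat_delete (Matrix.mat (Suc j) (Suc j) (\<lambda>(a, b). Y (a, b) (x, x'))) j b = mat_delete A0 j b"
          by (rule eq_matI) (auto simp: mat_delete_def A0_def Y_def)
        then show ?thesis by (simp add: cofactor_def)
      qed
      have "D (\<lambda>p\<in>?I. Y p (x, x')) = (\<Sum>b<N. d b * H x' $$ (j, b))" for x'
      proof -
        have "D (\<lambda>p\<in>?I. Y p (x, x')) = Determinant.det (Matrix.mat (Suc j) (Suc j) (\<lambda>(a, b). Y (a, b) (x, x')))"
          unfolding D_def by (intro arg_cong[where f=Determinant.det] eq_matI) auto
        also have "\<dots> = (\<Sum>b<Suc j. H x' $$ (j, b) * cofactor A0 j b)"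
        proof (subst laplace_expansion_row[of _ "Suc j" j])
          show "(\<Sum>b<Suc j. Matrix.mat (Suc j) (Suc j) (\<lambda>(a, b). Y (a, b) (x, x')) $$ (j, b) *
               cofactor (Matrix.mat (Suc j) (Suc j) (\<lambda>(a, b). Y (a, b) (x, x'))) j b) =
             (\<Sum>b<Suc j. H x' $$ (j, b) * cofactor A0 j b)"
            unfolding cof by (intro sum.cong refl) (simp add: Y_def)
        qed auto
        also have "\<dots> = (\<Sum>b<N. d b * H x' $$ (j, b))"
          by (rule sum.mono_neutral_cong_left) (use Suc in \<open>auto simp: d_def mult.commute\<close>)
        finally show ?thesis .
      qed
      moreover have "d j \<noteq> 0"
      proof -
        have "mat_delete A0 j j = Matrix.mat j j (\<lambda>(a, b). H x $$ (a, b))"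
          by (rule eq_matI) (auto simp: mat_delete_def A0_def)
        then show ?thesis using x by (simp add: d_def cofactor_def)
      qed
      then have "cform N S d \<noteq> 0" using Suc by (intro pd exI[of _ j]) auto
      then have "AE x' in M. Re (\<Sum>b<N. d b * H x' $$ (j, b)) \<noteq> 0"
        using channel_matrix_row_linear[OF P H, of j d] Suc N
        by (intro gaussian_var_AE_nonzero[OF P]) auto
      then have "AE x' in M. (\<Sum>b<N. d b * H x' $$ (j, b)) \<noteq> 0"
        by (rule eventually_mono) (metis zero_complex.sel(1))
      ultimately show ?thesis by simp
    qed
    moreover have "AE x in M. Determinant.det (Matrix.mat j j (\<lambda>(a, b). H x $$ (a, b))) \<noteq> 0"
      using Suc by simp
    ultimately show "AE x in M. AE y in M. D (\<lambda>p\<in>?I. Y p (x, y)) \<noteq> 0"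
      by (auto elim: eventually_mono)
  qed
  then have "AE x in M. D (\<lambda>p\<in>?I. H x $$ p) \<noteq> 0"
    using AE_cong_distr[OF law mX' mY', of "\<lambda>z. D z \<noteq> 0"] Dm by simp
  moreover have "D (\<lambda>p\<in>?I. H x $$ p) = Determinant.det (Matrix.mat (Suc j) (Suc j) (\<lambda>(a, b). H x $$ (a, b)))" for x
    unfolding D_def by (intro arg_cong[where f=Determinant.det] eq_matI) auto
  ultimately show ?case by simp
qed

lemma channel_matrix_cols_indep_AE:
  assumes P: "prob_space M" and H: "channel_matrix M n N S H" and N: "N \<le> n"
    and pd: "\<And>d. \<exists>a<N. d a \<noteq> 0 \<Longrightarrow> cform N S d \<noteq> 0"
  shows "AE x in M. cols_indep n N (\<lambda>m j. H x $$ (m, j))"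
proof -
  have "cols_indep n N (\<lambda>m j. H x $$ (m, j))"
    if "Determinant.det (Matrix.mat N N (\<lambda>(a, b). H x $$ (a, b))) \<noteq> 0" for x
    using that N unfolding cols_indep_def singular_iff_kernel by (meson order_less_le_trans)
  then show ?thesis
    using channel_matrix_leading_minor_AE[OF P H N pd order_refl] by (auto elim: eventually_mono)
qed

section \<open>Concentration of the residual of a column\<close>

text \<open>A relation y among the new columns becomes the relation v among the old ones, and w k =
  1 makes y recoverable from v.\<close>

lemma cols_indep_replace:
  assumes a: "cols_indep n N a" and k: "k < N" and w: "w k = 1"
  shows "cols_indep n N (\<lambda>m j. if j = k then \<Sum>i<N. a m i * w i else a m j)"
  unfolding cols_indep_def
proof (intro allI impI)
  fix y j assume y: "\<forall>m<n. (\<Sum>j<N. (if j = k then \<Sum>i<N. a m i * w i else a m j) * y j) = 0" and j: "j < N"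
  define v where "v j = (if j = k then 0 else y j) + y k * w j" for j
  have "(\<Sum>j<N. a m j * v j) = 0" if m: "m < n" for m
  proof -
    have "(\<Sum>j<N. (if j = k then \<Sum>i<N. a m i * w i else a m j) * y j) =
       (\<Sum>j\<in>{..<N}-{k}. a m j * y j) + (\<Sum>i<N. a m i * w i) * y k"
      using k by (subst sum.remove[of _ k]) (auto simp: add.commute intro!: sum.cong)
    also have "\<dots> = (\<Sum>j<N. a m j * (if j = k then 0 else y j)) + (\<Sum>i<N. a m i * w i) * y k"
      using k by (subst (2) sum.remove[of _ k]) (auto intro!: sum.cong)
    also have "\<dots> = (\<Sum>j<N. a m j * v j)"
      by (simp add: v_def distrib_left sum.distrib sum_distrib_left sum_distrib_right mult_ac)
    finally show ?thesis using y m by simp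
  qed
  then have v: "v j = 0" if "j < N" for j using a that unfolding cols_indep_def by blast
  from v[OF k] w have yk: "y k = 0" by (simp add: v_def)
  with v[OF j] show "y j = 0" by (auto simp: v_def split: if_splits)
qed

text \<open>Adding multiples of the other columns to column k changes neither their span nor the
  component of column k orthogonal to it, so one orthonormal system computes both distances.\<close>

lemma col_dist2_replace:
  assumes a: "cols_indep n N a" and k: "k < N" and N: "N \<le> n" and w: "w k = 1"
  shows "col_dist2 n N k (\<lambda>m j. if j = k then \<Sum>i<N. a m i * w i else a m j) = col_dist2 n N k a"
proof -
  let ?S = "insert k {N..<n}"
  have S: "finite ?S" "?S \<subseteq> {..<n}" using N k by auto
  have nS: "{..<n} - ?S = {..<N} - {k}" using N k by auto
  obtain q where q: "\<forall>i\<in>?S. \<forall>j\<in>?S. hdot n (q i) (q j) = (if i = j then 1 else 0)"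
    "\<forall>i\<in>?S. \<forall>j\<in>{..<N} - {k}. hdot n (\<lambda>m. a m j) (q i) = 0"
    using ex_orthonormal_completion[OF S, of "\<lambda>j m. a m j"] unfolding nS by blast
  have "hdot n (q i) (\<lambda>m. \<Sum>j<N. a m j * w j) = hdot n (q i) (\<lambda>m. a m k)" if i: "i \<in> ?S" for i
  proof -
    have "hdot n (q i) (\<lambda>m. \<Sum>j<N. a m j * w j) = (\<Sum>j<N. w j * hdot n (q i) (\<lambda>m. a m j))"
      using hdot_sum_right[of n "q i" w "\<lambda>j m. a m j" "{..<N}"] by (simp add: mult.commute)
    also have "\<dots> = (\<Sum>j<N. if j = k then hdot n (q i) (\<lambda>m. a m k) else 0)"
    proof (intro sum.cong refl)
      fix j assume "j \<in> {..<N}"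
      then show "w j * hdot n (q i) (\<lambda>m. a m j) = (if j = k then hdot n (q i) (\<lambda>m. a m k) else 0)"
        using i q(2) w hdot_commute[of n "q i" "\<lambda>m. a m j"] by auto
    qed
    finally show ?thesis using k by simp
  qed
  moreover have "col_dist2 n N k (\<lambda>m j. if j = k then \<Sum>i<N. a m i * w i else a m j) =
     complex_of_real (\<Sum>i\<in>?S. (cmod (hdot n (q i) (\<lambda>m. \<Sum>j<N. a m j * w j)))\<^sup>2)"
    using col_dist2_eq_projection[OF cols_indep_replace[where a=a and w=w, OF a k w] k N q(1)] q(2) by auto
  moreover have "col_dist2 n N k a = complex_of_real (\<Sum>i\<in>?S. (cmod (hdot n (q i) (\<lambda>m. a m k)))\<^sup>2)"
    by (rule col_dist2_eq_projection[OF a k N q])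
  ultimately show ?thesis by (auto intro!: sum.cong)
qed

text \<open>Pythagoras for the covariance form: one mixed term vanishes by \<open>unc\<close>, the
  other one as its conjugate.\<close>

lemma cform_add_uncorrelated:
  assumes herm: "\<And>a b. a < N \<Longrightarrow> b < N \<Longrightarrow> S $$ (b, a) = cnj (S $$ (a, b))"
    and unc: "(\<Sum>a<N. \<Sum>b<N. cnj (p a) * f b * S $$ (a, b)) = 0"
  shows "cform N S (\<lambda>b. u * p b + f b) = (cmod u)\<^sup>2 * cform N S p + cform N S f"
proof -
  have 2: "(\<Sum>a<N. \<Sum>b<N. cnj (f a) * p b * S $$ (a, b)) = 0"
  proof -
    have "(\<Sum>a<N. \<Sum>b<N. cnj (f a) * p b * S $$ (a, b)) = (\<Sum>b<N. \<Sum>a<N. cnj (f a) * p b * S $$ (a, b))"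
      by (rule sum.swap)
    also have "\<dots> = cnj (\<Sum>a<N. \<Sum>b<N. cnj (p a) * f b * S $$ (a, b))"
      unfolding cnj_sum by (intro sum.cong refl) (simp add: herm[symmetric] mult_ac)
    finally show ?thesis using unc by simp
  qed
  have "(\<Sum>a<N. \<Sum>b<N. cnj (u * p a + f a) * (u * p b + f b) * S $$ (a, b)) =
    (cnj u * u) * (\<Sum>a<N. \<Sum>b<N. cnj (p a) * p b * S $$ (a, b)) + cnj u * (\<Sum>a<N. \<Sum>b<N. cnj (p a) * f b * S $$ (a, b))
    + u * (\<Sum>a<N. \<Sum>b<N. cnj (f a) * p b * S $$ (a, b)) + (\<Sum>a<N. \<Sum>b<N. cnj (f a) * f b * S $$ (a, b))"
    by (simp add: sum_distrib_left sum.distrib algebra_simps)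
  also have "cnj u * u = complex_of_real ((cmod u)\<^sup>2)" by (simp only: complex_norm_square mult.commute)
  finally show ?thesis unfolding cform_def unc 2 by (simp add: Re_complex_of_real del: of_real_power Re_sum)
qed

text \<open>Column \<open>k\<close> of \<open>H F\<close> is replaced by its residual after regression on the other columns,
  which has the law of an independent Gaussian vector.\<close>

lemma residual_column_distr:
  assumes P: "prob_space M" and H: "channel_matrix M n N S H" and k: "k < N"
    and herm: "\<And>a b. a < N \<Longrightarrow> b < N \<Longrightarrow> S $$ (b, a) = cnj (S $$ (a, b))"
    and unc: "\<And>j. j < N \<Longrightarrow> j \<noteq> k \<Longrightarrow> (\<Sum>a<N. \<Sum>b<N. cnj (p a) * F b j * S $$ (a, b)) = 0"
    and \<nu>: "cform N S p = \<nu>" "0 \<le> \<nu>"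
  defines "X \<equiv> \<lambda>(m, j) x. if j = k then \<Sum>b<N. H x $$ (m, b) * p b else \<Sum>b<N. H x $$ (m, b) * F b j"
  defines "Y \<equiv> \<lambda>(m, j) (x, g). if j = k then sqrt (\<nu> / 2) * cg g m else \<Sum>b<N. H x $$ (m, b) * F b j"
  shows "distr M (Pi\<^sub>M ({..<n} \<times> {..<N}) (\<lambda>_. borel)) (\<lambda>x. \<lambda>i\<in>{..<n} \<times> {..<N}. X i x) =
    distr (M \<Otimes>\<^sub>M std_cgauss n) (Pi\<^sub>M ({..<n} \<times> {..<N}) (\<lambda>_. borel)) (\<lambda>z. \<lambda>i\<in>{..<n} \<times> {..<N}. Y i z)"
    and "\<And>i. i \<in> {..<n} \<times> {..<N} \<Longrightarrow> X i \<in> borel_measurable M"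
    and "\<And>i. i \<in> {..<n} \<times> {..<N} \<Longrightarrow> Y i \<in> borel_measurable (M \<Otimes>\<^sub>M std_cgauss n)"
proof -
  let ?I = "{..<n} \<times> {..<N}"
  let ?P = "M \<Otimes>\<^sub>M std_cgauss n"
  interpret M: prob_space M by fact
  interpret G: prob_space "std_cgauss n" by (rule prob_space_std_cgauss)
  interpret PP: pair_prob_space M "std_cgauss n" ..
  have mH [measurable]: "(\<lambda>x. H x $$ (m, b)) \<in> borel_measurable M" if "m < n" "b < N" for m b
    by (rule channel_matrix_entry_measurable[OF H that])
  have lin: "(\<lambda>x. \<Sum>b<N. H x $$ (m, b) * f b) \<in> borel_measurable M" if "m < n" for m f
    using that by measurable
  show mX: "X i \<in> borel_measurable M" if "i \<in> ?I" for i
    using that lin unfolding X_def by (cases i) auto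
  show mY: "Y i \<in> borel_measurable ?P" if "i \<in> ?I" for i
  proof (cases i)
    case (Pair m j)
    then have m: "m < n" using that by auto
    have [measurable]: "(\<lambda>g. cg g m) \<in> borel_measurable (std_cgauss n)" using m by measurable
    have [measurable]: "(\<lambda>x. \<Sum>b<N. H x $$ (m, b) * F b j) \<in> borel_measurable M" by (rule lin[OF m])
    show ?thesis unfolding Pair Y_def case_prod_conv split_beta' by (cases "j = k") simp_all
  qed
  show "distr M (Pi\<^sub>M ?I (\<lambda>_. borel)) (\<lambda>x. \<lambda>i\<in>?I. X i x) = distr ?P (Pi\<^sub>M ?I (\<lambda>_. borel)) (\<lambda>z. \<lambda>i\<in>?I. Y i z)"
  proof (rule complex_char_unique[OF P PP.prob_space_axioms _ mX mY])
    fix c :: "nat \<times> nat \<Rightarrow> complex"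
    define f where "f m b = (\<Sum>j\<in>{..<N}-{k}. c (m, j) * F b j)" for m b
    have remk: "(\<Sum>j<N. h j) = h k + (\<Sum>j\<in>{..<N}-{k}. h j)" for h :: "nat \<Rightarrow> complex"
      using k by (subst sum.remove[of _ k]) auto
    have fs: "(\<Sum>j\<in>{..<N}-{k}. c (m, j) * (\<Sum>b<N. h b * F b j)) = (\<Sum>b<N. f m b * h b)" for m h
      unfolding f_def sum_distrib_left sum_distrib_right by (subst sum.swap) (simp add: mult_ac)
    have X: "(\<Sum>i\<in>?I. c i * X i x) = (\<Sum>m<n. \<Sum>b<N. (c (m, k) * p b + f m b) * H x $$ (m, b))" for x
    proof -
      have "(\<Sum>i\<in>?I. c i * X i x) = (\<Sum>m<n. \<Sum>j<N. c (m, j) * X (m, j) x)"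
        by (simp add: sum.cartesian_product)
      also have "\<dots> = (\<Sum>m<n. c (m, k) * (\<Sum>b<N. H x $$ (m, b) * p b) + (\<Sum>j\<in>{..<N}-{k}. c (m, j) * (\<Sum>b<N. H x $$ (m, b) * F b j)))"
        by (intro sum.cong refl, subst remk) (auto simp: X_def intro!: sum.cong)
      also have "\<dots> = (\<Sum>m<n. \<Sum>b<N. (c (m, k) * p b + f m b) * H x $$ (m, b))"
        unfolding fs by (simp add: sum_distrib_left sum.distrib algebra_simps)
      finally show ?thesis .
    qed
    have Y: "(\<Sum>i\<in>?I. c i * Y i z) = (\<Sum>m<n. sqrt (\<nu> / 2) * c (m, k) * cg (snd z) m) + (\<Sum>m<n. \<Sum>b<N. f m b * H (fst z) $$ (m, b))" for z
    proof -
      have "(\<Sum>i\<in>?I. c i * Y i z) = (\<Sum>m<n. \<Sum>j<N. c (m, j) * Y (m, j) z)"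
        by (simp add: sum.cartesian_product)
      also have "\<dots> = (\<Sum>m<n. sqrt (\<nu> / 2) * c (m, k) * cg (snd z) m + (\<Sum>j\<in>{..<N}-{k}. c (m, j) * (\<Sum>b<N. H (fst z) $$ (m, b) * F b j)))"
        by (intro sum.cong refl, subst remk) (auto simp: Y_def split_beta' intro!: sum.cong)
      finally show ?thesis by (simp only: fs sum.distrib)
    qed
    \<comment> \<open>The part \<open>f m\<close> is a combination of the columns other than k,
      hence uncorrelated with p. The exponent therefore separates into the contributions of the two
      factors of the product measure.\<close>
    have cf: "cform N S (\<lambda>b. c (m, k) * p b + f m b) = \<nu> * (cmod (c (m, k)))\<^sup>2 + cform N S (f m)" for m
    proof -
      have "(\<Sum>a<N. \<Sum>b<N. cnj (p a) * f m b * S $$ (a, b)) =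
        (\<Sum>j\<in>{..<N}-{k}. c (m, j) * (\<Sum>a<N. \<Sum>b<N. cnj (p a) * F b j * S $$ (a, b)))"
      proof -
        have "(\<Sum>a<N. \<Sum>b<N. cnj (p a) * f m b * S $$ (a, b)) =
          (\<Sum>a<N. \<Sum>b<N. \<Sum>j\<in>{..<N}-{k}. c (m, j) * (cnj (p a) * F b j * S $$ (a, b)))"
          unfolding f_def by (simp add: sum_distrib_left sum_distrib_right mult_ac)
        also have "\<dots> = (\<Sum>a<N. \<Sum>j\<in>{..<N}-{k}. \<Sum>b<N. c (m, j) * (cnj (p a) * F b j * S $$ (a, b)))"
          by (intro sum.cong refl sum.swap)
        also have "\<dots> = (\<Sum>j\<in>{..<N}-{k}. \<Sum>a<N. \<Sum>b<N. c (m, j) * (cnj (p a) * F b j * S $$ (a, b)))"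
          by (rule sum.swap)
        finally show ?thesis by (simp add: sum_distrib_left)
      qed
      also have "\<dots> = 0" by (intro sum.neutral) (auto simp: unc)
      finally show ?thesis using cform_add_uncorrelated[OF herm, of N p "f m" "c (m, k)"] \<nu> by (simp add: mult.commute)
    qed
    have [measurable]: "(\<lambda>x. \<Sum>m<n. \<Sum>b<N. f m b * H x $$ (m, b)) \<in> borel_measurable M"
      "(\<lambda>g. \<Sum>m<n. sqrt (\<nu> / 2) * c (m, k) * cg g m) \<in> borel_measurable (std_cgauss n)"
      by measurable
    have "(LINT z|?P. cis (Re (\<Sum>i\<in>?I. c i * Y i z))) =
      (LINT z|?P. cis (Re (\<Sum>m<n. \<Sum>b<N. f m b * H (fst z) $$ (m, b))) * cis (Re (\<Sum>m<n. sqrt (\<nu> / 2) * c (m, k) * cg (snd z) m)))"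
      unfolding Y by (simp only: plus_complex.sel cis_mult add.commute)
    also have "\<dots> = (LINT x|M. cis (Re (\<Sum>m<n. \<Sum>b<N. f m b * H x $$ (m, b)))) *
       (LINT g|std_cgauss n. cis (Re (\<Sum>m<n. sqrt (\<nu> / 2) * c (m, k) * cg g m)))"
      by (rule integral_pair_product[OF P prob_space_std_cgauss]) (simp_all del: Re_sum)
    also have "\<dots> = complex_of_real (exp (- (\<Sum>m<n. cform N S (f m)) / 4)) *
        complex_of_real (exp (- (\<Sum>m<n. \<nu> / 2 * (cmod (c (m, k)))\<^sup>2) / 2))"
      unfolding channel_matrix_char[OF P H subset_refl] char_std_cgauss
      using \<nu> by (simp add: norm_mult power_mult_distrib)
    also have "\<dots> = exp (- (\<Sum>m<n. cform N S (\<lambda>b. c (m, k) * p b + f m b)) / 4)"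
      unfolding of_real_mult[symmetric] exp_add[symmetric] cf
      by (simp add: sum.distrib sum_distrib_left[symmetric] add_divide_distrib diff_divide_distrib sum_divide_distrib[symmetric])
    also have "\<dots> = (LINT x|M. cis (Re (\<Sum>i\<in>?I. c i * X i x)))"
      unfolding X channel_matrix_char[OF P H subset_refl] ..
    finally show "(LINT x|M. cis (Re (\<Sum>i\<in>?I. c i * X i x))) = (LINT z|?P. cis (Re (\<Sum>i\<in>?I. c i * Y i z)))" ..
  qed auto
qed

lemma cols_indep_mult:
  assumes H: "cols_indep n N h" and F: "cols_indep N N F"
  shows "cols_indep n N (\<lambda>m j. \<Sum>b<N. h m b * F b j)"
  unfolding cols_indep_def
proof (intro allI impI)
  fix y j assume y: "\<forall>m<n. (\<Sum>j<N. (\<Sum>b<N. h m b * F b j) * y j) = 0" and j: "j < N"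
  have "(\<Sum>b<N. h m b * (\<Sum>j<N. F b j * y j)) = 0" if m: "m < n" for m
  proof -
    have "(\<Sum>b<N. h m b * (\<Sum>j<N. F b j * y j)) = (\<Sum>j<N. (\<Sum>b<N. h m b * F b j) * y j)"
      unfolding sum_distrib_left sum_distrib_right by (subst sum.swap) (simp add: mult.assoc)
    then show ?thesis using y m by simp
  qed
  then have "\<forall>b<N. (\<Sum>j<N. F b j * y j) = 0"
    by (intro H[unfolded cols_indep_def, THEN spec, THEN mp] allI impI)
  from F[unfolded cols_indep_def, THEN spec, THEN mp, OF this] j show "y j = 0" by blast
qed

text \<open>With the other columns fixed, the orthonormal system q does not depend on g, so the
  squared distance is \<nu> / 2 times a sum of n - N + 1 squared orthonormal coordinates of g. The
  resulting probability is free of a, and this allows the other columns to be integrated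
  out.\<close>

lemma col_dist2_gaussian_column:
  assumes a: "cols_indep n N a" and k: "k < N" and N: "N \<le> n" and \<nu>: "0 < \<nu>"
    and Y: "AE g in std_cgauss n. cols_indep n N (\<lambda>m j. if j = k then sqrt (\<nu> / 2) * cg g m else a m j)"
  shows "measure (std_cgauss n) {g\<in>space (std_cgauss n).
      cmod (col_dist2 n N k (\<lambda>m j. if j = k then sqrt (\<nu> / 2) * cg g m else a m j) / \<nu> - of_nat (n - N + 1)) \<ge> \<epsilon> * real (n - N + 1)}
    = measure (std_cgauss (n - N + 1)) {g\<in>space (std_cgauss (n - N + 1)).
      \<bar>(\<Sum>m<n - N + 1. (cmod (cg g m))\<^sup>2) / 2 - real (n - N + 1)\<bar> \<ge> \<epsilon> * real (n - N + 1)}"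
proof -
  let ?S = "insert k {N..<n}"
  define r where "r = n - N + 1"
  interpret prob_space "std_cgauss n" by (rule prob_space_std_cgauss)
  have S: "finite ?S" "?S \<subseteq> {..<n}" using N k by auto
  have nS: "{..<n} - ?S = {..<N} - {k}" using N k by auto
  have cS: "card ?S = r" using N k by (simp add: r_def)
  obtain q where q: "\<forall>i\<in>?S. \<forall>j\<in>?S. hdot n (q i) (q j) = (if i = j then 1 else 0)"
    "\<forall>i\<in>?S. \<forall>j\<in>{..<N} - {k}. hdot n (\<lambda>m. a m j) (q i) = 0"
    using ex_orthonormal_completion[OF S, of "\<lambda>j m. a m j"] unfolding nS by blast
  obtain h where h: "bij_betw h {..<r} ?S"
    using ex_bij_betw_nat_finite[OF S(1)] unfolding cS atLeast0LessThan by blast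
  have hS: "h i \<in> ?S" if "i < r" for i using h that by (auto simp: bij_betw_def)
  have hinj: "h i = h j \<longleftrightarrow> i = j" if "i < r" "j < r" for i j
    using h that by (auto simp: bij_betw_def inj_on_def)
  have on: "(\<Sum>m<n. cnj (q (h i) m) * q (h j) m) = (if i = j then 1 else 0)" if "i < r" "j < r" for i j
    using q(1)[rule_format, OF hS[OF that(1)] hS[OF that(2)]] unfolding hdot_def hinj[OF that] .
  let ?Y = "\<lambda>g m j. if j = k then sqrt (\<nu> / 2) * cg g m else a m j"
  define cd where "cd g = col_dist2 n N k (?Y g)" for g
  define Q where "Q g = (\<Sum>i<r. (cmod (\<Sum>m<n. cnj (q (h i) m) * cg g m))\<^sup>2) / 2" for g
  have C: "cd g / \<nu> = complex_of_real (Q g)" if Yg: "cols_indep n N (?Y g)" for g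
  proof -
    have "col_dist2 n N k (?Y g) = complex_of_real (\<Sum>i\<in>?S. (cmod (hdot n (q i) (\<lambda>m. ?Y g m k)))\<^sup>2)"
    proof (rule col_dist2_eq_projection[OF Yg k N q(1)], intro ballI)
      fix i j assume i: "i \<in> ?S" and j: "j \<in> {..<N} - {k}"
      then have "j \<noteq> k" by simp
      then show "hdot n (\<lambda>m. ?Y g m j) (q i) = 0" using q(2)[rule_format, OF i j] by simp
    qed
    also have "(\<Sum>i\<in>?S. (cmod (hdot n (q i) (\<lambda>m. ?Y g m k)))\<^sup>2) = (\<Sum>i<r. (cmod (hdot n (q (h i)) (\<lambda>m. ?Y g m k)))\<^sup>2)"
      by (rule sum.reindex_bij_betw[OF h, symmetric])
    also have "(\<Sum>i<r. (cmod (hdot n (q (h i)) (\<lambda>m. ?Y g m k)))\<^sup>2) = \<nu> * Q g"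
    proof -
      have hd: "hdot n x (\<lambda>m. ?Y g m k) = complex_of_real (sqrt (\<nu> / 2)) * (\<Sum>m<n. cnj (x m) * cg g m)" for x
        by (simp add: hdot_def sum_distrib_left mult_ac)
      have sq: "(cmod (complex_of_real (sqrt (\<nu> / 2)) * z))\<^sup>2 = \<nu> / 2 * (cmod z)\<^sup>2" for z
        using \<nu> by (simp add: norm_mult power_mult_distrib)
      show ?thesis unfolding hd sq Q_def sum_distrib_left[symmetric] by (simp only: times_divide_eq_left times_divide_eq_right)
    qed
    finally show ?thesis using \<nu> by (simp add: cd_def)
  qed
  have cgm: "(\<lambda>g. cg g m) \<in> borel_measurable (std_cgauss n)" if "m < n" for m using that by measurable
  have Cm [measurable]: "cd \<in> borel_measurable (std_cgauss n)"
    unfolding cd_def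
  proof (rule borel_measurable_col_dist2[OF _ k])
    fix m j assume "m < n" "j < N"
    then show "(\<lambda>g. ?Y g m j) \<in> borel_measurable (std_cgauss n)"
      using cgm[of m] by (cases "j = k") auto
  qed
  have Qm [measurable]: "Q \<in> borel_measurable (std_cgauss n)"
    unfolding Q_def
    by (intro borel_measurable_divide borel_measurable_sum borel_measurable_power borel_measurable_norm
      borel_measurable_times borel_measurable_const cgm) auto
  have "prob {g\<in>space (std_cgauss n). cmod (cd g / \<nu> - of_nat r) \<ge> \<epsilon> * real r} =
     prob {g\<in>space (std_cgauss n). \<bar>Q g - real r\<bar> \<ge> \<epsilon> * real r}"
  proof (rule finite_measure_eq_AE)
    show "AE g in std_cgauss n. (g \<in> {g\<in>space (std_cgauss n). cmod (cd g / \<nu> - of_nat r) \<ge> \<epsilon> * real r}) \<longleftrightarrow>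
      (g \<in> {g\<in>space (std_cgauss n). \<bar>Q g - real r\<bar> \<ge> \<epsilon> * real r})"
      using Y
    proof (rule eventually_mono)
      fix g assume "cols_indep n N (?Y g)"
      then have "cmod (cd g / \<nu> - of_nat r) = cmod (complex_of_real (Q g - real r))"
        by (simp only: C of_real_diff of_real_of_nat_eq)
      then have "cmod (cd g / \<nu> - of_nat r) = \<bar>Q g - real r\<bar>" by (simp only: norm_of_real)
      then show "(g \<in> {g\<in>space (std_cgauss n). cmod (cd g / \<nu> - of_nat r) \<ge> \<epsilon> * real r}) \<longleftrightarrow>
      (g \<in> {g\<in>space (std_cgauss n). \<bar>Q g - real r\<bar> \<ge> \<epsilon> * real r})" by simp
    qed
  qed measurable
  also have "\<dots> = measure (std_cgauss r) {g\<in>space (std_cgauss r). \<bar>(\<Sum>m<r. (cmod (cg g m))\<^sup>2) / 2 - real r\<bar> \<ge> \<epsilon> * real r}"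
    unfolding Q_def by (rule orthonormal_cgauss_concentration[OF on])
  finally show ?thesis unfolding r_def cd_def .
qed

text \<open>As p = F w with w k = 1, the vector H p differs from column k of H F by a combination of
  the other columns and has the same distance from their span. After passage to the independent
  Gaussian column, Fubini fixes the others and leaves a probability bounded by \<delta> for almost
  every value of them.\<close>

theorem precoded_col_dist2_concentration:
  fixes F :: "nat \<Rightarrow> nat \<Rightarrow> complex"
  assumes P: "prob_space M" and H: "channel_matrix M n N S H" and k: "k < N" and N: "N \<le> n"
    and herm: "\<And>a b. a < N \<Longrightarrow> b < N \<Longrightarrow> S $$ (b, a) = cnj (S $$ (a, b))"
    and pd: "\<And>d. \<exists>a<N. d a \<noteq> 0 \<Longrightarrow> cform N S d \<noteq> 0"
    and unc: "\<And>j. j < N \<Longrightarrow> j \<noteq> k \<Longrightarrow> (\<Sum>a<N. \<Sum>b<N. cnj (p a) * F b j * S $$ (a, b)) = 0"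
    and \<nu>: "cform N S p = \<nu>" "0 < \<nu>"
    and F: "cols_indep N N F" and w: "w k = 1" and p: "\<And>b. b < N \<Longrightarrow> p b = (\<Sum>j<N. F b j * w j)"
    and \<delta>: "measure (std_cgauss (n - N + 1)) {g\<in>space (std_cgauss (n - N + 1)).
      \<bar>(\<Sum>m<n - N + 1. (cmod (cg g m))\<^sup>2) / 2 - real (n - N + 1)\<bar> \<ge> \<epsilon> * real (n - N + 1)} \<le> \<delta>"
  defines "A \<equiv> \<lambda>x m j. \<Sum>b<N. H x $$ (m, b) * F b j"
  shows "AE x in M. cols_indep n N (A x)"
    and "measure M {x\<in>space M. cmod (col_dist2 n N k (A x) / \<nu> - of_nat (n - N + 1)) \<ge> \<epsilon> * real (n - N + 1)} \<le> \<delta>"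
    and "(\<lambda>x. col_dist2 n N k (A x)) \<in> borel_measurable M"
proof -
  let ?I = "{..<n} \<times> {..<N}"
  let ?P = "M \<Otimes>\<^sub>M std_cgauss n"
  let ?r = "n - N + 1"
  let ?K = "Pi\<^sub>M ?I (\<lambda>_. borel :: complex measure)"
  interpret M: prob_space M by fact
  interpret G: prob_space "std_cgauss n" by (rule prob_space_std_cgauss)
  interpret PP: pair_prob_space M "std_cgauss n" ..
  show A: "AE x in M. cols_indep n N (A x)"
  proof (rule eventually_mono)
    show "AE x in M. cols_indep n N (\<lambda>m j. H x $$ (m, j))"
      by (rule channel_matrix_cols_indep_AE[OF P H N]) (rule pd)
    show "cols_indep n N (A x)" if "cols_indep n N (\<lambda>m j. H x $$ (m, j))" for x
      unfolding A_def by (rule cols_indep_mult[OF that F])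
  qed
  have mH [measurable]: "(\<lambda>x. H x $$ (m, b)) \<in> borel_measurable M" if "m < n" "b < N" for m b
    by (rule channel_matrix_entry_measurable[OF H that])
  have mA: "(\<lambda>x. A x m j) \<in> borel_measurable M" if "m < n" "j < N" for m j
    unfolding A_def using that by measurable
  show mC: "(\<lambda>x. col_dist2 n N k (A x)) \<in> borel_measurable M"
    by (rule borel_measurable_col_dist2[OF mA k])
  define X where "X = (\<lambda>(m, j) x. if j = k then \<Sum>b<N. H x $$ (m, b) * p b else \<Sum>b<N. H x $$ (m, b) * F b j)"
  define Y where "Y = (\<lambda>(m, j) (x, g). if j = k then complex_of_real (sqrt (\<nu> / 2)) * cg g m else \<Sum>b<N. H x $$ (m, b) * F b j)"
  have res: "distr M ?K (\<lambda>x. \<lambda>i\<in>?I. X i x) = distr ?P ?K (\<lambda>z. \<lambda>i\<in>?I. Y i z)"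
    "\<And>i. i \<in> ?I \<Longrightarrow> X i \<in> borel_measurable M" "\<And>i. i \<in> ?I \<Longrightarrow> Y i \<in> borel_measurable ?P"
    unfolding X_def Y_def
    using residual_column_distr[where p=p and F=F, OF P H k herm unc \<nu>(1) less_imp_le[OF \<nu>(2)]] by blast+
  have mX: "(\<lambda>x. \<lambda>i\<in>?I. X i x) \<in> measurable M ?K" by (intro measurable_restrict res)
  have mY: "(\<lambda>z. \<lambda>i\<in>?I. Y i z) \<in> measurable ?P ?K" by (intro measurable_restrict res)
  define C where "C z = col_dist2 n N k (\<lambda>m j. z (m, j))" for z :: "nat \<times> nat \<Rightarrow> complex"
  define D where "D z = Determinant.det (gram_mat n N (\<lambda>m j. z (m, j)))" for z :: "nat \<times> nat \<Rightarrow> complex"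
  have Cm [measurable]: "C \<in> borel_measurable ?K"
    unfolding C_def by (rule borel_measurable_col_dist2[OF _ k]) auto
  have Dm [measurable]: "D \<in> borel_measurable ?K"
    unfolding D_def by (rule borel_measurable_det_gram_mat) auto
  \<comment> \<open>The laws live on extensional functions, but the Gram matrix reads only indices
    in the box, so the restriction is invisible to it.\<close>
  have gram_restrict: "gram_mat n N (\<lambda>m j. (\<lambda>i\<in>?I. f i) (m, j)) = gram_mat n N (\<lambda>m j. f (m, j))" for f
    unfolding gram_mat_def by (rule eq_matI) auto
  have C_restrict: "C (\<lambda>i\<in>?I. f i) = col_dist2 n N k (\<lambda>m j. f (m, j))" for f
    unfolding C_def col_dist2_def gram_restrict ..
  have D_restrict: "D (\<lambda>i\<in>?I. f i) \<noteq> 0 \<longleftrightarrow> cols_indep n N (\<lambda>m j. f (m, j))" for f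
    unfolding D_def gram_restrict det_gram_mat_nonzero_iff ..
  have HX: "(\<Sum>b<N. H x $$ (m, b) * p b) = (\<Sum>j<N. A x m j * w j)" for x m
  proof -
    have "(\<Sum>b<N. H x $$ (m, b) * p b) = (\<Sum>b<N. \<Sum>j<N. H x $$ (m, b) * F b j * w j)"
      by (simp add: p sum_distrib_left mult.assoc)
    also have "\<dots> = (\<Sum>j<N. A x m j * w j)"
      unfolding A_def sum_distrib_right by (rule sum.swap)
    finally show ?thesis .
  qed
  have Xeq: "(\<lambda>m j. X (m, j) x) = (\<lambda>m j. if j = k then \<Sum>i<N. A x m i * w i else A x m j)" for x
    by (simp add: X_def HX fun_eq_iff) (simp add: A_def)
  have Yeq: "(\<lambda>m j. Y (m, j) (x, g)) = (\<lambda>m j. if j = k then complex_of_real (sqrt (\<nu> / 2)) * cg g m else A x m j)" for x g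
    unfolding Y_def case_prod_conv A_def ..
  \<comment> \<open>Independence of the columns holds for X, is expressed by the event that D is
    nonzero, and so passes to Y through the common law.\<close>
  have "AE x in M. D (\<lambda>i\<in>?I. X i x) \<noteq> 0"
    using A unfolding D_restrict Xeq by (rule eventually_mono) (rule cols_indep_replace[where w=w, OF _ k w])
  then have "AE z in ?P. D (\<lambda>i\<in>?I. Y i z) \<noteq> 0"
    using AE_cong_distr[OF res(1) mX mY, of "\<lambda>z. D z \<noteq> 0"] by simp
  from PP.AE_pair[OF this] have Yind: "AE x in M. AE g in std_cgauss n. cols_indep n N (\<lambda>m j. if j = k then complex_of_real (sqrt (\<nu> / 2)) * cg g m else A x m j)"
    unfolding D_restrict Yeq .
  define B where "B = {z\<in>space ?K. cmod (C z / \<nu> - of_nat ?r) \<ge> \<epsilon> * real ?r}"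
  have B: "B \<in> sets ?K" unfolding B_def by measurable
  have sp: "(\<lambda>i\<in>?I. f i) \<in> space ?K" for f by (auto simp: space_PiM)
  have "M.prob {x\<in>space M. cmod (col_dist2 n N k (A x) / \<nu> - of_nat ?r) \<ge> \<epsilon> * real ?r}
     = M.prob {x\<in>space M. cmod (C (\<lambda>i\<in>?I. X i x) / \<nu> - of_nat ?r) \<ge> \<epsilon> * real ?r}"
  proof (rule M.finite_measure_eq_AE)
    show "AE x in M. (x \<in> {x\<in>space M. cmod (col_dist2 n N k (A x) / \<nu> - of_nat ?r) \<ge> \<epsilon> * real ?r}) \<longleftrightarrow>
      (x \<in> {x\<in>space M. cmod (C (\<lambda>i\<in>?I. X i x) / \<nu> - of_nat ?r) \<ge> \<epsilon> * real ?r})"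
      using A
    proof (rule eventually_mono)
      fix x assume "cols_indep n N (A x)"
      then have "C (\<lambda>i\<in>?I. X i x) = col_dist2 n N k (A x)"
        unfolding C_restrict Xeq by (rule col_dist2_replace[where w=w, OF _ k N w])
      then show "(x \<in> {x\<in>space M. cmod (col_dist2 n N k (A x) / \<nu> - of_nat ?r) \<ge> \<epsilon> * real ?r}) \<longleftrightarrow>
      (x \<in> {x\<in>space M. cmod (C (\<lambda>i\<in>?I. X i x) / \<nu> - of_nat ?r) \<ge> \<epsilon> * real ?r})" by simp
    qed
    show "{x\<in>space M. cmod (C (\<lambda>i\<in>?I. X i x) / \<nu> - of_nat ?r) \<ge> \<epsilon> * real ?r} \<in> sets M"
      using measurable_compose[OF mX Cm] by measurable
  qed (use mC in measurable)
  also have "\<dots> = measure (distr M ?K (\<lambda>x. \<lambda>i\<in>?I. X i x)) B"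
    by (subst measure_distr[OF mX B]) (auto simp: B_def sp intro!: arg_cong[where f=M.prob])
  also have "\<dots> = measure ?P ((\<lambda>z. \<lambda>i\<in>?I. Y i z) -` B \<inter> space ?P)"
    unfolding res(1) by (rule measure_distr[OF mY B])
  also have "\<dots> \<le> \<delta>"
  proof -
    let ?B = "(\<lambda>z. \<lambda>i\<in>?I. Y i z) -` B \<inter> space ?P"
    have Bs: "?B \<in> sets ?P" using measurable_sets[OF mY B] .
    have \<delta>0: "0 \<le> \<delta>" using \<delta> measure_nonneg order_trans by blast
    have sec: "emeasure (std_cgauss n) (Pair x -` ?B) \<le> ennreal \<delta>"
      if x: "x \<in> space M" "cols_indep n N (A x)" and
      y: "AE g in std_cgauss n. cols_indep n N (\<lambda>m j. if j = k then complex_of_real (sqrt (\<nu> / 2)) * cg g m else A x m j)" for x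
    proof -
      have "Pair x -` ?B = {g\<in>space (std_cgauss n).
        cmod (col_dist2 n N k (\<lambda>m j. if j = k then complex_of_real (sqrt (\<nu> / 2)) * cg g m else A x m j) / \<nu> - of_nat ?r) \<ge> \<epsilon> * real ?r}"
        using x(1) by (auto simp: B_def sp C_restrict Yeq space_pair_measure)
      then show ?thesis
        using col_dist2_gaussian_column[OF x(2) k N \<nu>(2) y, of \<epsilon>] \<delta>
        by (simp add: G.emeasure_eq_measure ennreal_leI)
    qed
    have "emeasure ?P ?B = (\<integral>\<^sup>+ x. emeasure (std_cgauss n) (Pair x -` ?B) \<partial>M)"
      by (rule G.emeasure_pair_measure_alt[OF Bs])
    also have "\<dots> \<le> (\<integral>\<^sup>+ x. ennreal \<delta> \<partial>M)"
    proof (rule nn_integral_mono_AE)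
      show "AE x in M. emeasure (std_cgauss n) (Pair x -` ?B) \<le> ennreal \<delta>"
        using A Yind AE_space by eventually_elim (rule sec)
    qed
    also have "\<dots> = ennreal \<delta>" by (simp add: M.emeasure_space_1)
    finally show ?thesis using \<delta>0 by (simp add: PP.emeasure_eq_measure)
  qed
  finally show "M.prob {x\<in>space M. cmod (col_dist2 n N k (A x) / \<nu> - of_nat ?r) \<ge> \<epsilon> * real ?r} \<le> \<delta>" .
qed

section \<open>Toeplitz and circulant matrices\<close>

lemma sum_roots_of_unity:
  fixes t :: int
  assumes n: "0 < n"
  shows "(\<Sum>j<n. cis (2 * pi * real j * of_int t / real n)) = (if int n dvd t then of_nat n else 0)"
proof -
  define z where "z = cis (2 * pi * of_int t / real n)"
  have zj: "cis (2 * pi * real j * of_int t / real n) = z ^ j" for j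
    unfolding z_def Complex.DeMoivre by (rule arg_cong[where f=cis]) (simp add: field_simps)
  have zn: "z ^ n = 1"
    unfolding z_def Complex.DeMoivre using n cis_multiple_2pi[of "of_int t"] by (simp add: mult_ac)
  show ?thesis
  proof (cases "int n dvd t")
    case True
    then obtain q where "t = int n * q" by blast
    then have "z = 1" unfolding z_def using n cis_multiple_2pi[of "of_int q"] by (simp add: mult_ac)
    then show ?thesis using True by (simp add: zj)
  next
    case False
    have "z \<noteq> 1"
    proof
      assume "z = 1"
      then have "cos (2 * pi * of_int t / real n) = 1" by (simp add: z_def complex_eq_iff)
      then obtain x :: int where x: "2 * pi * of_int t / real n = of_int x * 2 * pi"
        unfolding cos_one_2pi_int by blast
      then have "real_of_int t = of_int (int n * x)" using n by (simp add: field_simps)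
      then have "t = int n * x" by (simp only: of_int_eq_iff)
      with False show False by simp
    qed
    then show ?thesis using False zn by (simp add: zj geometric_sum)
  qed
qed

lemma int_diff_dvd_iff_eq:
  assumes "a < n" "b < n"
  shows "int n dvd int a - int b \<longleftrightarrow> a = b"
proof
  assume "int n dvd int a - int b"
  then show "a = b"
    using assms zdvd_imp_le[of "int n" "int a - int b"] zdvd_imp_le[of "int n" "int b - int a"]
    by (cases a b rule: linorder_cases) (auto simp: dvd_diff_commute)
qed simp

text \<open>The hypothesis is the completeness relation of the w i: after expansion of the squares,
  summing over i first leaves only the diagonal.\<close>

lemma hdot_parseval:
  fixes w :: "nat \<Rightarrow> nat \<Rightarrow> complex" and x :: "nat \<Rightarrow> complex"
  assumes "\<And>a b. a < n \<Longrightarrow> b < n \<Longrightarrow> (\<Sum>i<n. w i a * cnj (w i b)) = (if a = b then 1 else 0)"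
  shows "(\<Sum>i<n. (cmod (hdot n (w i) x))\<^sup>2) = (\<Sum>a<n. (cmod (x a))\<^sup>2)"
proof -
  have "complex_of_real (\<Sum>i<n. (cmod (hdot n (w i) x))\<^sup>2) = (\<Sum>i<n. hdot n (w i) x * cnj (hdot n (w i) x))"
    by (simp only: complex_norm_square of_real_sum)
  also have "\<dots> = (\<Sum>i<n. \<Sum>b<n. \<Sum>a<n. x b * cnj (x a) * (w i a * cnj (w i b)))"
    unfolding hdot_def cnj_sum sum_product by (simp add: mult_ac)
  also have "\<dots> = (\<Sum>b<n. \<Sum>a<n. x b * cnj (x a) * (\<Sum>i<n. w i a * cnj (w i b)))"
    unfolding sum_distrib_left by (subst sum.swap, rule sum.cong[OF refl], subst sum.swap, rule refl)
  also have "\<dots> = (\<Sum>b<n. \<Sum>a<n. if a = b then x b * cnj (x a) else 0)"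
    by (intro sum.cong refl) (auto simp: assms)
  also have "\<dots> = complex_of_real (\<Sum>a<n. (cmod (x a))\<^sup>2)"
    by (simp only: complex_norm_square of_real_sum) simp
  finally show ?thesis by (simp only: of_real_eq_iff)
qed

text \<open>A weighted AM-GM inequality. It takes the place of the Cauchy-Schwarz inequality when
  mean absolute differences are bounded by mean-square ones, both for spectra and for integrals;
  \<epsilon> is chosen at the end.\<close>

lemma abs_le_add_square_div: "0 < \<epsilon> \<Longrightarrow> \<bar>d\<bar> \<le> \<epsilon> + d\<^sup>2 / \<epsilon>" for d \<epsilon> :: real
proof -
  assume \<epsilon>: "0 < \<epsilon>"
  have "\<bar>d\<bar> * \<epsilon> \<le> \<epsilon>\<^sup>2 + d\<^sup>2"
    using sum_squares_bound[of "\<bar>d\<bar>" \<epsilon>] \<epsilon> mult_nonneg_nonneg[of "\<bar>d\<bar>" \<epsilon>] by (simp del: mult_nonneg_nonneg)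
  then show ?thesis using \<epsilon> by (simp add: field_simps power2_eq_square)
qed

text \<open>Both spectra are compared through the doubly stochastic matrix of squared overlaps of the
  two eigenbases, as in the Hoffman--Wielandt inequality.\<close>

lemma spectral_sum_diff_le:
  fixes A B w v :: "nat \<Rightarrow> nat \<Rightarrow> complex" and l \<mu> :: "nat \<Rightarrow> real" and f :: "real \<Rightarrow> real"
  assumes w1: "\<And>a b. a < n \<Longrightarrow> b < n \<Longrightarrow> (\<Sum>i<n. w i a * cnj (w i b)) = (if a = b then 1 else 0)"
    and w2: "\<And>i. i < n \<Longrightarrow> hdot n (w i) (w i) = 1"
    and v1: "\<And>a b. a < n \<Longrightarrow> b < n \<Longrightarrow> (\<Sum>i<n. v i a * cnj (v i b)) = (if a = b then 1 else 0)"
    and v2: "\<And>i. i < n \<Longrightarrow> hdot n (v i) (v i) = 1"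
    and A: "\<And>i b. i < n \<Longrightarrow> b < n \<Longrightarrow> (\<Sum>a<n. cnj (w i a) * A a b) = l i * cnj (w i b)"
    and B: "\<And>j a. j < n \<Longrightarrow> a < n \<Longrightarrow> (\<Sum>b<n. B a b * v j b) = \<mu> j * v j a"
    and f: "\<And>x y. \<bar>f x - f y\<bar> \<le> L * \<bar>x - y\<bar>" and L: "0 \<le> L" and \<epsilon>: "0 < \<epsilon>"
  shows "\<bar>(\<Sum>i<n. f (l i)) - (\<Sum>j<n. f (\<mu> j))\<bar> \<le>
     L * (\<epsilon> * n + (\<Sum>a<n. \<Sum>b<n. (cmod (A a b - B a b))\<^sup>2) / \<epsilon>)"
proof -
  define p where "p i j = (cmod (hdot n (w i) (v j)))\<^sup>2" for i j
  have p0: "0 \<le> p i j" for i j by (simp add: p_def)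
  have norm1: "(\<Sum>a<n. (cmod (x a))\<^sup>2) = 1" if "hdot n x x = 1" for x
    using that unfolding hdot_self of_real_eq_1_iff .
  have col: "(\<Sum>i<n. p i j) = 1" if "j < n" for j
    unfolding p_def using hdot_parseval[OF w1] norm1[OF v2[OF that]] by simp
  have row: "(\<Sum>j<n. p i j) = 1" if "i < n" for i
  proof -
    have "(\<Sum>j<n. p i j) = (\<Sum>j<n. (cmod (hdot n (v j) (w i)))\<^sup>2)"
      unfolding p_def by (intro sum.cong refl) (subst hdot_commute, simp)
    then show ?thesis using hdot_parseval[OF v1] norm1[OF w2[OF that]] by simp
  qed
  define x where "x j a = (\<Sum>b<n. (A a b - B a b) * v j b)" for j a
  \<comment> \<open>w i acts on A from the left and v j on B from the right, so the entry of A - B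
    in these two bases is the eigenvalue difference times the overlap.\<close>
  have M: "hdot n (w i) (x j) = (l i - \<mu> j) * hdot n (w i) (v j)" if ij: "i < n" "j < n" for i j
  proof -
    have "hdot n (w i) (x j) = (\<Sum>a<n. cnj (w i a) * (\<Sum>b<n. A a b * v j b)) - (\<Sum>a<n. cnj (w i a) * (\<Sum>b<n. B a b * v j b))"
      unfolding hdot_def x_def by (simp add: left_diff_distrib sum_subtractf right_diff_distrib)
    also have "(\<Sum>a<n. cnj (w i a) * (\<Sum>b<n. A a b * v j b)) = (\<Sum>b<n. (\<Sum>a<n. cnj (w i a) * A a b) * v j b)"
      unfolding sum_distrib_left sum_distrib_right by (subst sum.swap) (simp add: mult.assoc)
    also have "\<dots> = l i * hdot n (w i) (v j)"
      unfolding hdot_def sum_distrib_left by (intro sum.cong refl) (simp add: A ij mult.assoc)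
    also have "(\<Sum>a<n. cnj (w i a) * (\<Sum>b<n. B a b * v j b)) = \<mu> j * hdot n (w i) (v j)"
      unfolding hdot_def sum_distrib_left[of "complex_of_real (\<mu> j)"] by (intro sum.cong refl) (simp add: B ij)
    finally show ?thesis by (simp add: left_diff_distrib)
  qed
  \<comment> \<open>Parseval in the basis w and then, after conjugation, in the basis v identifies
    the weighted squared differences with the squared Frobenius norm of A - B.\<close>
  have "(\<Sum>i<n. \<Sum>j<n. p i j * (l i - \<mu> j)\<^sup>2) = (\<Sum>j<n. \<Sum>i<n. p i j * (l i - \<mu> j)\<^sup>2)"
    by (rule sum.swap)
  also have "\<dots> = (\<Sum>j<n. \<Sum>i<n. (cmod (hdot n (w i) (x j)))\<^sup>2)"
  proof (intro sum.cong refl)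
    fix i j assume "i \<in> {..<n}" "j \<in> {..<n}"
    then have "hdot n (w i) (x j) = complex_of_real (l i - \<mu> j) * hdot n (w i) (v j)" using M by simp
    then show "p i j * (l i - \<mu> j)\<^sup>2 = (cmod (hdot n (w i) (x j)))\<^sup>2"
      by (simp only: p_def norm_mult norm_of_real power_mult_distrib power2_abs mult.commute)
  qed
  also have "\<dots> = (\<Sum>j<n. \<Sum>a<n. (cmod (x j a))\<^sup>2)"
    by (simp only: hdot_parseval[OF w1])
  also have "\<dots> = (\<Sum>a<n. \<Sum>j<n. (cmod (hdot n (v j) (\<lambda>b. cnj (A a b - B a b))))\<^sup>2)"
  proof (subst sum.swap, intro sum.cong refl)
    fix a j
    have "x j a = cnj (hdot n (v j) (\<lambda>b. cnj (A a b - B a b)))"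
      unfolding x_def hdot_def by (simp add: mult.commute)
    then show "(cmod (x j a))\<^sup>2 = (cmod (hdot n (v j) (\<lambda>b. cnj (A a b - B a b))))\<^sup>2" by simp
  qed
  also have "\<dots> = (\<Sum>a<n. \<Sum>b<n. (cmod (A a b - B a b))\<^sup>2)"
    by (simp only: hdot_parseval[OF v1] complex_mod_cnj)
  finally have frob: "(\<Sum>i<n. \<Sum>j<n. p i j * (l i - \<mu> j)\<^sup>2) = (\<Sum>a<n. \<Sum>b<n. (cmod (A a b - B a b))\<^sup>2)" .
  \<comment> \<open>Row and column sums 1 let both spectral sums run over the same weighted pairs,
    so that only the differences f (l i) - f (\<mu> j) remain.\<close>
  have "(\<Sum>i<n. f (l i)) = (\<Sum>i<n. \<Sum>j<n. p i j * f (l i))"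
    by (intro sum.cong refl) (simp add: sum_distrib_right[symmetric] row)
  moreover have "(\<Sum>j<n. f (\<mu> j)) = (\<Sum>i<n. \<Sum>j<n. p i j * f (\<mu> j))"
    by (subst sum.swap, intro sum.cong refl) (simp add: sum_distrib_right[symmetric] col)
  ultimately have "(\<Sum>i<n. f (l i)) - (\<Sum>j<n. f (\<mu> j)) = (\<Sum>i<n. \<Sum>j<n. p i j * (f (l i) - f (\<mu> j)))"
    by (simp add: sum_subtractf right_diff_distrib)
  then have "\<bar>(\<Sum>i<n. f (l i)) - (\<Sum>j<n. f (\<mu> j))\<bar> \<le> (\<Sum>i<n. \<Sum>j<n. \<bar>p i j * (f (l i) - f (\<mu> j))\<bar>)"
    by (auto intro: order_trans[OF sum_abs] sum_mono)
  also have "\<dots> \<le> (\<Sum>i<n. \<Sum>j<n. L * (\<epsilon> * p i j + p i j * (l i - \<mu> j)\<^sup>2 / \<epsilon>))"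
  proof (intro sum_mono)
    fix i j
    have "\<bar>p i j * (f (l i) - f (\<mu> j))\<bar> \<le> p i j * (L * \<bar>l i - \<mu> j\<bar>)"
      using f p0 by (simp add: abs_mult mult_left_mono)
    also have "\<dots> \<le> p i j * (L * (\<epsilon> + (l i - \<mu> j)\<^sup>2 / \<epsilon>))"
      using abs_le_add_square_div[OF \<epsilon>] p0 L by (intro mult_left_mono) auto
    finally show "\<bar>p i j * (f (l i) - f (\<mu> j))\<bar> \<le> L * (\<epsilon> * p i j + p i j * (l i - \<mu> j)\<^sup>2 / \<epsilon>)"
      by (simp add: algebra_simps)
  qed
  also have "\<dots> = L * (\<epsilon> * (\<Sum>i<n. \<Sum>j<n. p i j) + (\<Sum>i<n. \<Sum>j<n. p i j * (l i - \<mu> j)\<^sup>2) / \<epsilon>)"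
    by (simp only: sum.distrib sum_distrib_left[symmetric] sum_divide_distrib[symmetric])
  also have "(\<Sum>i<n. \<Sum>j<n. p i j) = n" by (simp add: row)
  finally show ?thesis unfolding frob .
qed

section \<open>Circulant matrices and their distance from Toeplitz matrices\<close>

definition partial_symbol :: "(int \<Rightarrow> complex) \<Rightarrow> nat \<Rightarrow> real \<Rightarrow> complex" where
  "partial_symbol \<sigma> K \<omega> = (\<Sum>k\<in>{- int K..int K}. \<sigma> k * cis (- (of_int k * \<omega>)))"

lemma partial_symbol_real:
  assumes "\<And>i. \<sigma> (- i) = cnj (\<sigma> i)"
  shows "partial_symbol \<sigma> K \<omega> = complex_of_real (Re (partial_symbol \<sigma> K \<omega>))"
proof -
  have "cnj (partial_symbol \<sigma> K \<omega>) = (\<Sum>k\<in>{- int K..int K}. \<sigma> (-k) * cis (- (of_int (-k) * \<omega>)))"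
    unfolding partial_symbol_def cnj_sum by (intro sum.cong refl) (simp add: assms cis_cnj)
  also have "\<dots> = partial_symbol \<sigma> K \<omega>"
    unfolding partial_symbol_def by (rule sum.reindex_bij_witness[of _ uminus uminus]) auto
  finally show ?thesis by (metis Reals_cnj_iff complex_is_Real_iff of_real_Re)
qed

text \<open>The coefficients with |k| \<le> K wrapped around modulo n. The eigenvalues of this
  matrix are the samples of \<open>partial_symbol\<close> at the points 2 pi j / n.\<close>

definition circulant :: "(int \<Rightarrow> complex) \<Rightarrow> nat \<Rightarrow> nat \<Rightarrow> nat \<Rightarrow> nat \<Rightarrow> complex" where
  "circulant \<sigma> K n a b = (\<Sum>k\<in>{k\<in>{- int K..int K}. int n dvd int a - int b - k}. \<sigma> k)"

definition fourier_vec :: "nat \<Rightarrow> nat \<Rightarrow> nat \<Rightarrow> complex" where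
  "fourier_vec n j a = cis (2 * pi * real j * real a / real n) / sqrt (real n)"

lemma fourier_vec_orthonormal:
  assumes n: "0 < n" and ab: "a < n" "b < n"
  shows "(\<Sum>i<n. fourier_vec n i a * cnj (fourier_vec n i b)) = (if a = b then 1 else 0)"
    and "hdot n (fourier_vec n a) (fourier_vec n b) = (if a = b then 1 else 0)"
proof -
  have s: "complex_of_real (sqrt (real n)) * complex_of_real (sqrt (real n)) = of_nat n"
    by (simp flip: of_real_mult)
  have "fourier_vec n i a * cnj (fourier_vec n i b) = cis (2 * pi * real i * of_int (int a - int b) / real n) / of_nat n" for i
    by (simp add: fourier_vec_def cis_cnj cis_mult s diff_divide_distrib right_diff_distrib)
  then have "(\<Sum>i<n. fourier_vec n i a * cnj (fourier_vec n i b)) = (\<Sum>i<n. cis (2 * pi * real i * of_int (int a - int b) / real n)) / of_nat n"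
    by (simp add: sum_divide_distrib)
  also have "\<dots> = (if a = b then 1 else 0)"
    unfolding sum_roots_of_unity[OF n] using n int_diff_dvd_iff_eq[OF ab] by simp
  finally show "(\<Sum>i<n. fourier_vec n i a * cnj (fourier_vec n i b)) = (if a = b then 1 else 0)" .
  have "cnj (fourier_vec n a i) * fourier_vec n b i = cis (2 * pi * real i * of_int (int b - int a) / real n) / of_nat n" for i
    by (simp add: fourier_vec_def cis_cnj cis_mult s diff_divide_distrib right_diff_distrib left_diff_distrib mult_ac)
  then have "hdot n (fourier_vec n a) (fourier_vec n b) = (\<Sum>i<n. cis (2 * pi * real i * of_int (int b - int a) / real n)) / of_nat n"
    by (simp add: hdot_def sum_divide_distrib)
  also have "\<dots> = (if a = b then 1 else 0)"
    unfolding sum_roots_of_unity[OF n] using n int_diff_dvd_iff_eq[OF ab(2,1)] by auto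
  finally show "hdot n (fourier_vec n a) (fourier_vec n b) = (if a = b then 1 else 0)" .
qed

text \<open>Summing the roots of unity over j selects exactly the k congruent to a - b modulo
  n.\<close>

lemma circulant_eq_fourier:
  assumes n: "0 < n"
  shows "circulant \<sigma> K n a b = (\<Sum>j<n. partial_symbol \<sigma> K (2 * pi * real j / real n) * fourier_vec n j a * cnj (fourier_vec n j b))"
proof -
  have s: "complex_of_real (sqrt (real n)) * complex_of_real (sqrt (real n)) = of_nat n"
    by (simp flip: of_real_mult)
  have "(\<Sum>j<n. partial_symbol \<sigma> K (2 * pi * real j / real n) * fourier_vec n j a * cnj (fourier_vec n j b)) =
    (\<Sum>j<n. \<Sum>k\<in>{- int K..int K}. \<sigma> k * cis (2 * pi * real j * of_int (int a - int b - k) / real n) / of_nat n)"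
  proof -
    have "cis (- (real_of_int k * (2 * pi * real j / real n))) * (fourier_vec n j a * cnj (fourier_vec n j b)) =
      cis (2 * pi * real j * of_int (int a - int b - k) / real n) / of_nat n" for j k
    proof -
      have "2 * pi * real j * of_int (int a - int b - k) / real n =
        - (real_of_int k * (2 * pi * real j / real n)) + (2 * pi * real j * real a / real n + - (2 * pi * real j * real b / real n))"
        using n by (simp add: field_simps)
      then show ?thesis by (simp only: cis_mult[symmetric]) (simp add: fourier_vec_def cis_cnj s)
    qed
    then show ?thesis unfolding partial_symbol_def sum_distrib_right by (simp add: mult.assoc)
  qed
  also have "\<dots> = (\<Sum>k\<in>{- int K..int K}. \<sigma> k / of_nat n * (\<Sum>j<n. cis (2 * pi * real j * of_int (int a - int b - k) / real n)))"
    by (subst sum.swap) (simp add: sum_distrib_left)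
  also have "\<dots> = (\<Sum>k\<in>{- int K..int K}. if int n dvd int a - int b - k then \<sigma> k else 0)"
    unfolding sum_roots_of_unity[OF n] using n by (intro sum.cong refl) auto
  also have "\<dots> = circulant \<sigma> K n a b"
    unfolding circulant_def by (rule sum.inter_filter[symmetric]) simp
  finally show ?thesis ..
qed

lemma circulant_eigenvector:
  assumes n: "0 < n" and j: "j < n"
  shows "(\<Sum>b<n. circulant \<sigma> K n a b * fourier_vec n j b) = partial_symbol \<sigma> K (2 * pi * real j / real n) * fourier_vec n j a"
proof -
  have "(\<Sum>b<n. circulant \<sigma> K n a b * fourier_vec n j b) =
    (\<Sum>i<n. partial_symbol \<sigma> K (2 * pi * real i / real n) * fourier_vec n i a * hdot n (fourier_vec n i) (fourier_vec n j))"
    unfolding circulant_eq_fourier[OF n] hdot_def sum_distrib_left sum_distrib_right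
    by (subst sum.swap) (simp add: mult_ac)
  also have "\<dots> = (\<Sum>i<n. if i = j then partial_symbol \<sigma> K (2 * pi * real j / real n) * fourier_vec n j a else 0)"
    using j by (intro sum.cong refl) (auto simp: fourier_vec_orthonormal(2)[OF n])
  finally show ?thesis using j by simp
qed

text \<open>Away from the corners the wrapped sum has at most the term k = a - b, so the entries
  agree inside the band and differ by one Toeplitz coefficient outside it. Wrapping can occur only
  for |a - b| \<ge> n - K, and there the crude bound C is used.\<close>

lemma toeplitz_circulant_entry_bound:
  assumes n: "2 * K < n" and ab: "a < n" "b < n" and C: "C = (\<Sum>k\<in>{- int K..int K}. cmod (\<sigma> k))"
  shows "(cmod (\<sigma> (int a - int b) - circulant \<sigma> K n a b))\<^sup>2 \<le>
    (if \<bar>int a - int b\<bar> > int K then 2 * (cmod (\<sigma> (int a - int b)))\<^sup>2 else 0) +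
    (if \<bar>int a - int b\<bar> \<ge> int n - int K then 2 * C\<^sup>2 else 0)"
proof -
  define t where "t = int a - int b"
  have t: "\<bar>t\<bar> < int n" using ab by (auto simp: t_def)
  have Cb: "cmod (circulant \<sigma> K n a b) \<le> C"
    unfolding circulant_def C by (rule order_trans[OF norm_sum]) (intro sum_mono2, auto)
  have C0: "0 \<le> C" unfolding C by (intro sum_nonneg) auto
  have far: "k = t \<or> \<bar>t\<bar> \<ge> int n - int K" if "k \<in> {- int K..int K}" "int n dvd t - k" for k
  proof (cases "k = t")
    case False
    then have "int n \<le> \<bar>t - k\<bar>" using that(2) zdvd_imp_le[of "int n" "\<bar>t - k\<bar>"] by auto
    then show ?thesis using that(1) by auto
  qed simp
  show ?thesis unfolding t_def[symmetric]
  proof (cases "\<bar>t\<bar> > int K")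
    case True
    show "(cmod (\<sigma> t - circulant \<sigma> K n a b))\<^sup>2 \<le> (if \<bar>t\<bar> > int K then 2 * (cmod (\<sigma> t))\<^sup>2 else 0) +
      (if \<bar>t\<bar> \<ge> int n - int K then 2 * C\<^sup>2 else 0)"
    proof (cases "\<bar>t\<bar> \<ge> int n - int K")
      case True
      have "(cmod (\<sigma> t - circulant \<sigma> K n a b))\<^sup>2 \<le> (cmod (\<sigma> t) + C)\<^sup>2"
        using norm_triangle_ineq4[of "\<sigma> t" "circulant \<sigma> K n a b"] Cb by (intro power_mono) auto
      also have "\<dots> \<le> 2 * (cmod (\<sigma> t))\<^sup>2 + 2 * C\<^sup>2"
        using sum_squares_bound[of "cmod (\<sigma> t)" C] by (simp add: power2_sum)
      finally show ?thesis using True \<open>\<bar>t\<bar> > int K\<close> by simp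
    next
      case False
      have E: "{k \<in> {- int K..int K}. int n dvd int a - int b - k} = {}"
        using far False \<open>\<bar>t\<bar> > int K\<close> unfolding t_def[symmetric] by fastforce
      have "circulant \<sigma> K n a b = 0" unfolding circulant_def E by simp
      then show ?thesis using True False by simp
    qed
  next
    case False
    have E: "{k \<in> {- int K..int K}. int n dvd int a - int b - k} = {t}"
      using far False n unfolding t_def[symmetric] by fastforce
    have "circulant \<sigma> K n a b = \<sigma> t" unfolding circulant_def E by simp
    then show "(cmod (\<sigma> t - circulant \<sigma> K n a b))\<^sup>2 \<le> (if \<bar>t\<bar> > int K then 2 * (cmod (\<sigma> t))\<^sup>2 else 0) +
      (if \<bar>t\<bar> \<ge> int n - int K then 2 * C\<^sup>2 else 0)" using C0 by simp
  qed
qed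

text \<open>In a row, the entries outside the band contribute at most twice the one-sided tail on
  either side of the diagonal. The corner positions lie in two K by K squares and cost 2 C^2 each;
  this part does not grow with n.\<close>

lemma toeplitz_circulant_frobenius_bound:
  assumes sym: "\<And>i. \<sigma> (- i) = cnj (\<sigma> i)" and sm: "summable (\<lambda>i. (cmod (\<sigma> (int i)))\<^sup>2)"
    and n: "2 * K < n" and C: "C = (\<Sum>k\<in>{- int K..int K}. cmod (\<sigma> k))"
  shows "(\<Sum>a<n. \<Sum>b<n. (cmod (\<sigma> (int a - int b) - circulant \<sigma> K n a b))\<^sup>2) \<le>
    4 * n * (\<Sum>i. (cmod (\<sigma> (int (i + Suc K))))\<^sup>2) + 4 * K\<^sup>2 * C\<^sup>2"
proof -
  define \<tau> where "\<tau> = (\<Sum>i. (cmod (\<sigma> (int (i + Suc K))))\<^sup>2)"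
  have smK: "summable (\<lambda>i. (cmod (\<sigma> (int (i + Suc K))))\<^sup>2)" using sm by (subst summable_iff_shift)
  \<comment> \<open>Conjugate symmetry reduces both sides of the diagonal to the one-sided
    coefficients of \<open>sm\<close>.\<close>
  have sabs: "cmod (\<sigma> k) = cmod (\<sigma> (int (nat \<bar>k\<bar>)))" for k
    using sym[of k] by (cases "k \<ge> 0") (auto simp: abs_if)
  have tail: "(\<Sum>b\<in>D. (cmod (\<sigma> (int a - int b)))\<^sup>2) \<le> \<tau>"
    if D: "finite D" "\<And>b. b \<in> D \<Longrightarrow> \<bar>int a - int b\<bar> > int K" "inj_on (\<lambda>b. \<bar>int a - int b\<bar>) D" for a D
  proof -
    define h where "h b = nat \<bar>int a - int b\<bar> - Suc K" for b
    have hb: "nat \<bar>int a - int b\<bar> = h b + Suc K" if "b \<in> D" for b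
      using D(2)[OF that] unfolding h_def by auto
    have inj: "inj_on h D"
    proof (rule inj_onI)
      fix x y assume xy: "x \<in> D" "y \<in> D" "h x = h y"
      then have "nat \<bar>int a - int x\<bar> = nat \<bar>int a - int y\<bar>" using hb by simp
      then have "\<bar>int a - int x\<bar> = \<bar>int a - int y\<bar>" by simp
      then show "x = y" using D(3) xy by (auto dest: inj_onD)
    qed
    have "(\<Sum>b\<in>D. (cmod (\<sigma> (int a - int b)))\<^sup>2) = (\<Sum>b\<in>D. (cmod (\<sigma> (int (h b + Suc K))))\<^sup>2)"
      by (intro sum.cong refl) (subst sabs, simp only: hb)
    also have "\<dots> = (\<Sum>i\<in>h ` D. (cmod (\<sigma> (int (i + Suc K))))\<^sup>2)"
      by (simp add: sum.reindex[OF inj])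
    also have "\<dots> \<le> \<tau>" unfolding \<tau>_def by (rule sum_le_suminf[OF smK]) (use D in auto)
    finally show ?thesis .
  qed
  have row: "(\<Sum>b<n. if \<bar>int a - int b\<bar> > int K then 2 * (cmod (\<sigma> (int a - int b)))\<^sup>2 else 0) \<le> 4 * \<tau>" for a
  proof -
    let ?D1 = "{b\<in>{..<n}. \<bar>int a - int b\<bar> > int K \<and> b \<le> a}" and ?D2 = "{b\<in>{..<n}. \<bar>int a - int b\<bar> > int K \<and> a < b}"
    have "(\<Sum>b<n. if \<bar>int a - int b\<bar> > int K then 2 * (cmod (\<sigma> (int a - int b)))\<^sup>2 else 0) =
      2 * (\<Sum>b\<in>{b\<in>{..<n}. \<bar>int a - int b\<bar> > int K}. (cmod (\<sigma> (int a - int b)))\<^sup>2)"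
      by (simp add: sum.inter_filter[symmetric] sum_distrib_left)
    also have "{b\<in>{..<n}. \<bar>int a - int b\<bar> > int K} = ?D1 \<union> ?D2" by auto
    also have "(\<Sum>b\<in>?D1 \<union> ?D2. (cmod (\<sigma> (int a - int b)))\<^sup>2) = (\<Sum>b\<in>?D1. (cmod (\<sigma> (int a - int b)))\<^sup>2) + (\<Sum>b\<in>?D2. (cmod (\<sigma> (int a - int b)))\<^sup>2)"
      by (rule sum.union_disjoint) auto
    also have "\<dots> \<le> \<tau> + \<tau>"
    proof (intro add_mono tail)
      show "inj_on (\<lambda>b. \<bar>int a - int b\<bar>) ?D1" "inj_on (\<lambda>b. \<bar>int a - int b\<bar>) ?D2"
        by (rule inj_onI; simp)+
      show "int K < \<bar>int a - int b\<bar>" if "b \<in> ?D1" for b using that by blast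
      show "int K < \<bar>int a - int b\<bar>" if "b \<in> ?D2" for b using that by blast
    qed simp_all
    finally show ?thesis by simp
  qed
  have corner: "(\<Sum>a<n. \<Sum>b<n. if \<bar>int a - int b\<bar> \<ge> int n - int K then 2 * C\<^sup>2 else 0) \<le> 4 * K\<^sup>2 * C\<^sup>2"
  proof -
    let ?P = "{(a,b)\<in>{..<n} \<times> {..<n}. \<bar>int a - int b\<bar> \<ge> int n - int K}"
    have "(\<Sum>a<n. \<Sum>b<n. if \<bar>int a - int b\<bar> \<ge> int n - int K then 2 * C\<^sup>2 else 0) =
      (\<Sum>p\<in>{..<n} \<times> {..<n}. if p \<in> ?P then 2 * C\<^sup>2 else 0)"
      unfolding sum.cartesian_product by (intro sum.cong refl) (auto split: if_splits)
    also have "\<dots> = real (card ?P) * (2 * C\<^sup>2)"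
      by (subst sum.inter_restrict[symmetric]) (auto intro!: arg_cong[where f=card] arg_cong[where f=real])
    also have "card ?P \<le> card ({n-K..<n} \<times> {..<K} \<union> {..<K} \<times> {n-K..<n})"
      by (intro card_mono) auto
    also have "\<dots> \<le> card ({n-K..<n} \<times> {..<K}) + card ({..<K} \<times> {n-K..<n})" by (rule card_Un_le)
    also have "\<dots> = 2 * K\<^sup>2" using n by (simp add: power2_eq_square)
    finally show ?thesis by (simp add: mult_right_mono)
  qed
  have "(\<Sum>a<n. \<Sum>b<n. (cmod (\<sigma> (int a - int b) - circulant \<sigma> K n a b))\<^sup>2) \<le>
    (\<Sum>a<n. \<Sum>b<n. (if \<bar>int a - int b\<bar> > int K then 2 * (cmod (\<sigma> (int a - int b)))\<^sup>2 else 0) +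
    (if \<bar>int a - int b\<bar> \<ge> int n - int K then 2 * C\<^sup>2 else 0))"
    by (intro sum_mono toeplitz_circulant_entry_bound[OF n _ _ C]) auto
  also have "\<dots> \<le> (\<Sum>a<n. 4 * \<tau>) + 4 * K\<^sup>2 * C\<^sup>2"
    unfolding sum.distrib by (intro add_mono corner sum_mono row)
  finally show ?thesis by (simp add: \<tau>_def mult_ac)
qed

section \<open>Integrals over one period\<close>

lemma measurable_period_measure:
  "continuous_on {0..2 * pi} f \<Longrightarrow> f \<in> borel_measurable period_measure"
  by (rule continuous_imp_measurable_on_sets_lebesgue) auto

lemma finite_period_measure: "finite_measure period_measure"
  by (rule finite_measureI) (simp add: emeasure_restrict_space)

lemma measure_period_measure: "measure period_measure (space period_measure) = 2 * pi"
  by (simp add: measure_restrict_space)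

lemma integral_cis_period:
  "(LINT \<omega>|period_measure. cis (of_int k * \<omega>)) = (if k = 0 then 2 * pi else 0)"
proof (cases "k = 0")
  case True
  then show ?thesis using measure_period_measure by (simp add: scaleR_conv_of_real)
next
  case False
  have cont: "continuous_on {0..2 * pi} (\<lambda>\<omega>. cis (of_int k * \<omega>))"
    unfolding cis_conv_exp by (intro continuous_intros)
  have "((\<lambda>\<omega>. cis (of_int k * \<omega>)) has_integral
      exp (\<i> * of_int k * complex_of_real (2 * pi)) / (\<i> * of_int k) - exp (\<i> * of_int k * complex_of_real 0) / (\<i> * of_int k)) {0..2*pi}"
  proof (rule fundamental_theorem_of_calculus)
    fix x :: real assume "x \<in> {0..2*pi}"
    have "((\<lambda>z. exp (\<i> * of_int k * z) / (\<i> * of_int k)) has_field_derivative cis (of_int k * x)) (at (complex_of_real x))"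
      using False by (auto intro!: derivative_eq_intros simp: cis_conv_exp mult_ac)
    then show "((\<lambda>\<omega>. exp (\<i> * of_int k * complex_of_real \<omega>) / (\<i> * of_int k)) has_vector_derivative cis (of_int k * x)) (at x within {0..2*pi})"
      by (rule has_vector_derivative_real_field)
  qed simp
  moreover have "exp (\<i> * of_int k * complex_of_real (2 * pi)) = 1"
    using cis_multiple_2pi[of "of_int k"] by (simp add: cis_conv_exp mult_ac)
  ultimately have "integral {0..2*pi} (\<lambda>\<omega>. cis (of_int k * \<omega>)) = 0"
    by (simp add: integral_unique)
  then show ?thesis
    using False by (subst lebesgue_integral_eq_integral[OF continuous_imp_integrable_real[OF cont]]) auto
qed

lemma integrable_mult_cis:
  assumes u: "integrable period_measure u"
  shows "integrable period_measure (\<lambda>\<omega>. complex_of_real (u \<omega>) * cis (of_int k * \<omega>))"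
proof (rule Bochner_Integration.integrable_bound[OF u])
  have [measurable]: "(\<lambda>\<omega>. cis (of_int k * \<omega>)) \<in> borel_measurable period_measure"
    by (rule measurable_period_measure) (unfold cis_conv_exp, intro continuous_intros)
  show "(\<lambda>\<omega>. complex_of_real (u \<omega>) * cis (of_int k * \<omega>)) \<in> borel_measurable period_measure"
    using u by measurable
qed (auto simp: norm_mult)

text \<open>Expanding the square turns the weighted integral of a squared trigonometric polynomial
  into the Toeplitz form of the Fourier coefficients of the weight. It is used for the symbol and
  for a constant weight.\<close>

lemma trig_poly_sq_integral:
  assumes u: "integrable period_measure u"
  shows "integrable period_measure (\<lambda>\<omega>. u \<omega> * (cmod (\<Sum>b<n. d b * cis (- (real b * \<omega>))))\<^sup>2)"
    and "complex_of_real (LINT \<omega>|period_measure. u \<omega> * (cmod (\<Sum>b<n. d b * cis (- (real b * \<omega>))))\<^sup>2) =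
    (\<Sum>a<n. \<Sum>b<n. cnj (d a) * d b * (LINT \<omega>|period_measure. complex_of_real (u \<omega>) * cis (of_int (int a - int b) * \<omega>)))"
proof -
  have eq: "complex_of_real (u \<omega> * (cmod (\<Sum>b<n. d b * cis (- (real b * \<omega>))))\<^sup>2) =
    (\<Sum>a<n. \<Sum>b<n. cnj (d a) * d b * (complex_of_real (u \<omega>) * cis (of_int (int a - int b) * \<omega>)))" for \<omega>
  proof -
    have c: "cis (of_int (int a - int b) * \<omega>) = cnj (cis (- (real a * \<omega>))) * cis (- (real b * \<omega>))" for a b
      by (simp add: cis_cnj cis_mult left_diff_distrib)
    have "complex_of_real (u \<omega> * (cmod (\<Sum>b<n. d b * cis (- (real b * \<omega>))))\<^sup>2) =
      complex_of_real (u \<omega>) * (cnj (\<Sum>b<n. d b * cis (- (real b * \<omega>))) * (\<Sum>b<n. d b * cis (- (real b * \<omega>))))"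
      by (simp only: of_real_mult complex_norm_square mult.commute)
    also have "\<dots> = (\<Sum>a<n. \<Sum>b<n. cnj (d a) * d b * (complex_of_real (u \<omega>) * cis (of_int (int a - int b) * \<omega>)))"
      unfolding cnj_sum sum_product unfolding sum_distrib_left c by (intro sum.cong refl) (simp only: complex_cnj_mult mult_ac)
    finally show ?thesis .
  qed
  have int: "integrable period_measure (\<lambda>\<omega>. cnj (d a) * d b * (complex_of_real (u \<omega>) * cis (of_int (int a - int b) * \<omega>)))" for a b
    by (intro integrable_mult_right integrable_mult_cis u)
  have "integrable period_measure (\<lambda>\<omega>. complex_of_real (u \<omega> * (cmod (\<Sum>b<n. d b * cis (- (real b * \<omega>))))\<^sup>2))"
    unfolding eq by (intro Bochner_Integration.integrable_sum int)
  from integrable_Re[OF this]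
  show "integrable period_measure (\<lambda>\<omega>. u \<omega> * (cmod (\<Sum>b<n. d b * cis (- (real b * \<omega>))))\<^sup>2)" by (simp only: Re_complex_of_real)
  have "complex_of_real (LINT \<omega>|period_measure. u \<omega> * (cmod (\<Sum>b<n. d b * cis (- (real b * \<omega>))))\<^sup>2) =
    (LINT \<omega>|period_measure. complex_of_real (u \<omega> * (cmod (\<Sum>b<n. d b * cis (- (real b * \<omega>))))\<^sup>2))"
    by (rule integral_complex_of_real[symmetric])
  also have "\<dots> = (\<Sum>a<n. \<Sum>b<n. LINT \<omega>|period_measure. cnj (d a) * d b * (complex_of_real (u \<omega>) * cis (of_int (int a - int b) * \<omega>)))"
    unfolding eq by (simp only: Bochner_Integration.integral_sum Bochner_Integration.integrable_sum int)
  also have "\<dots> = (\<Sum>a<n. \<Sum>b<n. cnj (d a) * d b * (LINT \<omega>|period_measure. complex_of_real (u \<omega>) * cis (of_int (int a - int b) * \<omega>)))"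
    by (simp only: integral_mult_right_zero)
  finally show "complex_of_real (LINT \<omega>|period_measure. u \<omega> * (cmod (\<Sum>b<n. d b * cis (- (real b * \<omega>))))\<^sup>2) =
    (\<Sum>a<n. \<Sum>b<n. cnj (d a) * d b * (LINT \<omega>|period_measure. complex_of_real (u \<omega>) * cis (of_int (int a - int b) * \<omega>)))" .
qed

lemma has_symbol_integrable: "has_symbol \<sigma> s \<Longrightarrow> integrable period_measure s"
  unfolding has_symbol_def
  by (elim conjE) (rule finite_measure.square_integrable_imp_integrable[OF finite_period_measure])

text \<open>Up to the factor 2 pi, both sides are integrals of the same squared trigonometric
  polynomial, against m on the left and against s on the right.\<close>

lemma toeplitz_form_lower_bound:
  assumes s: "has_symbol \<sigma> s" and m: "AE \<omega> in period_measure. m \<le> s \<omega>"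
  shows "m * (\<Sum>a<n. (cmod (d a))\<^sup>2) \<le> cform n (toeplitz \<sigma> n) d"
proof -
  interpret finite_measure period_measure by (rule finite_period_measure)
  let ?P = "\<lambda>\<omega>. (cmod (\<Sum>b<n. d b * cis (- (real b * \<omega>))))\<^sup>2"
  have si: "integrable period_measure s" by (rule has_symbol_integrable[OF s])
  have \<sigma>: "(LINT \<omega>|period_measure. complex_of_real (s \<omega>) * cis (of_int k * \<omega>)) = 2 * pi * \<sigma> k" for k
    using s by (simp add: has_symbol_def)
  have im: "integrable period_measure (\<lambda>_. m)" by simp
  have "complex_of_real (LINT \<omega>|period_measure. m * ?P \<omega>) =
     (\<Sum>a<n. \<Sum>b<n. if a = b then 2 * pi * m * (cnj (d a) * d b) else 0)"
  proof -
    have cm: "(LINT \<omega>|period_measure. complex_of_real m * cis (of_int k * \<omega>)) = (if k = 0 then 2 * pi * m else 0)" for k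
      unfolding integral_mult_right_zero integral_cis_period by simp
    show ?thesis unfolding trig_poly_sq_integral(2)[OF im] cm
      by (intro sum.cong refl) (simp add: mult_ac)
  qed
  also have "\<dots> = (\<Sum>a<n. 2 * pi * m * (cnj (d a) * d a))" by simp
  also have "\<dots> = complex_of_real (2 * pi * m * (\<Sum>a<n. (cmod (d a))\<^sup>2))"
    by (simp only: of_real_mult of_real_sum complex_norm_square sum_distrib_left mult_ac of_real_numeral)
  finally have mP: "(LINT \<omega>|period_measure. m * ?P \<omega>) = 2 * pi * m * (\<Sum>a<n. (cmod (d a))\<^sup>2)"
    by (simp only: of_real_eq_iff)
  have "complex_of_real (LINT \<omega>|period_measure. s \<omega> * ?P \<omega>) =
     2 * pi * (\<Sum>a<n. \<Sum>b<n. cnj (d a) * d b * \<sigma> (int a - int b))"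
    unfolding trig_poly_sq_integral(2)[OF si] \<sigma> by (simp add: sum_distrib_left mult_ac)
  also have "(\<Sum>a<n. \<Sum>b<n. cnj (d a) * d b * \<sigma> (int a - int b)) = (\<Sum>a<n. \<Sum>b<n. cnj (d a) * d b * toeplitz \<sigma> n $$ (a, b))"
    by (intro sum.cong refl) (simp add: toeplitz_def)
  finally have eq: "complex_of_real (LINT \<omega>|period_measure. s \<omega> * ?P \<omega>) =
     2 * pi * (\<Sum>a<n. \<Sum>b<n. cnj (d a) * d b * toeplitz \<sigma> n $$ (a, b))" .
  have R: "Re (complex_of_real (2 * pi) * Z) = 2 * pi * Re Z" for Z by simp
  have "Re (complex_of_real (LINT \<omega>|period_measure. s \<omega> * ?P \<omega>)) = 2 * pi * cform n (toeplitz \<sigma> n) d"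
    unfolding eq cform_def R ..
  then have sP: "(LINT \<omega>|period_measure. s \<omega> * ?P \<omega>) = 2 * pi * cform n (toeplitz \<sigma> n) d" by simp
  have "(LINT \<omega>|period_measure. m * ?P \<omega>) \<le> (LINT \<omega>|period_measure. s \<omega> * ?P \<omega>)"
    by (intro integral_mono_AE trig_poly_sq_integral(1) si im) (use m in \<open>auto elim!: eventually_mono intro: mult_right_mono\<close>)
  then show ?thesis unfolding mP sP by (simp add: mult.assoc)
qed

text \<open>On each of the n cells of length h = 2 pi / n the value at the left endpoint is off by
  at most D h, which gives a total error n D h^2 before the division by 2 pi.\<close>

lemma riemann_sum_error:
  fixes g :: "real \<Rightarrow> real"
  assumes g: "\<And>x y. \<bar>g x - g y\<bar> \<le> D * \<bar>x - y\<bar>" and n: "0 < n"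
  shows "\<bar>(\<Sum>j<n. g (2 * pi * real j / real n)) / real n - (LINT \<omega>|period_measure. g \<omega>) / (2 * pi)\<bar> \<le> 2 * pi * D / real n"
proof -
  have cont: "continuous_on S g" for S
  proof (rule continuous_on_subset[OF _ subset_UNIV], rule lipschitz_on_continuous_on)
    have "0 \<le> D" using g[of 1 0] by simp
    then show "D-lipschitz_on UNIV g" using g by (intro lipschitz_onI) (auto simp: dist_real_def)
  qed
  define h where "h = 2 * pi / real n"
  have h: "0 < h" using n by (simp add: h_def)
  have step: "\<bar>integral {h * real j..h * real (Suc j)} g - h * g (h * real j)\<bar> \<le> D * h\<^sup>2" for j
  proof -
    have le: "h * real j \<le> h * real (Suc j)" using h by simp
    have "integral {h * real j..h * real (Suc j)} (\<lambda>x. g x - g (h * real j)) =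
      integral {h * real j..h * real (Suc j)} g - integral {h * real j..h * real (Suc j)} (\<lambda>x. g (h * real j))"
      by (rule integral_diff) (auto intro: integrable_continuous_real cont)
    also have "integral {h * real j..h * real (Suc j)} (\<lambda>x. g (h * real j)) = h * g (h * real j)"
      using le by (simp add: algebra_simps)
    finally have eq: "integral {h * real j..h * real (Suc j)} (\<lambda>x. g x - g (h * real j)) =
      integral {h * real j..h * real (Suc j)} g - h * g (h * real j)" .
    have "norm (integral {h * real j..h * real (Suc j)} (\<lambda>x. g x - g (h * real j))) \<le> (D * h) * (h * real (Suc j) - h * real j)"
    proof (rule integral_bound[OF le])
      show "continuous_on {h * real j..h * real (Suc j)} (\<lambda>x. g x - g (h * real j))" by (intro continuous_intros cont)
      fix t assume t: "t \<in> {h * real j..h * real (Suc j)}"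
      have D: "0 \<le> D" using g[of 1 0] by simp
      have "\<bar>t - h * real j\<bar> \<le> h" using t by (auto simp: algebra_simps)
      then have "D * \<bar>t - h * real j\<bar> \<le> D * h" using D by (rule mult_left_mono)
      then show "norm (g t - g (h * real j)) \<le> D * h" using g[of t "h * real j"] by simp
    qed
    then show ?thesis unfolding eq by (simp add: algebra_simps power2_eq_square)
  qed
  have split: "integral {0..h * real m} g = (\<Sum>j<m. integral {h * real j..h * real (Suc j)} g)" for m
  proof (induction m)
    case (Suc m)
    have "integral {0..h * real m} g + integral {h * real m..h * real (Suc m)} g = integral {0..h * real (Suc m)} g"
      using h by (intro Henstock_Kurzweil_Integration.integral_combine) (auto intro: integrable_continuous_real cont mult_nonneg_nonneg)
    then show ?case using Suc by simp
  qed simp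
  have "integral\<^sup>L period_measure g = integral {0..2*pi} g"
    by (rule lebesgue_integral_eq_integral) (auto intro: continuous_imp_integrable_real cont)
  also have "\<dots> = integral {0..h * real n} g" using n by (simp add: h_def)
  finally have I: "integral\<^sup>L period_measure g = (\<Sum>j<n. integral {h * real j..h * real (Suc j)} g)"
    unfolding split .
  have "\<bar>(\<Sum>j<n. h * g (h * real j)) - integral\<^sup>L period_measure g\<bar> \<le> (\<Sum>j<n. \<bar>h * g (h * real j) - integral {h * real j..h * real (Suc j)} g\<bar>)"
    unfolding I sum_subtractf[symmetric] by (rule sum_abs)
  also have "\<dots> \<le> (\<Sum>j<n. D * h\<^sup>2)"
    by (intro sum_mono) (use step in \<open>simp add: abs_minus_commute\<close>)
  also have "\<dots> = 2 * pi * (2 * pi * D / real n)" using n by (simp add: h_def power2_eq_square field_simps)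
  finally have "\<bar>(\<Sum>j<n. h * g (h * real j)) - integral\<^sup>L period_measure g\<bar> / (2 * pi) \<le> 2 * pi * D / real n"
    by (subst pos_divide_le_eq) (auto simp: mult.commute)
  moreover have "(\<Sum>j<n. g (2 * pi * real j / real n)) / real n - integral\<^sup>L period_measure g / (2 * pi) =
    ((\<Sum>j<n. h * g (h * real j)) - integral\<^sup>L period_measure g) / (2 * pi)"
  proof -
    have "(\<Sum>j<n. h * g (h * real j)) = h * (\<Sum>j<n. g (2 * pi * real j / real n))"
      by (simp add: sum_distrib_left h_def)
    then show ?thesis using n by (simp add: h_def diff_divide_distrib)
  qed
  ultimately show ?thesis by (simp add: abs_divide)
qed

text \<open>Truncation at m makes 1 / sqrt bounded and Lipschitz on the whole line. The constant is
  the modulus of the derivative of 1 / sqrt at m, where it is largest.\<close>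

lemma inverse_sqrt_max_lipschitz:
  assumes m: "0 < (m::real)"
  shows "\<bar>1 / sqrt (max x m) - 1 / sqrt (max y m)\<bar> \<le> 1 / (2 * m * sqrt m) * \<bar>x - y\<bar>"
proof -
  have main: "\<bar>1 / sqrt a - 1 / sqrt b\<bar> \<le> 1 / (2 * m * sqrt m) * \<bar>a - b\<bar>" if ab: "m \<le> a" "m \<le> b" for a b
  proof -
    have pos: "0 < sqrt a" "0 < sqrt b" "0 < sqrt m" using m ab by auto
    have sm: "sqrt m \<le> sqrt a" "sqrt m \<le> sqrt b" using ab by auto
    have "1 / sqrt a - 1 / sqrt b = (sqrt b - sqrt a) / (sqrt a * sqrt b)"
      using pos by (simp add: field_simps)
    also have "\<dots> = (b - a) / (sqrt a * sqrt b * (sqrt a + sqrt b))"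
    proof -
      have "(sqrt b - sqrt a) * (sqrt a + sqrt b) = b - a"
        using ab m by (simp add: algebra_simps)
      moreover have "sqrt a + sqrt b \<noteq> 0" using pos by linarith
      then have "(sqrt b - sqrt a) / (sqrt a * sqrt b) = (sqrt b - sqrt a) * (sqrt a + sqrt b) / (sqrt a * sqrt b * (sqrt a + sqrt b))"
        by simp
      ultimately show ?thesis by simp
    qed
    finally have eq: "\<bar>1 / sqrt a - 1 / sqrt b\<bar> = \<bar>a - b\<bar> / (sqrt a * sqrt b * (sqrt a + sqrt b))"
      using pos by (simp add: abs_divide abs_mult abs_minus_commute)
    have "2 * m * sqrt m = sqrt m * sqrt m * (sqrt m + sqrt m)" using m by simp
    also have "\<dots> \<le> sqrt a * sqrt b * (sqrt a + sqrt b)"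
      using pos sm by (intro mult_mono add_mono) auto
    finally show ?thesis unfolding eq using pos m by (simp add: frac_le)
  qed
  have "\<bar>1 / sqrt (max x m) - 1 / sqrt (max y m)\<bar> \<le> 1 / (2 * m * sqrt m) * \<bar>max x m - max y m\<bar>"
    by (rule main) auto
  also have "\<dots> \<le> 1 / (2 * m * sqrt m) * \<bar>x - y\<bar>" using m by (intro mult_left_mono) auto
  finally show ?thesis .
qed

lemma cis_diff_le: "cmod (cis x - cis y) \<le> \<bar>x - y\<bar>"
proof -
  have "cis x - cis y = cis y * (cis (x - y) - 1)" by (simp add: algebra_simps cis_mult)
  then have "cmod (cis x - cis y) = cmod (exp (\<i> * complex_of_real (x - y)) - 1)"
    by (simp add: norm_mult cis_conv_exp)
  also have "\<dots> = 2 * \<bar>sin ((x - y) / 2)\<bar>" by (rule dist_exp_i_1)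
  also have "\<dots> \<le> \<bar>x - y\<bar>" using abs_sin_x_le_abs_x[of "(x - y)/2"] by simp
  finally show ?thesis .
qed

section \<open>Szego's theorem\<close>

lemma mult_mat_index_sum:
  assumes "A \<in> carrier_mat n m" "B \<in> carrier_mat m p" "i < n" "j < p"
  shows "(A * B) $$ (i, j) = (\<Sum>k<m. A $$ (i, k) * B $$ (k, j))"
  using assms by (auto simp: scalar_prod_def atLeast0LessThan)

lemma mat_adjoint_carrier [simp]:
  "A \<in> carrier_mat n m \<Longrightarrow> mat_adjoint A \<in> carrier_mat m n"
  unfolding mat_adjoint_def by (intro carrier_matI) auto

lemma mat_adjoint_index:
  assumes "A \<in> carrier_mat n m" "i < m" "j < n"
  shows "mat_adjoint A $$ (i, j) = cnj (A $$ (j, i))"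
  using assms by (auto simp: mat_adjoint_def mat_of_rows_def)

lemma unitary_mat_rows_cols:
  assumes "unitary_mat n W" "a < n" "b < n"
  shows "(\<Sum>i<n. W $$ (a, i) * cnj (W $$ (b, i))) = (if a = b then 1 else 0)"
    and "(\<Sum>i<n. cnj (W $$ (i, a)) * W $$ (i, b)) = (if a = b then 1 else 0)"
proof -
  have W: "W \<in> carrier_mat n n" using assms by (simp add: unitary_mat_def)
  have "(W * mat_adjoint W) $$ (a, b) = (if a = b then 1 else 0)"
    "(mat_adjoint W * W) $$ (a, b) = (if a = b then 1 else 0)"
    using assms by (auto simp: unitary_mat_def)
  then show "(\<Sum>i<n. W $$ (a, i) * cnj (W $$ (b, i))) = (if a = b then 1 else 0)"
    "(\<Sum>i<n. cnj (W $$ (i, a)) * W $$ (i, b)) = (if a = b then 1 else 0)"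
    using assms W by (simp_all add: mult_mat_index_sum[where n=n and m=n and p=n] mat_adjoint_index[OF W])
qed

lemma eigenvalue_decomposition_entry:
  assumes "eigenvalue_decomposition n S W l" "a < n" "b < n"
  shows "S $$ (a, b) = (\<Sum>i<n. l i * W $$ (a, i) * cnj (W $$ (b, i)))"
proof -
  have W: "W \<in> carrier_mat n n" using assms by (simp add: eigenvalue_decomposition_def unitary_mat_def)
  have "S = W * mat_diag n (\<lambda>i. complex_of_real (l i)) * mat_adjoint W"
    using assms by (simp add: eigenvalue_decomposition_def)
  also have "W * mat_diag n (\<lambda>i. complex_of_real (l i)) = Matrix.mat n n (\<lambda>(i, j). W $$ (i, j) * complex_of_real (l j))"
    by (rule mat_diag_mult_right[OF W])
  finally show ?thesis
    using assms W by (simp add: mult_mat_index_sum[where n=n and m=n and p=n] mat_adjoint_index[OF W] mult_ac)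
qed

lemma eigenvalue_decomposition_left:
  assumes E: "eigenvalue_decomposition n S W l" and ib: "i < n" "b < n"
  shows "(\<Sum>a<n. cnj (W $$ (a, i)) * S $$ (a, b)) = l i * cnj (W $$ (b, i))"
proof -
  have U: "unitary_mat n W" using E by (simp add: eigenvalue_decomposition_def)
  have "(\<Sum>a<n. cnj (W $$ (a, i)) * S $$ (a, b)) = (\<Sum>a<n. \<Sum>j<n. l j * cnj (W $$ (b, j)) * (cnj (W $$ (a, i)) * W $$ (a, j)))"
    by (intro sum.cong refl) (simp add: eigenvalue_decomposition_entry[OF E _ ib(2)] sum_distrib_left mult_ac)
  also have "\<dots> = (\<Sum>j<n. l j * cnj (W $$ (b, j)) * (\<Sum>a<n. cnj (W $$ (a, i)) * W $$ (a, j)))"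
    unfolding sum_distrib_left by (rule sum.swap)
  also have "\<dots> = (\<Sum>j<n. if i = j then l i * cnj (W $$ (b, i)) else 0)"
    by (intro sum.cong refl) (auto simp: unitary_mat_rows_cols(2)[OF U ib(1)])
  finally show ?thesis using ib by simp
qed

lemma eigenvalue_eq_cform:
  assumes E: "eigenvalue_decomposition n S W l" and i: "i < n"
  shows "cform n S (\<lambda>a. W $$ (a, i)) = l i"
proof -
  have U: "unitary_mat n W" using E by (simp add: eigenvalue_decomposition_def)
  have "(\<Sum>a<n. \<Sum>b<n. cnj (W $$ (a, i)) * W $$ (b, i) * S $$ (a, b)) =
     (\<Sum>b<n. W $$ (b, i) * (\<Sum>a<n. cnj (W $$ (a, i)) * S $$ (a, b)))"
    unfolding sum_distrib_left by (subst sum.swap) (simp add: mult_ac)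
  also have "\<dots> = (\<Sum>b<n. l i * (cnj (W $$ (b, i)) * W $$ (b, i)))"
    by (intro sum.cong refl) (simp add: eigenvalue_decomposition_left[OF E i])
  also have "\<dots> = l i"
    using unitary_mat_rows_cols(2)[OF U i i] by (simp add: sum_distrib_left[symmetric])
  finally show ?thesis by (simp add: cform_def del: Re_sum)
qed

text \<open>An eigenvalue is the value of the covariance form at the corresponding column of W, a
  unit vector.\<close>

lemma toeplitz_eigenvalue_lower_bound:
  assumes s: "has_symbol \<sigma> s" and m: "AE \<omega> in period_measure. m \<le> s \<omega>"
    and E: "eigenvalue_decomposition n (toeplitz \<sigma> n) W l" and i: "i < n"
  shows "m \<le> l i"
proof -
  have U: "unitary_mat n W" using E by (simp add: eigenvalue_decomposition_def)
  have "complex_of_real (\<Sum>a<n. (cmod (W $$ (a, i)))\<^sup>2) = 1"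
    using unitary_mat_rows_cols(2)[OF U i i] by (simp only: of_real_sum complex_norm_square mult.commute) simp
  then have "(\<Sum>a<n. (cmod (W $$ (a, i)))\<^sup>2) = 1" by (simp only: of_real_eq_1_iff)
  then show ?thesis
    using toeplitz_form_lower_bound[OF s m, of "\<lambda>a. W $$ (a, i)" n] eigenvalue_eq_cform[OF E i] by simp
qed

lemma partial_symbol_lipschitz:
  "cmod (partial_symbol \<sigma> K x - partial_symbol \<sigma> K y) \<le> (\<Sum>k\<in>{- int K..int K}. cmod (\<sigma> k) * \<bar>of_int k\<bar>) * \<bar>x - y\<bar>"
proof -
  have "cmod (partial_symbol \<sigma> K x - partial_symbol \<sigma> K y) \<le>
    (\<Sum>k\<in>{- int K..int K}. cmod (\<sigma> k * cis (- (of_int k * x)) - \<sigma> k * cis (- (of_int k * y))))"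
    unfolding partial_symbol_def sum_subtractf[symmetric] by (rule norm_sum)
  also have "\<dots> \<le> (\<Sum>k\<in>{- int K..int K}. cmod (\<sigma> k) * (\<bar>of_int k\<bar> * \<bar>x - y\<bar>))"
  proof (rule sum_mono)
    fix k
    have "cmod (cis (- (of_int k * x)) - cis (- (of_int k * y))) \<le> \<bar>- (of_int k * x) - - (of_int k * y)\<bar>"
      by (rule cis_diff_le)
    also have "\<dots> = \<bar>of_int k\<bar> * \<bar>x - y\<bar>"
      by (simp add: abs_mult[symmetric] algebra_simps abs_minus_commute)
    finally show "cmod (\<sigma> k * cis (- (of_int k * x)) - \<sigma> k * cis (- (of_int k * y))) \<le> cmod (\<sigma> k) * (\<bar>of_int k\<bar> * \<bar>x - y\<bar>)"
      by (simp add: right_diff_distrib[symmetric] norm_mult mult_left_mono)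
  qed
  finally show ?thesis by (simp add: sum_distrib_right mult.assoc)
qed

text \<open>The partial symbols approach s only in mean square, so the Lipschitz bound is combined
  pointwise with \<open>abs_le_add_square_div\<close> before integration.\<close>

lemma lipschitz_integral_diff_le:
  assumes s: "has_symbol \<sigma> s" and sym: "\<And>i. \<sigma> (- i) = cnj (\<sigma> i)"
    and f: "\<And>x y. \<bar>f x - f y\<bar> \<le> L * \<bar>x - y\<bar>" and fb: "\<And>x. \<bar>f x\<bar> \<le> B" and L: "0 \<le> L" and \<epsilon>: "0 < \<epsilon>"
  shows "\<bar>(LINT \<omega>|period_measure. f (Re (partial_symbol \<sigma> K \<omega>))) - (LINT \<omega>|period_measure. f (s \<omega>))\<bar> \<le>
    L * (\<epsilon> * (2 * pi) + (LINT \<omega>|period_measure. (cmod (complex_of_real (s \<omega>) - partial_symbol \<sigma> K \<omega>))\<^sup>2) / \<epsilon>)"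
proof -
  interpret finite_measure period_measure by (rule finite_period_measure)
  have sm [measurable]: "s \<in> borel_measurable period_measure" and s2: "integrable period_measure (\<lambda>\<omega>. (s \<omega>)\<^sup>2)"
    using s unfolding has_symbol_def by blast+
  have contp: "continuous_on {0..2 * pi} (partial_symbol \<sigma> K)"
    unfolding partial_symbol_def cis_conv_exp by (intro continuous_intros)
  have [measurable]: "partial_symbol \<sigma> K \<in> borel_measurable period_measure"
    by (rule measurable_period_measure[OF contp])
  have "continuous_on UNIV f"
  proof (rule lipschitz_on_continuous_on)
    show "L-lipschitz_on UNIV f" using f L by (intro lipschitz_onI) (auto simp: dist_real_def)
  qed
  then have [measurable]: "f \<in> borel_measurable borel" by (rule borel_measurable_continuous_onI)
  have i1: "integrable period_measure (\<lambda>\<omega>. f (Re (partial_symbol \<sigma> K \<omega>)))" "integrable period_measure (\<lambda>\<omega>. f (s \<omega>))"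
    by (rule integrable_const_bound[where B=B]; use fb in simp)+
  have p2: "integrable period_measure (\<lambda>\<omega>. (cmod (partial_symbol \<sigma> K \<omega>))\<^sup>2)"
    by (rule continuous_imp_integrable_real) (intro continuous_intros contp)
  have e: "integrable period_measure (\<lambda>\<omega>. (cmod (complex_of_real (s \<omega>) - partial_symbol \<sigma> K \<omega>))\<^sup>2)"
  proof (rule Bochner_Integration.integrable_bound)
    show "integrable period_measure (\<lambda>\<omega>. 2 * (s \<omega>)\<^sup>2 + 2 * (cmod (partial_symbol \<sigma> K \<omega>))\<^sup>2)"
      using s2 p2 by auto
    have "(cmod (complex_of_real a - z))\<^sup>2 \<le> 2 * a\<^sup>2 + 2 * (cmod z)\<^sup>2" for a z
    proof -
      have "(cmod (complex_of_real a - z))\<^sup>2 \<le> (\<bar>a\<bar> + cmod z)\<^sup>2"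
        using norm_triangle_ineq4[of "complex_of_real a" z] by (intro power_mono) auto
      also have "\<dots> \<le> 2 * a\<^sup>2 + 2 * (cmod z)\<^sup>2"
        using sum_squares_bound[of "\<bar>a\<bar>" "cmod z"] by (simp add: power2_sum)
      finally show ?thesis .
    qed
    then show "AE \<omega> in period_measure. norm ((cmod (complex_of_real (s \<omega>) - partial_symbol \<sigma> K \<omega>))\<^sup>2) \<le> norm (2 * (s \<omega>)\<^sup>2 + 2 * (cmod (partial_symbol \<sigma> K \<omega>))\<^sup>2)"
      by (intro AE_I2) (simp add: abs_of_nonneg)
  qed measurable
  have pt: "\<bar>f (Re (partial_symbol \<sigma> K \<omega>)) - f (s \<omega>)\<bar> \<le> L * \<epsilon> + L / \<epsilon> * (cmod (complex_of_real (s \<omega>) - partial_symbol \<sigma> K \<omega>))\<^sup>2" for \<omega>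
  proof -
    \<comment> \<open>Conjugate symmetry makes the partial symbol real, so the complex error is
      exactly the error of its real part.\<close>
    have "complex_of_real (s \<omega>) - partial_symbol \<sigma> K \<omega> = complex_of_real (s \<omega> - Re (partial_symbol \<sigma> K \<omega>))"
      by (subst partial_symbol_real[of \<sigma>, OF sym]) simp
    then have c: "(cmod (complex_of_real (s \<omega>) - partial_symbol \<sigma> K \<omega>))\<^sup>2 = (Re (partial_symbol \<sigma> K \<omega>) - s \<omega>)\<^sup>2"
      by (simp only: norm_of_real power2_abs power2_commute)
    have "\<bar>f (Re (partial_symbol \<sigma> K \<omega>)) - f (s \<omega>)\<bar> \<le> L * \<bar>Re (partial_symbol \<sigma> K \<omega>) - s \<omega>\<bar>" by (rule f)
    also have "\<dots> \<le> L * (\<epsilon> + (Re (partial_symbol \<sigma> K \<omega>) - s \<omega>)\<^sup>2 / \<epsilon>)"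
      by (intro mult_left_mono abs_le_add_square_div \<epsilon> L)
    finally show ?thesis unfolding c by (simp add: distrib_left)
  qed
  have "\<bar>(LINT \<omega>|period_measure. f (Re (partial_symbol \<sigma> K \<omega>))) - (LINT \<omega>|period_measure. f (s \<omega>))\<bar>
    = \<bar>LINT \<omega>|period_measure. f (Re (partial_symbol \<sigma> K \<omega>)) - f (s \<omega>)\<bar>"
    using i1 by simp
  also have "\<dots> \<le> (LINT \<omega>|period_measure. \<bar>f (Re (partial_symbol \<sigma> K \<omega>)) - f (s \<omega>)\<bar>)"
    by (rule integral_abs_bound)
  also have "\<dots> \<le> (LINT \<omega>|period_measure. L * \<epsilon> + L / \<epsilon> * (cmod (complex_of_real (s \<omega>) - partial_symbol \<sigma> K \<omega>))\<^sup>2)"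
    by (rule integral_mono) (use pt i1 e in auto)
  also have "\<dots> = L * \<epsilon> * (2 * pi) + L / \<epsilon> * (LINT \<omega>|period_measure. (cmod (complex_of_real (s \<omega>) - partial_symbol \<sigma> K \<omega>))\<^sup>2)"
    using e measure_period_measure by (subst Bochner_Integration.integral_add) auto
  finally show ?thesis by (simp add: algebra_simps)
qed

text \<open>Three comparisons are chained: Toeplitz with circulant eigenvalues, the mean of the
  circulant eigenvalues with the integral for the truncated symbol, and that integral with the one
  for s. The first and the third contribute L \<epsilon> each. Only the last summand depends on n,
  and it vanishes for fixed K and \<epsilon>.\<close>

lemma szego_error_bound:
  assumes sym: "\<And>i. \<sigma> (- i) = cnj (\<sigma> i)" and sm: "summable (\<lambda>i. (cmod (\<sigma> (int i)))\<^sup>2)"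
    and s: "has_symbol \<sigma> s" and E: "eigenvalue_decomposition n (toeplitz \<sigma> n) W l"
    and f: "\<And>x y. \<bar>f x - f y\<bar> \<le> L * \<bar>x - y\<bar>" and fb: "\<And>x. \<bar>f x\<bar> \<le> B" and L: "0 \<le> L" and \<epsilon>: "0 < \<epsilon>"
    and n: "2 * K < n"
  shows "\<bar>(\<Sum>i<n. f (l i)) / n - (LINT \<omega>|period_measure. f (s \<omega>)) / (2 * pi)\<bar> \<le>
    2 * L * \<epsilon> + 4 * L / \<epsilon> * (\<Sum>i. (cmod (\<sigma> (int (i + Suc K))))\<^sup>2)
    + L / (2 * pi * \<epsilon>) * (LINT \<omega>|period_measure. (cmod (complex_of_real (s \<omega>) - partial_symbol \<sigma> K \<omega>))\<^sup>2)
    + (4 * L / \<epsilon> * K\<^sup>2 * (\<Sum>k\<in>{- int K..int K}. cmod (\<sigma> k))\<^sup>2 + 2 * pi * L * (\<Sum>k\<in>{- int K..int K}. cmod (\<sigma> k) * \<bar>of_int k\<bar>)) / n"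
proof -
  have n0: "0 < n" using n by simp
  have U: "unitary_mat n W" using E by (simp add: eigenvalue_decomposition_def)
  define \<tau> where "\<tau> = (\<Sum>i. (cmod (\<sigma> (int (i + Suc K))))\<^sup>2)"
  define C where "C = (\<Sum>k\<in>{- int K..int K}. cmod (\<sigma> k))"
  define D where "D = (\<Sum>k\<in>{- int K..int K}. cmod (\<sigma> k) * \<bar>of_int k\<bar> :: real)"
  define e where "e = (LINT \<omega>|period_measure. (cmod (complex_of_real (s \<omega>) - partial_symbol \<sigma> K \<omega>))\<^sup>2)"
  define \<mu> where "\<mu> j = Re (partial_symbol \<sigma> K (2 * pi * real j / real n))" for j
  have "\<bar>(\<Sum>i<n. f (l i)) - (\<Sum>j<n. f (\<mu> j))\<bar> \<le>
     L * (\<epsilon> * n + (\<Sum>a<n. \<Sum>b<n. (cmod (\<sigma> (int a - int b) - circulant \<sigma> K n a b))\<^sup>2) / \<epsilon>)"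
  proof (rule spectral_sum_diff_le[where f=f and w="\<lambda>i a. W $$ (a, i)" and v="fourier_vec n", OF _ _ _ _ _ _ f L \<epsilon>])
    show "(\<Sum>a<n. cnj (W $$ (a, i)) * \<sigma> (int a - int b)) = l i * cnj (W $$ (b, i))" if "i < n" "b < n" for i b
      using eigenvalue_decomposition_left[OF E that] that by (simp add: toeplitz_def)
    show "(\<Sum>b<n. circulant \<sigma> K n a b * fourier_vec n j b) = \<mu> j * fourier_vec n j a" if "j < n" "a < n" for j a
      unfolding circulant_eigenvector[OF n0 that(1)] \<mu>_def using partial_symbol_real[of \<sigma>, OF sym] by simp
  qed (use unitary_mat_rows_cols[OF U] fourier_vec_orthonormal[OF n0] in \<open>auto simp: hdot_def\<close>)
  also have "\<dots> \<le> L * (\<epsilon> * n + (4 * n * \<tau> + 4 * K\<^sup>2 * C\<^sup>2) / \<epsilon>)"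
    using toeplitz_circulant_frobenius_bound[of \<sigma>, OF sym sm n C_def] \<epsilon> L
    by (intro mult_left_mono add_left_mono divide_right_mono) (auto simp: \<tau>_def)
  finally have 1: "\<bar>(\<Sum>i<n. f (l i)) - (\<Sum>j<n. f (\<mu> j))\<bar> / n \<le> L * (\<epsilon> * n + (4 * n * \<tau> + 4 * K\<^sup>2 * C\<^sup>2) / \<epsilon>) / n"
    by (rule divide_right_mono) simp
  have 2: "\<bar>(\<Sum>j<n. f (\<mu> j)) / n - (LINT \<omega>|period_measure. f (Re (partial_symbol \<sigma> K \<omega>))) / (2 * pi)\<bar> \<le> 2 * pi * (L * D) / n"
    unfolding \<mu>_def
  proof (rule riemann_sum_error[OF _ n0])
    fix x y
    have "\<bar>f (Re (partial_symbol \<sigma> K x)) - f (Re (partial_symbol \<sigma> K y))\<bar> \<le> L * \<bar>Re (partial_symbol \<sigma> K x) - Re (partial_symbol \<sigma> K y)\<bar>"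
      by (rule f)
    also have "\<dots> \<le> L * (D * \<bar>x - y\<bar>)"
      using partial_symbol_lipschitz[of \<sigma> K x y] abs_Re_le_cmod[of "partial_symbol \<sigma> K x - partial_symbol \<sigma> K y"] L
      by (intro mult_left_mono) (auto simp: D_def)
    finally show "\<bar>f (Re (partial_symbol \<sigma> K x)) - f (Re (partial_symbol \<sigma> K y))\<bar> \<le> L * D * \<bar>x - y\<bar>" by (simp add: mult.assoc)
  qed
  have "\<bar>(LINT \<omega>|period_measure. f (Re (partial_symbol \<sigma> K \<omega>))) - (LINT \<omega>|period_measure. f (s \<omega>))\<bar> / (2 * pi) \<le> L * (\<epsilon> * (2 * pi) + e / \<epsilon>) / (2 * pi)"
    unfolding e_def by (intro divide_right_mono lipschitz_integral_diff_le[where \<sigma>=\<sigma> and f=f, OF s sym f fb L \<epsilon>]) simp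
  then have 3: "\<bar>(LINT \<omega>|period_measure. f (Re (partial_symbol \<sigma> K \<omega>))) / (2 * pi) - (LINT \<omega>|period_measure. f (s \<omega>)) / (2 * pi)\<bar> \<le> L * (\<epsilon> * (2 * pi) + e / \<epsilon>) / (2 * pi)"
    by (simp add: diff_divide_distrib[symmetric] abs_divide)
  have b1: "\<bar>(\<Sum>i<n. f (l i)) / n - (\<Sum>j<n. f (\<mu> j)) / n\<bar> \<le> L * (\<epsilon> * n + (4 * n * \<tau> + 4 * K\<^sup>2 * C\<^sup>2) / \<epsilon>) / n"
    using 1 by (simp add: diff_divide_distrib[symmetric] abs_divide)
  have "\<bar>(\<Sum>i<n. f (l i)) / n - (LINT \<omega>|period_measure. f (s \<omega>)) / (2 * pi)\<bar> \<le>
     L * (\<epsilon> * n + (4 * n * \<tau> + 4 * K\<^sup>2 * C\<^sup>2) / \<epsilon>) / n + 2 * pi * (L * D) / n + L * (\<epsilon> * (2 * pi) + e / \<epsilon>) / (2 * pi)"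
    using b1 2 3 by linarith
  also have "\<dots> = 2 * L * \<epsilon> + 4 * L / \<epsilon> * \<tau> + L / (2 * pi * \<epsilon>) * e + (4 * L / \<epsilon> * K\<^sup>2 * C\<^sup>2 + 2 * pi * L * D) / n"
    using n0 \<epsilon> by (simp add: field_simps)
  finally show ?thesis unfolding \<tau>_def C_def D_def e_def .
qed

text \<open>The parameters are fixed in the order \<epsilon>, K, n: the coefficient tail and the
  mean-square error are divided by \<epsilon>, and the corner and Riemann terms depend on K.\<close>

theorem szego_lipschitz:
  assumes sym: "\<And>i. \<sigma> (- i) = cnj (\<sigma> i)" and sm: "summable (\<lambda>i. (cmod (\<sigma> (int i)))\<^sup>2)"
    and s: "has_symbol \<sigma> s" and E: "\<And>n. 0 < n \<Longrightarrow> eigenvalue_decomposition n (toeplitz \<sigma> n) (W n) (l n)"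
    and f: "\<And>x y. \<bar>f x - f y\<bar> \<le> L * \<bar>x - y\<bar>" and fb: "\<And>x. \<bar>f x\<bar> \<le> B" and L: "0 < L"
  shows "(\<lambda>n. (\<Sum>i<n. f (l n i)) / real n) \<longlonglongrightarrow> (LINT \<omega>|period_measure. f (s \<omega>)) / (2 * pi)"
proof (rule LIMSEQ_I)
  fix r :: real assume r: "0 < r"
  \<comment> \<open>Makes the term 2 L \<epsilon> equal to r / 4; each of the other three terms gets
    a quarter as well.\<close>
  define \<epsilon> where "\<epsilon> = r / (8 * L)"
  have \<epsilon>: "0 < \<epsilon>" using r L by (simp add: \<epsilon>_def)
  define \<tau> where "\<tau> K = (\<Sum>i. (cmod (\<sigma> (int (i + Suc K))))\<^sup>2)" for K
  define e where "e K = (LINT \<omega>|period_measure. (cmod (complex_of_real (s \<omega>) - partial_symbol \<sigma> K \<omega>))\<^sup>2)" for K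
  have "e \<longlonglongrightarrow> 0" using s unfolding has_symbol_def e_def partial_symbol_def by blast
  then have "(\<lambda>K. L / (2 * pi * \<epsilon>) * e K) \<longlonglongrightarrow> L / (2 * pi * \<epsilon>) * 0" by (intro tendsto_intros)
  from order_tendstoD(2)[OF this, of "r / 4"] have ev1: "eventually (\<lambda>K. L / (2 * pi * \<epsilon>) * e K < r / 4) sequentially"
    using r by simp
  have "(\<lambda>K. \<Sum>i. (cmod (\<sigma> (int (i + K))))\<^sup>2) \<longlonglongrightarrow> 0"
    by (rule suminf_exist_split2[OF sm])
  then have "\<tau> \<longlonglongrightarrow> 0" unfolding \<tau>_def by (rule LIMSEQ_Suc)
  then have "(\<lambda>K. 4 * L / \<epsilon> * \<tau> K) \<longlonglongrightarrow> 4 * L / \<epsilon> * 0" by (intro tendsto_intros)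
  from order_tendstoD(2)[OF this, of "r / 4"] have "eventually (\<lambda>K. 4 * L / \<epsilon> * \<tau> K < r / 4) sequentially"
    using r by simp
  with ev1 have "eventually (\<lambda>K. L / (2 * pi * \<epsilon>) * e K < r / 4 \<and> 4 * L / \<epsilon> * \<tau> K < r / 4) sequentially"
    by (rule eventually_conj)
  then obtain K where K: "L / (2 * pi * \<epsilon>) * e K < r / 4" "4 * L / \<epsilon> * \<tau> K < r / 4"
    unfolding eventually_sequentially by blast
  define A where "A = 4 * L / \<epsilon> * K\<^sup>2 * (\<Sum>k\<in>{- int K..int K}. cmod (\<sigma> k))\<^sup>2 + 2 * pi * L * (\<Sum>k\<in>{- int K..int K}. cmod (\<sigma> k) * \<bar>of_int k\<bar>)"
  have "(\<lambda>n. A / real n) \<longlonglongrightarrow> 0" by (rule lim_const_over_n)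
  then have "eventually (\<lambda>n. A / real n < r / 4) sequentially"
    using r by (intro order_tendstoD(2)) auto
  then obtain N where N: "\<And>n. n \<ge> N \<Longrightarrow> A / real n < r / 4" unfolding eventually_sequentially by blast
  have "norm ((\<Sum>i<n. f (l n i)) / real n - (LINT \<omega>|period_measure. f (s \<omega>)) / (2 * pi)) < r"
    if n: "n \<ge> max N (Suc (2 * K))" for n
  proof -
    have "\<bar>(\<Sum>i<n. f (l n i)) / real n - (LINT \<omega>|period_measure. f (s \<omega>)) / (2 * pi)\<bar> \<le>
      2 * L * \<epsilon> + 4 * L / \<epsilon> * \<tau> K + L / (2 * pi * \<epsilon>) * e K + A / real n"
      unfolding A_def \<tau>_def e_def
      by (rule szego_error_bound[where \<sigma>=\<sigma> and f=f, OF sym sm s E f fb less_imp_le[OF L] \<epsilon>]) (use n in auto)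
    also have "2 * L * \<epsilon> = r / 4" using L by (simp add: \<epsilon>_def)
    finally have "\<bar>(\<Sum>i<n. f (l n i)) / real n - (LINT \<omega>|period_measure. f (s \<omega>)) / (2 * pi)\<bar> \<le>
      r / 4 + 4 * L / \<epsilon> * \<tau> K + L / (2 * pi * \<epsilon>) * e K + A / real n" .
    moreover have "A / real n < r / 4" using N n by simp
    ultimately show ?thesis using K unfolding real_norm_def by linarith
  qed
  then show "\<exists>no. \<forall>n\<ge>no. norm ((\<Sum>i<n. f (l n i)) / real n - (LINT \<omega>|period_measure. f (s \<omega>)) / (2 * pi)) < r" by blast
qed

text \<open>The function 1 / sqrt truncated at m agrees with 1 / sqrt at all eigenvalues and at
  almost all values of the symbol, since these are at least m.\<close>

corollary szego_inverse_sqrt: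
  assumes sym: "\<And>i. \<sigma> (- i) = cnj (\<sigma> i)" and sm: "summable (\<lambda>i. (cmod (\<sigma> (int i)))\<^sup>2)"
    and s: "has_symbol \<sigma> s" and E: "\<And>n. 0 < n \<Longrightarrow> eigenvalue_decomposition n (toeplitz \<sigma> n) (W n) (l n)"
    and m: "0 < m" "AE \<omega> in period_measure. m \<le> s \<omega>"
  shows "(\<lambda>n. (\<Sum>i<n. l n i powr (-1/2)) / real n) \<longlonglongrightarrow> 1 / (2 * pi) * (LINT \<omega>|period_measure. 1 / sqrt (s \<omega>))"
proof -
  let ?f = "\<lambda>x. 1 / sqrt (max x m)"
  have [measurable]: "s \<in> borel_measurable period_measure" using s unfolding has_symbol_def by blast
  have "(\<lambda>n. (\<Sum>i<n. ?f (l n i)) / real n) \<longlonglongrightarrow> (LINT \<omega>|period_measure. ?f (s \<omega>)) / (2 * pi)"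
  proof (rule szego_lipschitz[where \<sigma>=\<sigma> and f="?f", OF sym sm s E])
    show "\<bar>?f x - ?f y\<bar> \<le> 1 / (2 * m * sqrt m) * \<bar>x - y\<bar>" for x y by (rule inverse_sqrt_max_lipschitz[OF m(1)])
    show "\<bar>?f x\<bar> \<le> 1 / sqrt m" for x using m(1) by (auto intro!: divide_left_mono simp: abs_of_pos)
  qed (use m in auto)
  moreover have "(\<Sum>i<n. ?f (l n i)) = (\<Sum>i<n. l n i powr (-1/2))" for n
  proof (intro sum.cong refl)
    fix i assume "i \<in> {..<n}"
    then have "m \<le> l n i" using toeplitz_eigenvalue_lower_bound[OF s m(2) E, of n i] by auto
    then show "?f (l n i) = l n i powr (-1/2)"
      using m(1) by (simp add: powr_minus_divide powr_half_sqrt max_def)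
  qed
  moreover have "(LINT \<omega>|period_measure. ?f (s \<omega>)) = (LINT \<omega>|period_measure. 1 / sqrt (s \<omega>))"
    by (rule integral_cong_AE) (use m(2) in \<open>auto elim!: eventually_mono simp: max_def\<close>)
  ultimately show ?thesis by simp
qed

section \<open>The precoder\<close>

lemma dft_mat_eq_fourier_vec:
  assumes "i < N" "j < N"
  shows "dft_mat N $$ (i, j) = cnj (fourier_vec N i j)"
proof -
  have "cis (- (2 * pi * real i * real j / real N)) = exp (- (2 * complex_of_real pi * \<i> * of_nat i * of_nat j / of_nat N))"
    unfolding cis_conv_exp by (simp add: mult_ac)
  then show ?thesis using assms by (simp add: dft_mat_def fourier_vec_def cis_cnj)
qed

text \<open>The third fact, constant modulus of the entries, makes the residual variance of a column
  independent of its index.\<close>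

lemma dft_mat_orthonormal:
  assumes N: "0 < N" and ab: "a < N" "b < N"
  shows "(\<Sum>i<N. cnj (dft_mat N $$ (i, a)) * dft_mat N $$ (i, b)) = (if a = b then 1 else 0)"
    and "(\<Sum>j<N. dft_mat N $$ (a, j) * cnj (dft_mat N $$ (b, j))) = (if a = b then 1 else 0)"
    and "cnj (dft_mat N $$ (a, b)) * dft_mat N $$ (a, b) = 1 / of_nat N"
proof -
  show "(\<Sum>i<N. cnj (dft_mat N $$ (i, a)) * dft_mat N $$ (i, b)) = (if a = b then 1 else 0)"
    using fourier_vec_orthonormal(1)[OF N ab] ab by (simp add: dft_mat_eq_fourier_vec)
  show "(\<Sum>j<N. dft_mat N $$ (a, j) * cnj (dft_mat N $$ (b, j))) = (if a = b then 1 else 0)"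
    using fourier_vec_orthonormal(2)[OF N ab] ab by (simp add: dft_mat_eq_fourier_vec hdot_def)
  have "fourier_vec N a b * cnj (fourier_vec N a b) = complex_of_real ((cmod (fourier_vec N a b))\<^sup>2)"
    by (simp only: complex_norm_square)
  also have "cmod (fourier_vec N a b) = 1 / sqrt (real N)"
    by (simp add: fourier_vec_def norm_divide)
  finally show "cnj (dft_mat N $$ (a, b)) * dft_mat N $$ (a, b) = 1 / of_nat N"
    using ab by (simp add: dft_mat_eq_fourier_vec power_divide)
qed

lemma precoder_entry:
  assumes W: "W \<in> carrier_mat N N" and "b < N" "j < N"
  shows "precoder N W l $$ (b, j) = (\<Sum>i<N. W $$ (b, i) *
    (complex_of_real (1 / sqrt (\<Sum>i<N. l i powr (-1/2)) * l i powr (-1/4)) * dft_mat N $$ (i, j)))"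
proof -
  have D: "dft_mat N \<in> carrier_mat N N" by (simp add: dft_mat_def)
  have WD: "W * mat_diag N (\<lambda>i. complex_of_real (l i powr (-1/4))) = Matrix.mat N N (\<lambda>(i, j). W $$ (i, j) * complex_of_real (l j powr (-1/4)))"
    by (rule mat_diag_mult_right[OF W])
  have c: "Matrix.mat N N (\<lambda>(i, j). W $$ (i, j) * complex_of_real (l j powr (-1/4))) * dft_mat N \<in> carrier_mat N N"
    using D by (intro mult_carrier_mat) auto
  have "precoder N W l $$ (b, j) = complex_of_real (1 / sqrt (\<Sum>i<N. l i powr (-1/2))) *
    ((Matrix.mat N N (\<lambda>(i, j). W $$ (i, j) * complex_of_real (l j powr (-1/4))) * dft_mat N) $$ (b, j))"
    unfolding precoder_def WD using c assms by (subst index_smult_mat) auto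
  also have "(Matrix.mat N N (\<lambda>(i, j). W $$ (i, j) * complex_of_real (l j powr (-1/4))) * dft_mat N) $$ (b, j) =
    (\<Sum>i<N. W $$ (b, i) * complex_of_real (l i powr (-1/4)) * dft_mat N $$ (i, j))"
    using assms D by (subst mult_mat_index_sum[where n=N and m=N and p=N]) auto
  finally show ?thesis by (simp only: sum_distrib_left of_real_mult mult_ac)
qed

lemma precoder_carrier: "W \<in> carrier_mat N N \<Longrightarrow> precoder N W l \<in> carrier_mat N N"
  unfolding precoder_def dft_mat_def by (intro smult_carrier_mat mult_carrier_mat) auto

text \<open>The matrix inverted in the SNR is the Gram matrix of H F; k - 1 is the 0-based column
  index.\<close>

lemma snr_eq_col_dist2:
  assumes H: "H \<in> carrier_mat n N" and F: "F \<in> carrier_mat N N" and k: "1 \<le> k" "k \<le> N" and n: "N \<le> n"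
    and ind: "cols_indep n N (\<lambda>m j. \<Sum>b<N. H $$ (m, b) * F $$ (b, j))"
  shows "snr nv F H k = 1 / complex_of_real nv * col_dist2 n N (k - 1) (\<lambda>m j. \<Sum>b<N. H $$ (m, b) * F $$ (b, j))"
proof -
  have HF: "H * F \<in> carrier_mat n N" using H F by simp
  have Ha: "mat_adjoint H \<in> carrier_mat N n" using H by simp
  have Fa: "mat_adjoint F \<in> carrier_mat N N" using F by simp
  have FH: "mat_adjoint F * mat_adjoint H \<in> carrier_mat N n" using Fa Ha by simp
  have "mat_adjoint F * mat_adjoint H * H * F = (mat_adjoint F * mat_adjoint H) * (H * F)"
    using FH H F by (rule assoc_mult_mat)
  also have "\<dots> = gram_mat n N (\<lambda>m j. \<Sum>b<N. H $$ (m, b) * F $$ (b, j))"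
  proof (rule eq_matI)
    fix i j assume "i < dim_row (gram_mat n N (\<lambda>m j. \<Sum>b<N. H $$ (m, b) * F $$ (b, j)))"
      "j < dim_col (gram_mat n N (\<lambda>m j. \<Sum>b<N. H $$ (m, b) * F $$ (b, j)))"
    then have ij: "i < N" "j < N" by (auto simp: gram_mat_def)
    have 1: "(mat_adjoint F * mat_adjoint H) $$ (i, m) = cnj (\<Sum>b<N. H $$ (m, b) * F $$ (b, i))" if m: "m < n" for m
      by (subst mult_mat_index_sum[OF Fa Ha ij(1) m])
         (simp add: mat_adjoint_index[OF F] mat_adjoint_index[OF H] ij m mult.commute)
    have 2: "(H * F) $$ (m, j) = (\<Sum>b<N. H $$ (m, b) * F $$ (b, j))" if "m < n" for m
      by (rule mult_mat_index_sum[OF H F that ij(2)])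
    show "(mat_adjoint F * mat_adjoint H * (H * F)) $$ (i, j) = gram_mat n N (\<lambda>m j. \<Sum>b<N. H $$ (m, b) * F $$ (b, j)) $$ (i, j)"
      unfolding mult_mat_index_sum[OF FH HF ij] gram_mat_def using ij by (simp add: 1 2)
  qed (use FH HF in \<open>auto simp: gram_mat_def\<close>)
  finally have G: "mat_adjoint F * mat_adjoint H * H * F = gram_mat n N (\<lambda>m j. \<Sum>b<N. H $$ (m, b) * F $$ (b, j))" .
  have "1 / (the (mat_inverse (gram_mat n N (\<lambda>m j. \<Sum>b<N. H $$ (m, b) * F $$ (b, j)))) $$ (k - 1, k - 1)) =
    col_dist2 n N (k - 1) (\<lambda>m j. \<Sum>b<N. H $$ (m, b) * F $$ (b, j))"
    using k n by (intro mat_inverse_gram_diag[OF ind]) auto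
  from this[symmetric] show ?thesis unfolding snr_def G by simp
qed

text \<open>A real m is chosen strictly between 0 and the essential infimum, which is an extended
  real.\<close>

lemma essinf_pos_lower_bound:
  assumes "essinf M s > 0"
  obtains m where "0 < m" "AE x in M. m \<le> s x"
proof -
  obtain m where m: "0 < ereal m" "ereal m < essinf M s"
    using ereal_dense2[OF assms] by auto
  have "AE x in M. - ereal (s x) \<le> esssup M (\<lambda>x. - ereal (s x))" by (rule esssup_AE)
  then have "AE x in M. m \<le> s x"
  proof (rule eventually_mono)
    fix x assume "- ereal (s x) \<le> esssup M (\<lambda>x. - ereal (s x))"
    then have "essinf M s \<le> ereal (s x)" unfolding essinf_def by (simp add: ereal_uminus_le_reorder)
    with m(2) have "ereal m < ereal (s x)" by (rule less_le_trans)
    then show "m \<le> s x" by simp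
  qed
  with m show thesis by (intro that[of m]) auto
qed

text \<open>\<open>p\<close> is the direction with \<open>H p\<close> equal to the residual of column \<open>k\<close> of \<open>H F\<close> after regression
  on the other columns; explicitly \<open>p = (\<nu> / c) W \<Lambda>\<^sup>-\<^sup>3\<^sup>/\<^sup>4 V e\<^sub>k\<close> where \<open>c\<close> is the normalisation of the precoder.\<close>

lemma precoder_residual_direction:
  assumes E: "eigenvalue_decomposition N S W l" and l: "\<And>i. i < N \<Longrightarrow> 0 < l i" and k: "k < N"
  defines "T \<equiv> \<Sum>i<N. l i powr (-1/2)"
  defines "F \<equiv> \<lambda>b j. precoder N W l $$ (b, j)"
  obtains p w where "\<And>j. j < N \<Longrightarrow> j \<noteq> k \<Longrightarrow> (\<Sum>a<N. \<Sum>b<N. cnj (p a) * F b j * S $$ (a, b)) = 0"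
    and "cform N S p = real N / T\<^sup>2" and "w k = 1" and "\<And>b. b < N \<Longrightarrow> p b = (\<Sum>j<N. F b j * w j)"
proof -
  have N: "0 < N" using k by simp
  have U: "unitary_mat N W" using E by (simp add: eigenvalue_decomposition_def)
  then have Wc: "W \<in> carrier_mat N N" by (simp add: unitary_mat_def)
  have T: "0 < T" unfolding T_def by (intro sum_pos) (use N in \<open>auto dest: l\<close>)
  let ?V = "\<lambda>i j. dft_mat N $$ (i, j)"
  define c where "c = 1 / sqrt T"
  define \<nu> where "\<nu> = real N / T\<^sup>2"
  have c: "0 < c" "c\<^sup>2 = 1 / T" using T by (auto simp: c_def power_divide)
  have \<nu>: "0 < \<nu>" using T N by (simp add: \<nu>_def)
  define X where "X i j = complex_of_real (c * l i powr (-1/4)) * ?V i j" for i j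
  define y where "y i = complex_of_real (\<nu> / c * l i powr (-3/4)) * ?V i k" for i
  \<comment> \<open>With D the diagonal matrix of eigenvalues, F^H S F = c^2 V^H D^(1/2) V. The
    vector w is \<nu> times column k of its inverse, and \<nu> is the reciprocal of the diagonal
    entry there, so that w k = 1.\<close>
  define w where "w j = complex_of_real (\<nu> / c\<^sup>2) * (\<Sum>h<N. cnj (?V h j) * (complex_of_real (l h powr (-1/2)) * ?V h k))" for j
  define p where "p b = (\<Sum>i<N. W $$ (b, i) * y i)" for b
  have F: "F b j = (\<Sum>i<N. W $$ (b, i) * X i j)" if "b < N" "j < N" for b j
    unfolding F_def precoder_entry[OF Wc that] X_def c_def T_def ..
  have WHW: "(\<Sum>b<N. cnj (W $$ (b, i)) * (\<Sum>h<N. W $$ (b, h) * x h)) = x i" if i: "i < N" for i x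
  proof -
    have "(\<Sum>b<N. cnj (W $$ (b, i)) * (\<Sum>h<N. W $$ (b, h) * x h)) = (\<Sum>h<N. (\<Sum>b<N. cnj (W $$ (b, i)) * W $$ (b, h)) * x h)"
      unfolding sum_distrib_left sum_distrib_right by (subst sum.swap) (simp add: mult.assoc)
    also have "\<dots> = (\<Sum>h<N. if i = h then x i else 0)"
      by (intro sum.cong refl) (auto simp: unitary_mat_rows_cols(2)[OF U i])
    finally show ?thesis using i by simp
  qed
  \<comment> \<open>In the eigenbasis the covariance form is diagonal.\<close>
  have form: "(\<Sum>a<N. \<Sum>b<N. cnj (p a) * (\<Sum>h<N. W $$ (b, h) * x h) * S $$ (a, b)) = (\<Sum>i<N. l i * cnj (y i) * x i)" for x
  proof -
    have "(\<Sum>a<N. \<Sum>b<N. cnj (p a) * (\<Sum>h<N. W $$ (b, h) * x h) * S $$ (a, b)) =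
      (\<Sum>b<N. (\<Sum>a<N. cnj (p a) * S $$ (a, b)) * (\<Sum>h<N. W $$ (b, h) * x h))"
      unfolding sum_distrib_right[of _ _ "\<Sum>h<N. _ h * x h"] by (subst sum.swap) (simp add: mult_ac)
    also have "\<dots> = (\<Sum>b<N. (\<Sum>i<N. l i * cnj (y i) * cnj (W $$ (b, i))) * (\<Sum>h<N. W $$ (b, h) * x h))"
    proof -
      have "(\<Sum>a<N. cnj (p a) * S $$ (a, b)) = (\<Sum>i<N. l i * cnj (y i) * cnj (W $$ (b, i)))" if b: "b < N" for b
      proof -
        have "(\<Sum>a<N. cnj (p a) * S $$ (a, b)) = (\<Sum>i<N. cnj (y i) * (\<Sum>a<N. cnj (W $$ (a, i)) * S $$ (a, b)))"
          unfolding p_def cnj_sum sum_distrib_left sum_distrib_right by (subst sum.swap) (simp add: mult_ac)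
        also have "\<dots> = (\<Sum>i<N. l i * cnj (y i) * cnj (W $$ (b, i)))"
          by (intro sum.cong refl) (simp add: eigenvalue_decomposition_left[OF E _ b])
        finally show ?thesis .
      qed
      then show ?thesis by simp
    qed
    also have "\<dots> = (\<Sum>i<N. l i * cnj (y i) * (\<Sum>b<N. cnj (W $$ (b, i)) * (\<Sum>h<N. W $$ (b, h) * x h)))"
      unfolding sum_distrib_right[of "\<lambda>i. complex_of_real (l i) * cnj (y i) * _ i"] sum_distrib_left[of "complex_of_real (l _) * _"]
      by (subst sum.swap) (simp add: mult_ac)
    also have "\<dots> = (\<Sum>i<N. l i * cnj (y i) * x i)"
      by (intro sum.cong refl) (simp add: WHW)
    finally show ?thesis .
  qed
  show thesis
  proof (rule that)
    show "w k = 1"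
    proof -
      have "(\<Sum>h<N. cnj (?V h k) * (complex_of_real (l h powr (-1/2)) * ?V h k)) = (\<Sum>h<N. complex_of_real (l h powr (-1/2)) * (cnj (?V h k) * ?V h k))"
        by (simp add: mult_ac)
      also have "\<dots> = complex_of_real T / of_nat N"
        by (simp add: dft_mat_orthonormal(3)[OF N _ k] T_def sum_divide_distrib)
      finally have "w k = complex_of_real (\<nu> / c\<^sup>2 * (T / real N))" by (simp add: w_def)
      also have "\<nu> / c\<^sup>2 * (T / real N) = 1" using T N unfolding c(2) \<nu>_def by (simp add: power2_eq_square)
      finally show ?thesis by simp
    qed
    show "p b = (\<Sum>j<N. F b j * w j)" if b: "b < N" for b
    proof -
      have y: "(\<Sum>j<N. X i j * w j) = y i" if i: "i < N" for i
      proof -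
        have "(\<Sum>j<N. X i j * w j) = complex_of_real (c * l i powr (-1/4) * (\<nu> / c\<^sup>2)) *
          (\<Sum>j<N. \<Sum>h<N. ?V i j * cnj (?V h j) * (complex_of_real (l h powr (-1/2)) * ?V h k))"
          unfolding X_def w_def by (simp add: sum_distrib_left mult_ac)
        also have "(\<Sum>j<N. \<Sum>h<N. ?V i j * cnj (?V h j) * (complex_of_real (l h powr (-1/2)) * ?V h k)) =
          (\<Sum>h<N. (\<Sum>j<N. ?V i j * cnj (?V h j)) * (complex_of_real (l h powr (-1/2)) * ?V h k))"
          unfolding sum_distrib_right by (rule sum.swap)
        also have "\<dots> = (\<Sum>h<N. if i = h then complex_of_real (l i powr (-1/2)) * ?V i k else 0)"
          by (intro sum.cong refl) (auto simp: dft_mat_orthonormal(2)[OF N i])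
        also have "\<dots> = complex_of_real (l i powr (-1/2)) * ?V i k" using i by simp
        also have "complex_of_real (c * l i powr (-1/4) * (\<nu> / c\<^sup>2)) * (complex_of_real (l i powr (-1/2)) * ?V i k) =
          complex_of_real (c * l i powr (-1/4) * (\<nu> / c\<^sup>2) * l i powr (-1/2)) * ?V i k" by simp
        also have "c * l i powr (-1/4) * (\<nu> / c\<^sup>2) * l i powr (-1/2) = \<nu> / c * (l i powr (-1/4) * l i powr (-1/2))"
          using c(1) by (simp add: field_simps power2_eq_square)
        also have "l i powr (-1/4) * l i powr (-1/2) = l i powr (-3/4)"
          by (simp add: powr_add[symmetric])
        finally show ?thesis by (simp add: y_def)
      qed
      have "(\<Sum>j<N. F b j * w j) = (\<Sum>j<N. \<Sum>i<N. W $$ (b, i) * (X i j * w j))"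
        by (intro sum.cong refl) (simp add: F[OF b] sum_distrib_right mult.assoc)
      also have "\<dots> = (\<Sum>i<N. W $$ (b, i) * (\<Sum>j<N. X i j * w j))"
        unfolding sum_distrib_left by (rule sum.swap)
      finally show ?thesis by (simp add: y p_def)
    qed
    show "(\<Sum>a<N. \<Sum>b<N. cnj (p a) * F b j * S $$ (a, b)) = 0" if j: "j < N" "j \<noteq> k" for j
    proof -
      have "(\<Sum>a<N. \<Sum>b<N. cnj (p a) * F b j * S $$ (a, b)) = (\<Sum>i<N. l i * cnj (y i) * X i j)"
        unfolding form[symmetric] by (intro sum.cong refl) (simp add: F[OF _ j(1)])
      \<comment> \<open>The powers 1, -3/4 and -1/4 of l i cancel, leaving the product of two
        different DFT columns.\<close>
      also have "\<dots> = (\<Sum>i<N. complex_of_real \<nu> * (cnj (?V i k) * ?V i j))"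
      proof (intro sum.cong refl)
        fix i assume "i \<in> {..<N}"
        then have li: "0 < l i" using l by simp
        have "l i * cnj (y i) * X i j = complex_of_real (l i * (\<nu> / c * l i powr (-3/4)) * (c * l i powr (-1/4))) * (cnj (?V i k) * ?V i j)"
          by (simp add: y_def X_def mult_ac)
        also have "l i * (\<nu> / c * l i powr (-3/4)) * (c * l i powr (-1/4)) = \<nu> * (l i powr 1 * (l i powr (-3/4) * l i powr (-1/4)))"
          using c(1) li by simp
        also have "l i powr 1 * (l i powr (-3/4) * l i powr (-1/4)) = 1"
          unfolding powr_add[symmetric] using li by simp
        finally show "l i * cnj (y i) * X i j = complex_of_real \<nu> * (cnj (?V i k) * ?V i j)" by simp
      qed
      also have "\<dots> = 0"
        using dft_mat_orthonormal(1)[OF N k j(1)] j(2) by (simp add: sum_distrib_left[symmetric])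
      finally show ?thesis .
    qed
    have "(\<Sum>a<N. \<Sum>b<N. cnj (p a) * p b * S $$ (a, b)) = (\<Sum>i<N. l i * cnj (y i) * y i)"
      unfolding form[symmetric] p_def ..
    \<comment> \<open>Here the powers 1, -3/4 and -3/4 combine to -1/2, so the sum over i is T
      again; with c^2 = 1 / T the total \<nu>^2 T^2 / N equals \<nu>.\<close>
    also have "\<dots> = (\<Sum>i<N. complex_of_real (\<nu>\<^sup>2 / c\<^sup>2 * l i powr (-1/2) / real N))"
    proof (intro sum.cong refl)
      fix i assume i: "i \<in> {..<N}"
      then have li: "0 < l i" using l by simp
      have "l i * cnj (y i) * y i = complex_of_real (l i * (\<nu> / c * l i powr (-3/4)) * (\<nu> / c * l i powr (-3/4))) * (cnj (?V i k) * ?V i k)"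
        by (simp add: y_def mult_ac)
      also have "cnj (?V i k) * ?V i k = 1 / of_nat N" using i by (intro dft_mat_orthonormal(3)[OF N _ k]) auto
      also have "l i * (\<nu> / c * l i powr (-3/4)) * (\<nu> / c * l i powr (-3/4)) = \<nu>\<^sup>2 / c\<^sup>2 * (l i powr 1 * (l i powr (-3/4) * l i powr (-3/4)))"
        using li by (simp add: power2_eq_square)
      also have "l i powr 1 * (l i powr (-3/4) * l i powr (-3/4)) = l i powr (-1/2)"
        unfolding powr_add[symmetric] by simp
      finally show "l i * cnj (y i) * y i = complex_of_real (\<nu>\<^sup>2 / c\<^sup>2 * l i powr (-1/2) / real N)" by simp
    qed
    also have "\<dots> = complex_of_real (\<nu>\<^sup>2 / c\<^sup>2 * T / real N)"
      unfolding of_real_sum[symmetric] by (simp only: T_def sum_distrib_left sum_divide_distrib)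
    also have "\<nu>\<^sup>2 / c\<^sup>2 * T / real N = \<nu>" using T N unfolding c(2) \<nu>_def by (simp add: power2_eq_square field_simps)
    finally show "cform N S p = real N / T\<^sup>2" unfolding cform_def \<nu>_def by (simp only: Re_complex_of_real)
  qed
qed

text \<open>A left inverse forces independent columns. W has its adjoint, and the remaining factor
  T^(-1/2) D^(-1/4) V, with D the diagonal matrix of eigenvalues, has T^(1/2) V^H D^(1/4).\<close>

lemma precoder_cols_indep:
  assumes E: "eigenvalue_decomposition N S W l" and l: "\<And>i. i < N \<Longrightarrow> 0 < l i" and N: "0 < N"
  shows "cols_indep N N (\<lambda>b j. precoder N W l $$ (b, j))"
proof -
  define T where "T = (\<Sum>i<N. l i powr (-1/2))"
  have T: "0 < T" unfolding T_def by (intro sum_pos) (use N in \<open>auto dest: l\<close>)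
  have U: "unitary_mat N W" using E by (simp add: eigenvalue_decomposition_def)
  then have Wc: "W \<in> carrier_mat N N" by (simp add: unitary_mat_def)
  have inv: "cols_indep N N f" if g: "\<And>i h. i < N \<Longrightarrow> h < N \<Longrightarrow> (\<Sum>b<N. g i b * f b h) = (if i = h then 1 else 0)" for f g
    unfolding cols_indep_def
  proof (intro allI impI)
    fix y j assume y: "\<forall>m<N. (\<Sum>j<N. f m j * y j) = 0" and j: "j < N"
    have "(\<Sum>b<N. g j b * (\<Sum>h<N. f b h * y h)) = (\<Sum>h<N. (\<Sum>b<N. g j b * f b h) * y h)"
      unfolding sum_distrib_left sum_distrib_right by (subst sum.swap) (simp add: mult.assoc)
    also have "\<dots> = (\<Sum>h<N. if j = h then y j else 0)"
      by (intro sum.cong refl) (auto simp: g[OF j])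
    finally have "(\<Sum>b<N. g j b * (\<Sum>h<N. f b h * y h)) = y j" using j by simp
    then show "y j = 0" using y by simp
  qed
  define X where "X i j = complex_of_real (1 / sqrt T * l i powr (-1/4)) * dft_mat N $$ (i, j)" for i j
  have "cols_indep N N (\<lambda>b i. W $$ (b, i))"
    by (rule inv[of "\<lambda>i b. cnj (W $$ (b, i))"]) (rule unitary_mat_rows_cols(2)[OF U])
  moreover have "cols_indep N N X"
  proof (rule inv[of "\<lambda>i b. cnj (dft_mat N $$ (b, i)) * complex_of_real (sqrt T * l b powr (1/4))"])
    fix i h assume ih: "i < N" "h < N"
    have eq: "cnj (dft_mat N $$ (b, i)) * complex_of_real (sqrt T * l b powr (1/4)) * X b h = cnj (dft_mat N $$ (b, i)) * dft_mat N $$ (b, h)"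
      if b: "b < N" for b
    proof -
      have "sqrt T * l b powr (1/4) * (1 / sqrt T * l b powr (-1/4)) = l b powr (1/4) * l b powr (-1/4)"
        using T by simp
      also have "\<dots> = 1" unfolding powr_add[symmetric] using l[OF b] by simp
      finally have "complex_of_real (sqrt T * l b powr (1/4)) * complex_of_real (1 / sqrt T * l b powr (-1/4)) = 1"
        unfolding of_real_mult[symmetric] by simp
      then show ?thesis unfolding X_def by (metis (no_types, lifting) mult.assoc mult_1)
    qed
    have "(\<Sum>b<N. cnj (dft_mat N $$ (b, i)) * complex_of_real (sqrt T * l b powr (1/4)) * X b h) =
      (\<Sum>b<N. cnj (dft_mat N $$ (b, i)) * dft_mat N $$ (b, h))"
      by (intro sum.cong refl eq) simp
    then show "(\<Sum>b<N. cnj (dft_mat N $$ (b, i)) * complex_of_real (sqrt T * l b powr (1/4)) * X b h) = (if i = h then 1 else 0)"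
      using dft_mat_orthonormal(1)[OF N ih] by simp
  qed
  ultimately have "cols_indep N N (\<lambda>b j. \<Sum>i<N. W $$ (b, i) * X i j)" by (rule cols_indep_mult)
  then show ?thesis
    unfolding cols_indep_def by (simp add: precoder_entry[OF Wc] X_def T_def)
qed

section \<open>Convergence of the SNR\<close>

lemma toeplitz_hermitian:
  assumes "\<And>i. \<sigma> (- i) = cnj (\<sigma> i)" "a < n" "b < n"
  shows "toeplitz \<sigma> n $$ (b, a) = cnj (toeplitz \<sigma> n $$ (a, b))"
  using assms(1)[of "int a - int b"] assms(2,3) by (simp add: toeplitz_def)

text \<open>The lower bound m of the symbol provides both ingredients of the concentration result
  for this precoder: positive eigenvalues and a definite covariance form.\<close>

lemma precoded_channel_tail:
  assumes P: "prob_space M" and sym: "\<And>i. \<sigma> (- i) = cnj (\<sigma> i)" and s: "has_symbol \<sigma> s"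
    and m: "0 < m" "AE \<omega> in period_measure. m \<le> s \<omega>"
    and H: "channel_matrix M n N (toeplitz \<sigma> N) H" and E: "eigenvalue_decomposition N (toeplitz \<sigma> N) W l"
    and k: "k < N" and n: "N \<le> n"
    and \<delta>: "measure (std_cgauss (n - N + 1)) {g\<in>space (std_cgauss (n - N + 1)).
      \<bar>(\<Sum>m<n - N + 1. (cmod (cg g m))\<^sup>2) / 2 - real (n - N + 1)\<bar> \<ge> \<epsilon> * real (n - N + 1)} \<le> \<delta>"
  defines "A \<equiv> \<lambda>x m j. \<Sum>b<N. H x $$ (m, b) * precoder N W l $$ (b, j)"
    and "\<nu> \<equiv> real N / (\<Sum>i<N. l i powr (-1/2))\<^sup>2"
  shows "AE x in M. cols_indep n N (A x)"
    and "measure M {x\<in>space M. cmod (col_dist2 n N k (A x) / \<nu> - of_nat (n - N + 1)) \<ge> \<epsilon> * real (n - N + 1)} \<le> \<delta>"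
    and "(\<lambda>x. col_dist2 n N k (A x)) \<in> borel_measurable M"
proof -
  have l: "0 < l i" if "i < N" for i
    using toeplitz_eigenvalue_lower_bound[OF s m(2) E that] m(1) by simp
  have T: "0 < (\<Sum>i<N. l i powr (-1/2))" by (intro sum_pos) (use k in \<open>auto dest: l\<close>)
  then have \<nu>: "0 < \<nu>" unfolding \<nu>_def using k by simp
  have pd: "cform N (toeplitz \<sigma> N) d \<noteq> 0" if d: "\<exists>a<N. d a \<noteq> 0" for d
  proof -
    obtain a where a: "a < N" "d a \<noteq> 0" using d by blast
    have "(\<Sum>a<N. (cmod (d a))\<^sup>2) > 0"
      by (rule sum_pos2[of _ a]) (use a in auto)
    then have "0 < m * (\<Sum>a<N. (cmod (d a))\<^sup>2)" using m(1) by simp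
    then show ?thesis using toeplitz_form_lower_bound[OF s m(2), of d N] by linarith
  qed
  obtain p w where pw: "\<And>j. j < N \<Longrightarrow> j \<noteq> k \<Longrightarrow> (\<Sum>a<N. \<Sum>b<N. cnj (p a) * precoder N W l $$ (b, j) * toeplitz \<sigma> N $$ (a, b)) = 0"
    "cform N (toeplitz \<sigma> N) p = \<nu>" "w k = 1" "\<And>b. b < N \<Longrightarrow> p b = (\<Sum>j<N. precoder N W l $$ (b, j) * w j)"
  proof (rule precoder_residual_direction[OF E l k])
    fix p w
    assume *: "\<And>j. j < N \<Longrightarrow> j \<noteq> k \<Longrightarrow> (\<Sum>a<N. \<Sum>b<N. cnj (p a) * precoder N W l $$ (b, j) * toeplitz \<sigma> N $$ (a, b)) = 0"
      "cform N (toeplitz \<sigma> N) p = real N / (\<Sum>i<N. l i powr (-1/2))\<^sup>2" "w k = 1" "\<And>b. b < N \<Longrightarrow> p b = (\<Sum>j<N. precoder N W l $$ (b, j) * w j)"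
    show thesis by (rule that[of p w]) (use * in \<open>simp_all add: \<nu>_def\<close>)
  qed
  have N0: "0 < N" using k by simp
  note main = precoded_col_dist2_concentration[where F="\<lambda>b j. precoder N W l $$ (b, j)" and p=p and w=w and \<nu>=\<nu>,
      OF P H k n toeplitz_hermitian[where \<sigma>=\<sigma>, OF sym] pd pw(1,2) \<nu> precoder_cols_indep[OF E l N0] pw(3,4) \<delta>]
  show "AE x in M. cols_indep n N (A x)"
    unfolding A_def by (rule main(1)) assumption+
  show "measure M {x\<in>space M. cmod (col_dist2 n N k (A x) / \<nu> - of_nat (n - N + 1)) \<ge> \<epsilon> * real (n - N + 1)} \<le> \<delta>"
    unfolding A_def by (rule main(2)) assumption+
  show "(\<lambda>x. col_dist2 n N k (A x)) \<in> borel_measurable M"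
    unfolding A_def by (rule main(3)) assumption+
qed

text \<open>The SNR is \<eta> times the deterministic factor \<nu> r times the squared distance
  divided by \<nu> r. The deterministic factor converges by Szego's theorem, and the random ratio
  tends to 1 almost surely by the tail bounds.\<close>

theorem mainTheorem7:
  fixes M :: "'w measure"
    and \<beta> \<eta> nv :: real
    and \<sigma> :: "int \<Rightarrow> complex"
    and s :: "real \<Rightarrow> real"
    and H :: "nat \<Rightarrow> 'w \<Rightarrow> complex mat"
    and W :: "nat \<Rightarrow> complex mat"
    and l :: "nat \<Rightarrow> nat \<Rightarrow> real"
    and k :: nat
  assumes "prob_space M"
    and "\<beta> > 1"
    and "nv > 0"
    and "\<eta> = 1 / nv"
    and "\<And>i. \<sigma> (- i) = cnj (\<sigma> i)"
    and "summable (\<lambda>i. (cmod (\<sigma> (int i)))\<^sup>2)"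
    and "has_symbol \<sigma> s"
    and "essinf period_measure s > 0"
    and "\<And>Nt Nr. 0 < Nt \<Longrightarrow> real Nr = \<beta> * real Nt \<Longrightarrow>
           channel_matrix M Nr Nt (toeplitz \<sigma> Nt) (H Nt)"
    and "\<And>Nt. 0 < Nt \<Longrightarrow> eigenvalue_decomposition Nt (toeplitz \<sigma> Nt) (W Nt) (l Nt)"
    and "k \<ge> 1"
  shows "AE x in M.
           ((\<lambda>Nt. snr nv (precoder Nt (W Nt) (l Nt)) (H Nt x) k) \<longlongrightarrow>
             complex_of_real
               (\<eta> * (\<beta> - 1) / (1 / (2 * pi) * (LINT \<omega>|period_measure. 1 / sqrt (s \<omega>)))\<^sup>2))
           (inf sequentially (principal (admissible_sizes \<beta>)))"
proof -
  note P = assms(1) and \<beta> = assms(2) and nv = assms(3,4) and sym = assms(5) and sm = assms(6) and sy = assms(7)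
    and H = assms(9) and E = assms(10) and k = assms(11)
  interpret prob_space M by (rule P)
  obtain m where m: "0 < m" "AE \<omega> in period_measure. m \<le> s \<omega>"
    using essinf_pos_lower_bound[OF assms(8)] by blast
  define \<Lambda> where "\<Lambda> = 1 / (2 * pi) * (LINT \<omega>|period_measure. 1 / sqrt (s \<omega>))"
  \<comment> \<open>The number of rows; the floor is exact on admissible sizes and only makes the
    function total.\<close>
  define n where "n N = nat \<lfloor>\<beta> * real N\<rfloor>" for N
  define T where "T N = (\<Sum>i<N. l N i powr (-1/2))" for N
  define \<nu> where "\<nu> N = real N / (T N)\<^sup>2" for N
  define r where "r N = n N - N + 1" for N
  define A where "A N x m j = (\<Sum>b<N. H N x $$ (m, b) * precoder N (W N) (l N) $$ (b, j))" for N x m j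
  define cd where "cd N x = col_dist2 (n N) N (k - 1) (A N x)" for N x
  \<comment> \<open>Sub-channel k exists only from size k on; the finitely many smaller sizes do not
    affect the limit.\<close>
  define G where "G = {N\<in>admissible_sizes \<beta>. k \<le> N}"
  have rn: "real (n N) = \<beta> * real N" if "N \<in> admissible_sizes \<beta>" for N
  proof -
    from that obtain q where "\<beta> * real N = real q" unfolding admissible_sizes_def Nats_def by auto
    then show ?thesis by (simp add: n_def)
  qed
  have Gn: "N \<le> n N" "0 < N" "k - 1 < N" "real (n N) = \<beta> * real N" "real (r N) = (\<beta> - 1) * real N + 1" if "N \<in> G" for N
  proof -
    have N: "N \<in> admissible_sizes \<beta>" "k \<le> N" using that by (auto simp: G_def)
    show "real (n N) = \<beta> * real N" by (rule rn[OF N(1)])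
    then have "real N \<le> real (n N)" using \<beta> by (simp add: mult_le_cancel_right1)
    then show nN: "N \<le> n N" by simp
    show "0 < N" "k - 1 < N" using N k by auto
    show "real (r N) = (\<beta> - 1) * real N + 1" using nN rn[OF N(1)] by (simp add: r_def of_nat_diff algebra_simps)
  qed
  have Tpos: "0 < T N" if "0 < N" for N
  proof -
    have l: "0 < l N i" if "i < N" for i
      using toeplitz_eigenvalue_lower_bound[OF sy m(2) E[OF \<open>0 < N\<close>] that] m(1) by simp
    show ?thesis unfolding T_def using that by (intro sum_pos) (auto dest: l)
  qed
  note tail = precoded_channel_tail[where \<sigma>=\<sigma>, OF P sym sy m H E]
  have ind: "AE x in M. \<forall>N\<in>G. cols_indep (n N) N (A N x)"
  proof (rule AE_ball_countable')
    fix N assume N: "N \<in> G"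
    show "AE x in M. cols_indep (n N) N (A N x)"
      unfolding A_def by (rule tail(1)[OF Gn(2,4)[OF N] Gn(2)[OF N] Gn(3,1)[OF N] order_refl])
  qed auto
  have conc: "AE x in M. eventually (\<lambda>N. N \<in> G \<longrightarrow> cmod (cd N x / \<nu> N - of_nat (r N)) < \<epsilon> * real (r N)) sequentially"
    if \<epsilon>: "0 < \<epsilon>" for \<epsilon>
  proof -
    obtain \<rho> where \<rho>: "0 < \<rho>" "\<rho> < 1" and \<rho>r: "\<And>r. measure (std_cgauss r) {g\<in>space (std_cgauss r). \<bar>(\<Sum>m<r. (cmod (cg g m))\<^sup>2) / 2 - real r\<bar> \<ge> \<epsilon> * real r} \<le> 2 * \<rho> ^ r"
      using std_cgauss_norm_concentration[OF \<epsilon>] by blast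
    \<comment> \<open>Empty outside G, so that the events form a sequence indexed by all N.\<close>
    define B where "B N = (if N \<in> G then {x\<in>space M. cmod (cd N x / \<nu> N - of_nat (r N)) \<ge> \<epsilon> * real (r N)} else {})" for N
    have Bs: "B N \<in> sets M" for N
    proof (cases "N \<in> G")
      case True
      have [measurable]: "cd N \<in> borel_measurable M"
        unfolding cd_def A_def by (rule tail(3)[OF Gn(2,4)[OF True] Gn(2)[OF True] Gn(3,1)[OF True] order_refl])
      show ?thesis unfolding B_def using True by simp
    qed (simp add: B_def)
    \<comment> \<open>Since \<open>r N\<close> exceeds (\<beta> - 1) N, the tail is dominated by a
      geometric sequence, whose ratio is below 1 because \<beta> > 1.\<close>
    have Bm: "prob (B N) \<le> 2 * (\<rho> powr (\<beta> - 1)) ^ N" for N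
    proof (cases "N \<in> G")
      case True
      have "prob (B N) \<le> 2 * \<rho> ^ (r N)"
        unfolding B_def cd_def A_def \<nu>_def T_def r_def using True
        by (simp only: if_True) (rule tail(2)[OF Gn(2,4)[OF True] Gn(2)[OF True] Gn(3,1)[OF True] \<rho>r])
      also have "\<rho> ^ (r N) = \<rho> powr real (r N)" using \<rho> by (simp add: powr_realpow)
      also have "\<dots> \<le> \<rho> powr ((\<beta> - 1) * real N)" using \<rho> Gn(5)[OF True] by (intro powr_mono') auto
      also have "\<dots> = (\<rho> powr (\<beta> - 1)) ^ N" using \<rho> by (simp add: powr_powr[symmetric] powr_realpow)
      finally show ?thesis by simp
    qed (simp add: B_def)
    have "\<rho> powr (\<beta> - 1) < 1" using \<rho> \<beta> by (simp add: powr_def mult_pos_neg)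
    then have "summable (\<lambda>N. 2 * (\<rho> powr (\<beta> - 1)) ^ N)" by (intro summable_mult summable_geometric) simp
    then have "summable (\<lambda>N. prob (B N))"
      by (rule summable_comparison_test'[where N=0]) (use Bm in simp)
    then have "AE x in M. eventually (\<lambda>N. x \<in> space M - B N) sequentially"
      by (intro borel_cantelli_AE1 Bs) (simp_all add: emeasure_eq_measure)
    then show ?thesis
    proof (rule eventually_mono)
      fix x assume "eventually (\<lambda>N. x \<in> space M - B N) sequentially"
      then show "eventually (\<lambda>N. N \<in> G \<longrightarrow> cmod (cd N x / \<nu> N - of_nat (r N)) < \<epsilon> * real (r N)) sequentially"
        by (rule eventually_mono) (auto simp: B_def)
    qed
  qed
  \<comment> \<open>Countably many tolerances suffice, and they share one null set.\<close>
  have conc_all: "AE x in M. \<forall>i::nat. eventually (\<lambda>N. N \<in> G \<longrightarrow> cmod (cd N x / \<nu> N - of_nat (r N)) < 1 / real (Suc i) * real (r N)) sequentially"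
    unfolding AE_all_countable by (intro allI conc) simp
  let ?F = "inf sequentially (principal (admissible_sizes \<beta>))"
  have evG: "eventually (\<lambda>N. N \<in> G) ?F"
    unfolding eventually_inf_principal G_def using eventually_ge_at_top[of k] by (rule eventually_mono) simp
  \<comment> \<open>Division by powers of N gives ((\<beta> - 1) + 1 / N) / (T / N)^2, where 1 / N
    stems from the summand 1 in \<open>r\<close>.\<close>
  have lim_c: "((\<lambda>N. \<nu> N * real (r N)) \<longlongrightarrow> (\<beta> - 1) / \<Lambda>\<^sup>2) ?F"
  proof -
    have "((\<lambda>N. T N / real N) \<longlongrightarrow> \<Lambda>) ?F"
      unfolding T_def \<Lambda>_def
      by (rule tendsto_mono[OF inf_le1 szego_inverse_sqrt[where \<sigma>=\<sigma>, OF sym sm sy E m]])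
    moreover have "((\<lambda>N. (\<beta> - 1) + 1 / real N) \<longlongrightarrow> (\<beta> - 1) + 0) ?F"
      by (intro tendsto_add tendsto_const tendsto_mono[OF inf_le1 lim_1_over_n])
    \<comment> \<open>The limit of the denominator must not vanish: an integrand that is positive
      almost everywhere on a set of positive measure has nonzero integral.\<close>
    moreover have "\<Lambda> \<noteq> 0"
    proof -
      interpret finite_measure period_measure by (rule finite_period_measure)
      have [measurable]: "s \<in> borel_measurable period_measure" using sy unfolding has_symbol_def by blast
      have int: "integrable period_measure (\<lambda>\<omega>. 1 / sqrt (s \<omega>))"
        by (rule integrable_const_bound[where B="1 / sqrt m"])
           (use m in \<open>auto elim!: eventually_mono intro!: divide_left_mono\<close>)
      have pos: "AE \<omega> in period_measure. 0 < 1 / sqrt (s \<omega>)" using m by (auto elim!: eventually_mono)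
      have "(LINT \<omega>|period_measure. 1 / sqrt (s \<omega>)) \<noteq> 0"
      proof
        assume "(LINT \<omega>|period_measure. 1 / sqrt (s \<omega>)) = 0"
        moreover have "AE \<omega> in period_measure. 0 \<le> 1 / sqrt (s \<omega>)"
          using pos by (rule eventually_mono) (rule less_imp_le)
        ultimately have "AE \<omega> in period_measure. 1 / sqrt (s \<omega>) = 0"
          using integral_nonneg_eq_0_iff_AE[OF int] by blast
        with pos have F: "AE \<omega> in period_measure. False" by eventually_elim simp
        have sp: "{\<omega> \<in> space period_measure. \<not> False} = space period_measure" by auto
        have "emeasure period_measure (space period_measure) = 0"
          by (rule iffD1[OF AE_iff_measurable[OF sets.top sp] F])
        then show False using measure_period_measure by (simp add: measure_def)
      qed
      then show ?thesis by (simp add: \<Lambda>_def)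
    qed
    ultimately have "((\<lambda>N. ((\<beta> - 1) + 1 / real N) / (T N / real N)\<^sup>2) \<longlongrightarrow> ((\<beta> - 1) + 0) / \<Lambda>\<^sup>2) ?F"
      by (intro tendsto_divide tendsto_power) auto
    moreover have "eventually (\<lambda>N. ((\<beta> - 1) + 1 / real N) / (T N / real N)\<^sup>2 = \<nu> N * real (r N)) ?F"
      using evG
    proof (rule eventually_mono)
      fix N assume N: "N \<in> G"
      have "((\<beta> - 1) + 1 / real N) = real (r N) / real N" using Gn(2,5)[OF N] by (simp add: field_simps)
      then show "((\<beta> - 1) + 1 / real N) / (T N / real N)\<^sup>2 = \<nu> N * real (r N)"
        using Gn(2)[OF N] by (simp add: \<nu>_def power2_eq_square)
    qed
    ultimately show ?thesis by (simp add: tendsto_cong)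
  qed
  show ?thesis
    using ind conc_all AE_space
  proof eventually_elim
    case (elim x)
    have z: "((\<lambda>N. cd N x / \<nu> N / of_nat (r N)) \<longlongrightarrow> 1) ?F"
    proof (rule tendstoI)
      fix e :: real assume "0 < e"
      then obtain i where i: "1 / real (Suc i) < e" using reals_Archimedean[of e] by (auto simp: inverse_eq_divide)
      have "eventually (\<lambda>N. N \<in> G \<longrightarrow> cmod (cd N x / \<nu> N - of_nat (r N)) < 1 / real (Suc i) * real (r N)) ?F"
        using elim(2) filter_leD[OF inf_le1] by blast
      with evG show "eventually (\<lambda>N. dist (cd N x / \<nu> N / of_nat (r N)) 1 < e) ?F"
      proof eventually_elim
        case (elim N)
        have r0: "0 < real (r N)" by (simp add: r_def)
        have "cd N x / \<nu> N / of_nat (r N) - 1 = (cd N x / \<nu> N - of_nat (r N)) / of_nat (r N)"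
          using r0 by (simp add: diff_divide_distrib)
        then have "dist (cd N x / \<nu> N / of_nat (r N)) 1 = cmod (cd N x / \<nu> N - of_nat (r N)) / real (r N)"
          by (simp add: dist_norm norm_divide)
        also have "\<dots> < 1 / real (Suc i)" using elim r0 by (simp add: pos_divide_less_eq)
        finally show ?case using i by simp
      qed
    qed
    have "((\<lambda>N. complex_of_real \<eta> * complex_of_real (\<nu> N * real (r N)) * (cd N x / \<nu> N / of_nat (r N))) \<longlongrightarrow>
       complex_of_real \<eta> * complex_of_real ((\<beta> - 1) / \<Lambda>\<^sup>2) * 1) ?F"
      by (intro tendsto_mult tendsto_const tendsto_of_real lim_c z)
    moreover have "eventually (\<lambda>N. complex_of_real \<eta> * complex_of_real (\<nu> N * real (r N)) * (cd N x / \<nu> N / of_nat (r N)) =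
       snr nv (precoder N (W N) (l N)) (H N x) k) ?F"
      using evG
    proof (rule eventually_mono)
      fix N assume N: "N \<in> G"
      have \<nu>0: "\<nu> N \<noteq> 0" using Gn(2)[OF N] Tpos[of N] by (simp add: \<nu>_def)
      have r0: "r N \<noteq> 0" by (simp add: r_def)
      have Wc: "W N \<in> carrier_mat N N" using E[OF Gn(2)[OF N]] by (simp add: eigenvalue_decomposition_def unitary_mat_def)
      have Hc: "H N x \<in> carrier_mat (n N) N" using H[OF Gn(2,4)[OF N]] elim(3) by (simp add: channel_matrix_def)
      have i: "cols_indep (n N) N (\<lambda>m j. \<Sum>b<N. H N x $$ (m, b) * precoder N (W N) (l N) $$ (b, j))"
        using elim(1) N unfolding A_def by blast
      have kN: "k \<le> N" using N by (simp add: G_def)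
      have "snr nv (precoder N (W N) (l N)) (H N x) k = 1 / complex_of_real nv * cd N x"
        unfolding cd_def A_def by (rule snr_eq_col_dist2[OF Hc precoder_carrier[OF Wc] k kN Gn(1)[OF N] i])
      then show "complex_of_real \<eta> * complex_of_real (\<nu> N * real (r N)) * (cd N x / \<nu> N / of_nat (r N)) =
       snr nv (precoder N (W N) (l N)) (H N x) k"
        using \<nu>0 r0 nv by simp
    qed
    ultimately have "((\<lambda>N. snr nv (precoder N (W N) (l N)) (H N x) k) \<longlongrightarrow> complex_of_real \<eta> * complex_of_real ((\<beta> - 1) / \<Lambda>\<^sup>2) * 1) ?F"
      by (rule Lim_transform_eventually)
    then show ?case unfolding \<Lambda>_def by simp
  qed
qed

end
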